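(* Let $\ell>0$, let $a\in\mathbb{R}$, let $(u,\mu)\in\mathcal{D}_{\mathrm{per}}$ and let $(u_k,\mu_k)$ be a sequence of pairs in $\mathcal{D}_{\mathrm{per}}$. For $z\in\mathbb{C}$ let $s(z,\cdot)$ and $s_k(z,\cdot)$ denote the solutions, normalized at the base point $a$ as described in the context, of the differential equations associated with $(u,\mu)$ and $(u_k,\mu_k)$, respectively. If the pairs $(u_k,\mu_k)$ converge to $(u,\mu)$ in $\mathcal{D}_{\mathrm{per}}$ as $k\to\infty$, then the entire functions $z\mapsto s_k(z,a+\ell)$ converge to $z\mapsto s(z,a+\ell)$ locally uniformly on $\mathbb{C}$.
   Context: Borel measures on $\mathbb{R}$ are assumed finite on compact sets. Fix $\ell>0$. $H^1_{\mathrm{loc}}(\mathbb{R})$ is the space of locally absolutely continuous functions with locally square integrable derivative, and $H^1_{\mathrm{c}}(\mathbb{R})$ the subspace of those with compact support. $\mathcal{D}_{\mathrm{per}}$ is the set of all pairs $(u,\mu)$ such that $u$ is an $\ell$-periodic real-valued function in $H^1_{\mathrm{loc}}(\mathbb{R})$ and $\mu$ is an $\ell$-periodic non-negative Borel measure on $\mathbb{R}$ with $\mu(B)\ge\int_B u(x)^2+u'(x)^2\,dx$ for every Borel set $B\subseteq\mathbb{R}$. Topology: $\mathcal{D}_{\mathrm{per}}$ carries the initial topology with respect to the functionals $(u,\mu)\mapsto\int_{\mathbb{R}}u(x)h(x)\,dx+\int_{\mathbb{R}}u'(x)h'(x)\,dx+\int_{\mathbb{R}}g\,d\mu$ for all $h\in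 H^1_{\mathrm{c}}(\mathbb{R})$ and $g\in C_{\mathrm{c}}(\mathbb{R})$ (continuous functions with compact support). With $(u,\mu)$ one associates the distribution $\omega(h)=\int_{\mathbb{R}}u h\,dx+\int_{\mathbb{R}}u'h'\,dx$, $h\in H^1_{\mathrm{c}}(\mathbb{R})$ (i.e. $\omega=u-u''$), and the $\ell$-periodic non-negative Borel measure $\upsilon$ given by $\mu(B)=\int_B u(x)^2+u'(x)^2\,dx+\upsilon(B)$ for all Borel sets $B$. For $z\in\mathbb{C}$, a solution of $$-f''+\tfrac14 f=z\,\omega f+z^2\upsilon f\qquad(\mathrm{E})$$ is a (complex-valued) function $f\in H^1_{\mathrm{loc}}(\mathbb{R})$ with $\int_{\mathbb{R}}f'h'\,dx+\frac14\int_{\mathbb{R}}fh\,dx=z\,\omega(fh)+z^2\int_{\mathbb{R}}fh\,d\upsilon$ for all $h\in H^1_{\mathrm{c}}(\mathbb{R})$. For each solution $f$ there is a unique left-continuous function $f^{[1]}$ (the quasi-derivative) with $f^{[1]}=f'-zu'f$ almost everywhere. For every $a\in\mathbb{R}$ and $d_1,d_2\in\mathbb{C}$ there is a unique solution of (E) with $f(a)=d_1$, $f^{[1]}(a)=d_2$. Given the base point $a$, $s(z,\cdot)$ is the solution of (E) with $s(z,a)=0$, $s^{[1]}(z,a)=1$; for each $x\in\mathbb{R}$ the function $z\mapsto s(z,x)$ is entire. $s_k(z,\cdot)$ is defined in the same way from $(u_k,\mu_k)$. *)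

theory Defs
  imports "HOL-Analysis.Analysis"
begin

subsection \<open>The spaces \<open>H\<^sup>1\<^sub>l\<^sub>o\<^sub>c(\<real>)\<close>, \<open>H\<^sup>1\<^sub>c(\<real>)\<close> and \<open>C\<^sub>c(\<real>)\<close>\<close>

text \<open>
  A locally absolutely continuous function is differentiable almost everywhere, so the pointwise
  derivative represents the almost-everywhere class \<open>f'\<close>.  Where \<open>f\<close> is not differentiable,
  the value is unspecified; it is only used under integrals and in almost-everywhere statements.
\<close>
abbreviation ddx :: "(real \<Rightarrow> 'a::real_normed_vector) \<Rightarrow> real \<Rightarrow> 'a" where
  "ddx f x \<equiv> vector_derivative f (at x)"

text \<open>
  The classical epsilon-delta condition; a finite family of non-overlapping subintervals of
  \<open>[a, b]\<close> is encoded as a finite set of pairs of endpoints.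
\<close>
definition abs_cont_on :: "real \<Rightarrow> real \<Rightarrow> (real \<Rightarrow> 'a::real_normed_vector) \<Rightarrow> bool" where
  "abs_cont_on a b f \<longleftrightarrow>
     (\<forall>e>0. \<exists>\<delta>>0. \<forall>D :: (real \<times> real) set.
        finite D \<longrightarrow> (\<forall>(c, d)\<in>D. a \<le> c \<and> c \<le> d \<and> d \<le> b) \<longrightarrow>
        disjoint_family_on (\<lambda>(c, d). {c<..<d}) D \<longrightarrow>
        (\<Sum>(c, d)\<in>D. d - c) < \<delta> \<longrightarrow>
        (\<Sum>(c, d)\<in>D. norm (f d - f c)) < e)"

definition H1loc :: "(real \<Rightarrow> 'a::euclidean_space) set" where
  "H1loc = {f. \<forall>a b. abs_cont_on a b f \<and>
                 (\<lambda>x. (norm (ddx f x))\<^sup>2) absolutely_integrable_on {a..b}}"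

definition compactly_supported :: "(real \<Rightarrow> 'a::zero) \<Rightarrow> bool" where
  "compactly_supported f \<longleftrightarrow> compact (closure {x. f x \<noteq> 0})"

definition H1c :: "(real \<Rightarrow> 'a::euclidean_space) set" where
  "H1c = {h \<in> H1loc. compactly_supported h}"

definition Cc :: "(real \<Rightarrow> 'a::real_normed_vector) set" where
  "Cc = {g. continuous_on UNIV g \<and> compactly_supported g}"


subsection \<open>The phase space and its topology\<close>

definition periodic_measure :: "real \<Rightarrow> real measure \<Rightarrow> bool" where
  "periodic_measure l M \<longleftrightarrow>
     (\<forall>B\<in>sets borel. emeasure M ((\<lambda>x. x + l) ` B) = emeasure M B)"

definition Dper :: "real \<Rightarrow> ((real \<Rightarrow> real) \<times> real measure) set" where
  "Dper l = {(u, M).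
     u \<in> H1loc \<and> (\<forall>x. u (x + l) = u x) \<and>
     sets M = sets borel \<and> (\<forall>K. compact K \<longrightarrow> emeasure M K < \<infinity>) \<and> periodic_measure l M \<and>
     (\<forall>B\<in>sets borel. emeasure M B \<ge> (\<integral>\<^sup>+x\<in>B. ennreal ((u x)\<^sup>2 + (ddx u x)\<^sup>2) \<partial>lebesgue))}"

definition omega :: "(real \<Rightarrow> real) \<Rightarrow> (real \<Rightarrow> complex) \<Rightarrow> complex" where
  "omega u h = (LINT x|lebesgue. of_real (u x) * h x) + (LINT x|lebesgue. of_real (ddx u x) * ddx h x)"

definition Dper_functional ::
  "(real \<Rightarrow> complex) \<Rightarrow> (real \<Rightarrow> complex) \<Rightarrow> (real \<Rightarrow> real) \<times> real measure \<Rightarrow> complex" where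
  "Dper_functional h g = (\<lambda>(u, M). omega u h + (LINT x|M. g x))"

definition Dper_topology :: "real \<Rightarrow> ((real \<Rightarrow> real) \<times> real measure) topology" where
  "Dper_topology l = topology_generated_by
     {{p \<in> Dper l. Dper_functional h g p \<in> U} | h g U. h \<in> H1c \<and> g \<in> Cc \<and> open U}"


subsection \<open>The differential equation\<close>

text \<open>
  The measure is introduced by the additive identity rather than by subtraction because both
  terms may be infinite on unbounded sets.
\<close>
definition upsilon :: "(real \<Rightarrow> real) \<Rightarrow> real measure \<Rightarrow> real measure" where
  "upsilon u M = (THE N. sets N = sets borel \<and>
     (\<forall>B\<in>sets borel. emeasure M B =
        (\<integral>\<^sup>+x\<in>B. ennreal ((u x)\<^sup>2 + (ddx u x)\<^sup>2) \<partial>lebesgue) + emeasure N B))"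

definition is_solution ::
  "(real \<Rightarrow> real) \<Rightarrow> real measure \<Rightarrow> complex \<Rightarrow> (real \<Rightarrow> complex) \<Rightarrow> bool" where
  "is_solution u M z f \<longleftrightarrow> f \<in> H1loc \<and>
     (\<forall>h\<in>H1c.
        (LINT x|lebesgue. ddx f x * ddx h x) + 1/4 * (LINT x|lebesgue. f x * h x) =
        z * omega u (\<lambda>x. f x * h x) + z\<^sup>2 * (LINT x|upsilon u M. f x * h x))"

definition is_quasi_derivative ::
  "(real \<Rightarrow> real) \<Rightarrow> complex \<Rightarrow> (real \<Rightarrow> complex) \<Rightarrow> (real \<Rightarrow> complex) \<Rightarrow> bool" where
  "is_quasi_derivative u z f q \<longleftrightarrow>
     (\<forall>x. continuous (at_left x) q) \<and>
     (AE x in lebesgue. q x = ddx f x - z * of_real (ddx u x) * f x)"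

definition solves_ivp ::
  "(real \<Rightarrow> real) \<Rightarrow> real measure \<Rightarrow> complex \<Rightarrow> real \<Rightarrow> complex \<Rightarrow> complex \<Rightarrow> (real \<Rightarrow> complex) \<Rightarrow> bool" where
  "solves_ivp u M z a d1 d2 f \<longleftrightarrow> is_solution u M z f \<and> f a = d1 \<and>
     (\<exists>q. is_quasi_derivative u z f q \<and> q a = d2)"

end

theory Submission
  imports Defs
begin

text \<open>
  With \<open>\<phi> = exp (- z u) f\<close> and \<open>\<psi> = exp (z u) f\<^sup>[\<^sup>1\<^sup>]\<close>, equation (E) becomes
  \<open>\<phi>' = exp (- 2 z u) \<psi>\<close>, \<open>d\<psi> = exp (2 z u) \<phi> ((1/4 - z u + z\<^sup>2 u\<^sup>2) dx - z\<^sup>2 d\<mu>)\<close>: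
  the derivative \<open>u'\<close> and the measure \<open>\<upsilon>\<close> have disappeared in favour of \<open>u\<close> and \<open>\<mu>\<close>.
  Integrating twice gives a Volterra equation for the continuous function \<open>\<phi>\<close> whose kernel
  is continuous and vanishes on the diagonal.  Convergence in the phase space amounts to locally uniform
  convergence of \<open>u\<close> (pointwise by testing with a function whose periodization is a multiple of
  Green's function, and equicontinuous since \<open>\<mu>\<close> bounds \<open>\<integral> u'\<^sup>2\<close>) and vague convergence of \<open>\<mu>\<close>, which is all the
  Volterra equation needs.  Locally uniform convergence in \<open>z\<close> follows by letting the
  spectral parameter vary along a convergent sequence \<open>z\<^sub>k\<close>.

  Almost everywhere differentiability of absolutely continuous functions is obtained from Vitali's
  covering theorem.
\<close>

subsection \<open>Functions of bounded variation\<close>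

text \<open>The obstacle is that neither \<open>upsilon\<close> nor f^[1] behaves well in the limit.
  Oscillations of u_k of vanishing size but non-vanishing slope leave a trace in \<mu> that
  reappears as a part of \<open>upsilon\<close>, so the measures \<upsilon>_k need not converge to
  \<upsilon>; and f^[1] jumps at atoms of \<open>upsilon\<close>, while the \<mu>_k converge only
  against continuous functions. In the gauged equation only \<mu> is left, and integrating twice
  leaves only the continuous \<phi> under it. Cutting the integrals off at a and x could still
  charge atoms at these points. This does not happen because the kernel vanishes at s = x and, for
  the solution normalized by s(z, a) = 0, \<phi>(a) = 0. The integrand, extended through
  \<open>max a s\<close>, therefore lies in \<open>Cc\<close>, and vague convergence applies to it
  directly. The limit \<phi> is then inserted into the k-th Volterra equation: the defect tends to
  zero, and a stability estimate whose constant depends only on bounds for u_k, z_k and the mass of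
  \<mu>_k turns it into a bound for \<phi>_k - \<phi>.\<close>

lemma sum_mono_increments_le:
  fixes Q :: "real \<Rightarrow> real" and lo hi :: "'i \<Rightarrow> real"
  assumes "finite I" "mono_on {a..b} Q" "a \<le> b"
    and "\<And>i. i \<in> I \<Longrightarrow> a \<le> lo i \<and> lo i \<le> hi i \<and> hi i \<le> b"
    and "disjoint_family_on (\<lambda>i. {lo i<..<hi i}) I"
  shows "(\<Sum>i\<in>I. Q (hi i) - Q (lo i)) \<le> Q b - Q a"
  using assms
proof (induction "card I" arbitrary: I b)
  case 0
  then have "Q a \<le> Q b" by (intro mono_onD[of "{a..b}" Q]) auto
  with 0 show ?case by auto
next
  case (Suc n)
  show ?case
  \<comment> \<open>Degenerate indices are discarded first: their open intervals are empty, so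
    disjointness says nothing about their position. Once all intervals are proper, the one with the
    largest left end lies to the right of all others.\<close>
  proof (cases "\<exists>i\<in>I. lo i = hi i")
    case True
    then obtain i where i: "i \<in> I" "lo i = hi i" by auto
    have "(\<Sum>i\<in>I-{i}. Q (hi i) - Q (lo i)) \<le> Q b - Q a"
      using Suc.prems i Suc.hyps(2)
      by (intro Suc.hyps(1)) (auto simp: disjoint_family_on_def)
    then show ?thesis using Suc.prems(1) i by (simp add: sum.remove[OF _ i(1)])
  next
    case False
    have "I \<noteq> {}" using Suc.hyps(2) by auto
    then obtain i where i: "i \<in> I" and imax: "\<And>j. j \<in> I \<Longrightarrow> lo j \<le> lo i"
      using finite_has_maximal[of "lo ` I"] Suc.prems(1)
      by (metis (no_types, lifting) Max_ge Max_in finite_imageI image_iff image_is_empty)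
    have le: "hi j \<le> lo i" if "j \<in> I - {i}" for j
    proof (rule ccontr)
      assume "\<not> hi j \<le> lo i"
      moreover have "lo i < hi i" "lo j < hi j"
        using False i that Suc.prems(4) by (force simp: order.order_iff_strict)+
      moreover have "{lo i<..<hi i} \<inter> {lo j<..<hi j} = {}"
        using Suc.prems(5) i that by (auto simp: disjoint_family_on_def)
      moreover obtain m where "lo i < m" "m < min (hi i) (hi j)"
        using dense[of "lo i" "min (hi i) (hi j)"] calculation by auto
      moreover have "lo j \<le> lo i" using imax that by auto
      ultimately have "m \<in> {lo i<..<hi i} \<inter> {lo j<..<hi j}" by auto
      with \<open>{lo i<..<hi i} \<inter> {lo j<..<hi j} = {}\<close> show False by blast
    qed
    have "(\<Sum>i\<in>I-{i}. Q (hi i) - Q (lo i)) \<le> Q (lo i) - Q a"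
    proof (intro Suc.hyps(1))
      show "mono_on {a..lo i} Q"
        using Suc.prems(2) Suc.prems(4)[OF i] by (auto intro: mono_on_subset)
    qed (use Suc.prems i Suc.hyps(2) le in \<open>auto simp: disjoint_family_on_def\<close>)
    moreover have "Q (hi i) \<le> Q b"
      using Suc.prems(4)[OF i] Suc.prems(3) by (intro mono_onD[OF Suc.prems(2)]) auto
    ultimately show ?thesis using Suc.prems(1) i by (simp add: sum.remove[OF _ i])
  qed
qed

text \<open>Vitali's theorem extracts countably many disjoint intervals \<open>{p..q}\<close> that
  cover S up to a null set. On each of them k times the length is at most the rise of Q, and these
  rises add up to at most \<open>Q b - Q a\<close>. A measurable superset W stands in for S, whose
  measurability is not assumed.\<close>

lemma vitali_steep_bound:
  fixes Q :: "real \<Rightarrow> real"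
  assumes Q: "mono_on {a..b} Q" and ab: "a \<le> b" and k: "k > 0"
    and S: "\<And>x e. x \<in> S \<Longrightarrow> e > 0 \<Longrightarrow>
      \<exists>p q. a \<le> p \<and> p < q \<and> q \<le> b \<and> x \<in> {p..q} \<and> q - p < e \<and> k * (q - p) \<le> Q q - Q p"
  shows "\<exists>W. S \<subseteq> W \<and> W \<in> lmeasurable \<and> measure lebesgue W \<le> (Q b - Q a) / k"
proof -
  define K where "K = {(p, q). a \<le> p \<and> p < q \<and> q \<le> b \<and> k * (q - p) \<le> Q q - Q p}"
  \<comment> \<open>Midpoint and half-length, since the covering theorem speaks of balls.\<close>
  define m r where "m = (\<lambda>(p, q). (p + q) / 2 :: real)" and "r = (\<lambda>(p, q). (q - p) / 2 :: real)"
  have cb: "cball (m i) (r i) = {fst i..snd i}" for i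
    by (cases i) (auto simp: m_def r_def cball_eq_atLeastAtMost field_simps)
  obtain C where C: "countable C" "C \<subseteq> K"
     "pairwise (\<lambda>i j. disjnt (cball (m i) (r i)) (cball (m j) (r j))) C"
     "negligible (S - (\<Union>i \<in> C. cball (m i) (r i)))"
  proof (rule Vitali_covering_theorem_cballs[of K r S m])
    show "\<And>i. i \<in> K \<Longrightarrow> 0 < r i" by (auto simp: K_def r_def)
    fix x d :: real assume "x \<in> S" "0 < d"
    from S[OF this] obtain p q where "a \<le> p \<and> p < q \<and> q \<le> b \<and> x \<in> {p..q} \<and> q - p < d \<and> k * (q - p) \<le> Q q - Q p"
      by blast
    then show "\<exists>i. i \<in> K \<and> x \<in> cball (m i) (r i) \<and> r i < d"
      by (unfold cb, intro exI[of _ "(p, q)"]) (auto simp: K_def r_def)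
  qed
  let ?U = "\<Union>i\<in>C. {fst i..snd i}"
  have fin: "(\<Sum>i\<in>F. snd i - fst i) \<le> (Q b - Q a) / k" if F: "finite F" "F \<subseteq> C" for F
  proof -
    have "(\<Sum>i\<in>F. Q (snd i) - Q (fst i)) \<le> Q b - Q a"
    proof (rule sum_mono_increments_le[OF F(1) Q ab])
      show "disjoint_family_on (\<lambda>i. {fst i<..<snd i}) F"
        unfolding disjoint_family_on_def
      proof (intro ballI impI)
        fix i j assume "i \<in> F" "j \<in> F" "i \<noteq> j"
        then have "disjnt {fst i..snd i} {fst j..snd j}"
          using C(3) F(2) by (auto simp: pairwise_def cb)
        moreover have "{fst i<..<snd i} \<subseteq> {fst i..snd i}" "{fst j<..<snd j} \<subseteq> {fst j..snd j}" by auto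
        ultimately show "{fst i<..<snd i} \<inter> {fst j<..<snd j} = {}"
          unfolding disjnt_def by blast
      qed
    qed (use F C(2) in \<open>auto simp: K_def\<close>)
    moreover have "k * (\<Sum>i\<in>F. snd i - fst i) \<le> (\<Sum>i\<in>F. Q (snd i) - Q (fst i))"
      unfolding sum_distrib_left using F C(2) by (intro sum_mono) (auto simp: K_def)
    ultimately show ?thesis using k by (simp add: field_simps)
  qed
  have U: "?U \<in> lmeasurable \<and> measure lebesgue ?U \<le> (Q b - Q a) / k"
  proof -
    have F: "measure lebesgue (\<Union>i\<in>F. {fst i..snd i}) \<le> (Q b - Q a) / k" if "finite F" "F \<subseteq> C" for F
    proof -
      have "measure lebesgue (\<Union>i\<in>F. {fst i..snd i}) \<le> (\<Sum>i\<in>F. measure lebesgue {fst i..snd i})"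
        using that(1) by (intro measure_UNION_le) auto
      also have "\<dots> = (\<Sum>i\<in>F. snd i - fst i)"
        using that C(2) by (intro sum.cong) (auto simp: K_def)
      finally show ?thesis using fin[OF that] by linarith
    qed
    then show ?thesis
      using fmeasurable_UN_bound[OF C(1), of "\<lambda>i. {fst i..snd i}" lebesgue "(Q b - Q a) / k"]
        measure_UN_bound[OF C(1), of "\<lambda>i. {fst i..snd i}" lebesgue "(Q b - Q a) / k"]
      by (simp add: F)
  qed
  have neg: "negligible (S - ?U)" using C(4) by (simp add: cb)
  show ?thesis
  proof (intro exI conjI)
    show "S \<subseteq> ?U \<union> (S - ?U)" by auto
    show "?U \<union> (S - ?U) \<in> lmeasurable" using U neg negligible_imp_measurable by blast
    have "measure lebesgue (?U \<union> (S - ?U)) \<le> measure lebesgue ?U + measure lebesgue (S - ?U)"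
      using U neg negligible_imp_measurable by (intro measure_Un_le) (auto simp: fmeasurableD)
    also have "measure lebesgue (S - ?U) = 0" using neg negligible_imp_measure0 by blast
    finally show "measure lebesgue (?U \<union> (S - ?U)) \<le> (Q b - Q a) / k" using U by simp
  qed
qed

section \<open>Variation over finite families of non-overlapping intervals\<close>

definition subintervals :: "real \<Rightarrow> real \<Rightarrow> (real \<times> real) set set" where
  "subintervals a b = {D. finite D \<and> (\<forall>(c, d)\<in>D. a \<le> c \<and> c \<le> d \<and> d \<le> b) \<and>
     disjoint_family_on (\<lambda>(c, d). {c<..<d}) D}"

definition total_increment :: "(real \<Rightarrow> 'a::real_normed_vector) \<Rightarrow> (real \<times> real) set \<Rightarrow> real" where
  "total_increment f D = (\<Sum>(c, d)\<in>D. norm (f d - f c))"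

definition bounded_var :: "real \<Rightarrow> real \<Rightarrow> (real \<Rightarrow> 'a::real_normed_vector) \<Rightarrow> bool" where
  "bounded_var a b f \<longleftrightarrow> bdd_above (total_increment f ` subintervals a b)"

definition variation :: "real \<Rightarrow> (real \<Rightarrow> 'a::real_normed_vector) \<Rightarrow> real \<Rightarrow> real" where
  "variation a f x = (SUP D\<in>subintervals a x. total_increment f D)"

lemma abs_cont_on_altdef:
  "abs_cont_on a b f \<longleftrightarrow>
     (\<forall>e>0. \<exists>\<delta>>0. \<forall>D\<in>subintervals a b. (\<Sum>(c, d)\<in>D. d - c) < \<delta> \<longrightarrow> total_increment f D < e)"
  unfolding abs_cont_on_def subintervals_def total_increment_def by (simp add: imp_conjL)

lemma empty_subintervals [simp]: "{} \<in> subintervals a b"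
  by (simp add: subintervals_def disjoint_family_on_def)

lemma subintervals_mono: "a' \<le> a \<Longrightarrow> b \<le> b' \<Longrightarrow> subintervals a b \<subseteq> subintervals a' b'"
  by (force simp: subintervals_def)

lemma bounded_var_subset: "bounded_var a b f \<Longrightarrow> y \<le> b \<Longrightarrow> bdd_above (total_increment f ` subintervals a y)"
  unfolding bounded_var_def
  by (erule bdd_above_mono) (intro image_mono subintervals_mono, auto)

lemma sum_lengths_le:
  assumes "D \<in> subintervals a b" "a \<le> b"
  shows "(\<Sum>(c, d)\<in>D. d - c) \<le> b - a"
  using sum_mono_increments_le[of D a b "\<lambda>x. x" fst snd] assms
  by (auto simp: subintervals_def case_prod_unfold mono_on_def)

lemma variation_nonneg:
  assumes "bounded_var a b f" "y \<le> b" 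
  shows "0 \<le> variation a f y"
proof -
  have "total_increment f {} \<le> variation a f y"
    unfolding variation_def by (intro cSUP_upper bounded_var_subset[OF assms]) auto
  then show ?thesis by (simp add: total_increment_def)
qed

text \<open>The interval from x to y is added to an arbitrary family in \<open>{a..x}\<close>. This
  superadditivity makes the variation increasing and lets its increments dominate those of f, so
  that slope bounds for f become slope bounds for a monotone function.\<close>

lemma variation_increment:
  assumes bv: "bounded_var a b f" and xy: "a \<le> x" "x \<le> y" "y \<le> b"
  shows "variation a f x + norm (f y - f x) \<le> variation a f y"
proof (cases "x = y")
  case True
  then show ?thesis by simp
next
  case False
  with xy have lt: "x < y" by auto
  have "total_increment f D \<le> variation a f y - norm (f y - f x)" if D: "D \<in> subintervals a x" for D
  proof -
    have nin: "(x, y) \<notin> D" using D lt by (auto simp: subintervals_def)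
    have "insert (x, y) D \<in> subintervals a y"
      using D xy nin by (force simp: subintervals_def disjoint_family_on_def)
    then have "total_increment f (insert (x, y) D) \<le> variation a f y"
      unfolding variation_def by (intro cSUP_upper bounded_var_subset[OF bv xy(3)]) auto
    moreover have "finite D" using D by (simp add: subintervals_def)
    ultimately show ?thesis using nin by (simp add: total_increment_def)
  qed
  then have "variation a f x \<le> variation a f y - norm (f y - f x)"
    unfolding variation_def[of a f x] by (intro cSUP_least) (auto intro: empty_subintervals)
  then show ?thesis by simp
qed

lemma mono_on_variation: "bounded_var a b f \<Longrightarrow> mono_on {a..b} (variation a f)"
  by (rule mono_onI) (smt (verit, best) variation_increment norm_ge_zero atLeastAtMost_iff)

section \<open>Points of oscillation and of infinite slope\<close>

text \<open>The point x may lie anywhere in the short interval, as Vitali coverings allow;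
  \<open>steep_upI\<close> obtains the property from difference quotients at x. Steep descent is
  expressed by passing to -f.\<close>

definition steep_up :: "(real \<Rightarrow> real) \<Rightarrow> real \<Rightarrow> real \<Rightarrow> bool" where
  "steep_up f k x \<longleftrightarrow> (\<forall>e>0. \<exists>p q. p < q \<and> x \<in> {p..q} \<and> q - p < e \<and> k * (q - p) \<le> f q - f p)"

text \<open>A family \<open>D\<close> whose total increment is within \<open>e\<close> of the total variation leaves
  the monotone function \<open>Q = variation - g\<close> with total rise at most \<open>e\<close>, where \<open>g\<close> follows
  \<open>f\<close> on the members of \<open>D\<close> with signs chosen so that it increases over each of them.
  At an oscillation point \<open>f\<close> also moves against the sign, so \<open>Q\<close> is steep there.\<close>
lemma bounded_var_oscillation_cover:
  fixes f :: "real \<Rightarrow> real"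
  assumes bv: "bounded_var a b f" and ab: "a < b" and k: "k > 0" and e: "e > 0"
  shows "\<exists>W N. {x \<in> {a<..<b}. steep_up f k x \<and> steep_up (\<lambda>x. - f x) k x} \<subseteq> W \<union> N \<and>
     finite N \<and> W \<in> lmeasurable \<and> measure lebesgue W \<le> e / k"
proof -
  define V where "V = variation a f"
  have "\<exists>D\<in>subintervals a b. V b - e < total_increment f D"
    unfolding V_def variation_def
    by (rule less_cSUP_iff[THEN iffD1]) (use bv e in \<open>auto simp: bounded_var_def intro: empty_subintervals\<close>)
  then obtain D where D: "D \<in> subintervals a b" and near: "V b - e < total_increment f D" by blast
  have finD: "finite D" and inD: "\<And>c d. (c, d) \<in> D \<Longrightarrow> a \<le> c \<and> c \<le> d \<and> d \<le> b"
    and disD: "disjoint_family_on (\<lambda>(c, d). {c<..<d}) D"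
    using D by (auto simp: subintervals_def)
  \<comment> \<open>\<open>f (clamp c d x)\<close> follows f inside \<open>{c..d}\<close> and is
    constant outside, so each summand of g below changes only across its own interval, and
    \<open>g b\<close> is the total increment of D.\<close>
  define clamp where "clamp = (\<lambda>c d x :: real. max c (min d x))"
  define sg where "sg = (\<lambda>c d. if f c \<le> f d then 1 else -1 :: real)"
  have sgabs: "\<bar>sg c d\<bar> = 1" and sgd: "sg c d * (f d - f c) = \<bar>f d - f c\<bar>" for c d
    by (auto simp: sg_def)
  define g where "g x = (\<Sum>(c, d)\<in>D. sg c d * (f (clamp c d x) - f c))" for x
  define Q where "Q x = V x - g x" for x
  have Vmono: "mono_on {a..b} V" unfolding V_def by (rule mono_on_variation[OF bv])
  have Vinc: "\<bar>f y - f x\<bar> \<le> V y - V x" if "a \<le> x" "x \<le> y" "y \<le> b" for x y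
    using variation_increment[OF bv that] by (simp add: V_def)
  have Qmono: "mono_on {a..b} Q"
  proof (rule mono_onI)
    fix x y assume xy: "x \<in> {a..b}" "y \<in> {a..b}" "x \<le> y"
    have "g y - g x = (\<Sum>(c, d)\<in>D. sg c d * (f (clamp c d y) - f (clamp c d x)))"
      unfolding g_def sum_subtractf[symmetric] by (intro sum.cong) (auto simp: algebra_simps)
    \<comment> \<open>The arguments of V are the ends of the part of \<open>{c..d}\<close> inside
      \<open>{x..y}\<close>; if there is no such part, both equal x or both equal y. These parts do
      not overlap, so their V-increments add up to at most V y - V x.\<close>
    also have "\<dots> \<le> (\<Sum>(c, d)\<in>D. V (max x (min y d)) - V (min y (max x c)))"
    proof (intro sum_mono, clarify)
      fix c d assume cd: "(c, d) \<in> D"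
      have "sg c d * (f (clamp c d y) - f (clamp c d x)) \<le> \<bar>f (clamp c d y) - f (clamp c d x)\<bar>"
        using sgabs[of c d] by (metis abs_ge_self abs_mult mult_1)
      also have "\<dots> \<le> V (max x (min y d)) - V (min y (max x c))"
      proof (cases "d \<le> x \<or> y \<le> c")
        case True
        then have "clamp c d y = clamp c d x" using inD[OF cd] xy(3) by (auto simp: clamp_def)
        moreover have "V (min y (max x c)) \<le> V (max x (min y d))"
          by (intro mono_onD[OF Vmono]) (use True xy inD[OF cd] in auto)
        ultimately show ?thesis by simp
      next
        case False
        then have "clamp c d y = max x (min y d)" "clamp c d x = min y (max x c)"
          using inD[OF cd] xy(3) by (auto simp: clamp_def)
        then show ?thesis using Vinc[of "min y (max x c)" "max x (min y d)"] inD[OF cd] xy False by auto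
      qed
      finally show "sg c d * (f (clamp c d y) - f (clamp c d x)) \<le> V (max x (min y d)) - V (min y (max x c))" .
    qed
    also have "\<dots> \<le> V y - V x"
    proof -
      define lo hi where "lo = (\<lambda>(c, d::real). min y (max x c))" and "hi = (\<lambda>(c, d). max (min y (max x c)) (max x (min y d)))"
      have eq: "hi i = max x (min y (snd i))" "lo i = min y (max x (fst i))" if "i \<in> D" for i
        using inD[of "fst i" "snd i"] that xy by (auto simp: lo_def hi_def case_prod_unfold)
      have "(\<Sum>i\<in>D. V (hi i) - V (lo i)) \<le> V y - V x"
      proof (rule sum_mono_increments_le[where Q = V and a = x and b = y and lo = lo and hi = hi, OF finD])
        show "mono_on {x..y} V" using Vmono xy by (auto intro: mono_on_subset)
        show "disjoint_family_on (\<lambda>i. {lo i<..<hi i}) D"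
          unfolding disjoint_family_on_def
        proof (intro ballI impI)
          fix i j assume ij: "i \<in> D" "j \<in> D" "i \<noteq> j"
          then have "{fst i<..<snd i} \<inter> {fst j<..<snd j} = {}"
            using disD by (auto simp: disjoint_family_on_def case_prod_unfold)
          moreover have "{lo i<..<hi i} \<subseteq> {fst i<..<snd i}" "{lo j<..<hi j} \<subseteq> {fst j<..<snd j}"
            using eq ij xy by (auto simp: min_def max_def split: if_splits)
          ultimately show "{lo i<..<hi i} \<inter> {lo j<..<hi j} = {}" by blast
        qed
      qed (use xy in \<open>auto simp: lo_def hi_def\<close>)
      also have "(\<Sum>i\<in>D. V (hi i) - V (lo i)) = (\<Sum>(c, d)\<in>D. V (max x (min y d)) - V (min y (max x c)))"
        by (intro sum.cong) (auto simp: eq)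
      finally show ?thesis .
    qed
    finally show "Q x \<le> Q y" by (simp add: Q_def)
  qed
  have "clamp c d a = c" if "(c, d) \<in> D" for c d
    using inD[OF that] by (auto simp: clamp_def)
  then have "g a = 0" unfolding g_def by (intro sum.neutral) auto
  moreover have "g b = total_increment f D" unfolding g_def total_increment_def
    by (intro sum.cong) (use inD sgd in \<open>auto simp: clamp_def max_def min_def\<close>)
  moreover have "0 \<le> V a" unfolding V_def using variation_nonneg[OF bv] ab by simp
  ultimately have Qe: "Q b - Q a \<le> e" using near by (simp add: Q_def)
  \<comment> \<open>Off the endpoints of D, a sufficiently short interval around x is either
    contained in a given member of D or disjoint from its interior, depending only on x.\<close>
  define N where "N = fst ` D \<union> snd ` D"
  define S where "S = {x \<in> {a<..<b}. steep_up f k x \<and> steep_up (\<lambda>x. - f x) k x} - N"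
  have "\<exists>p q. a \<le> p \<and> p < q \<and> q \<le> b \<and> x \<in> {p..q} \<and> q - p < \<eta> \<and> k * (q - p) \<le> Q q - Q p"
    if x: "x \<in> S" and \<eta>: "\<eta> > 0" for x \<eta>
  proof -
    have "open ({a<..<b} - N)" using finD by (auto simp: N_def intro!: open_Diff finite_imp_closed)
    then obtain r where r: "r > 0" "ball x r \<subseteq> {a<..<b} - N"
      using x unfolding S_def open_contains_ball by blast
    have near: "{p..q} \<subseteq> {a<..<b} - N" if "x \<in> {p..q}" "q - p < r" for p q
    proof -
      have "{p..q} \<subseteq> ball x r" using that by (auto simp: dist_real_def)
      with r show ?thesis by blast
    qed
    have out: "p < q \<Longrightarrow> q \<le> c \<or> d \<le> p" if "x \<in> {p..q}" "q - p < r" "(c, d) \<in> D" "x \<notin> {c<..<d}" for p q c d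
    proof -
      have "c \<notin> {p..q}" "d \<notin> {p..q}" using near[OF that(1,2)] that(3) by (force simp: N_def)+
      then show ?thesis using that by auto
    qed
    have inn: "c < p \<and> q < d" if "x \<in> {p..q}" "q - p < r" "(c, d) \<in> D" "x \<in> {c<..<d}" for p q c d
    proof -
      have "c \<notin> {p..q}" "d \<notin> {p..q}" using near[OF that(1,2)] that(3) by (force simp: N_def)+
      then show ?thesis using that by auto
    qed
    \<comment> \<open>\<sigma> is opposite to the sign attached to the member of D around x, if
      there is one. Oscillation provides short intervals \<open>{p..q}\<close> on which \<sigma> f
      rises steeply; there g does not increase, while V rises at least as much as \<sigma> f, so Q =
      V - g is steep at x.\<close>
    obtain \<sigma> :: real where \<sigma>: "\<bar>\<sigma>\<bar> = 1" "\<And>c d. (c, d) \<in> D \<Longrightarrow> x \<in> {c<..<d} \<Longrightarrow> sg c d = - \<sigma>"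
    proof (cases "\<exists>c d. (c, d) \<in> D \<and> x \<in> {c<..<d}")
      case True
      then obtain c d where cd: "(c, d) \<in> D" "x \<in> {c<..<d}" by auto
      have "(c', d') = (c, d)" if "(c', d') \<in> D" "x \<in> {c'<..<d'}" for c' d'
        using disD cd that by (fastforce simp: disjoint_family_on_def)
      then show ?thesis using that[of "- sg c d"] sgabs[of c d] by auto
    next
      case False
      then show ?thesis using that[of 1] by auto
    qed
    have "steep_up (\<lambda>x. \<sigma> * f x) k x"
      using \<sigma>(1) x by (auto simp: S_def abs_eq_iff' )
    then obtain p q where pq: "p < q" "x \<in> {p..q}" "q - p < min \<eta> r" "k * (q - p) \<le> \<sigma> * (f q - f p)"
      unfolding steep_up_def using \<eta> r(1) by (metis min_less_iff_conj right_diff_distrib)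
    have pqab: "a \<le> p" "q \<le> b" 
      using near[OF pq(2)] pq(1,3) subsetD[of "{p..q}" "{a<..<b} - N" p] subsetD[of "{p..q}" "{a<..<b} - N" q] by auto
    have "g q - g p = (\<Sum>(c, d)\<in>D. sg c d * (f (clamp c d q) - f (clamp c d p)))"
      unfolding g_def sum_subtractf[symmetric] by (intro sum.cong) (auto simp: algebra_simps)
    also have "\<dots> \<le> 0"
    proof (intro sum_nonpos, clarify)
      fix c d assume cd: "(c, d) \<in> D"
      show "sg c d * (f (clamp c d q) - f (clamp c d p)) \<le> 0"
      proof (cases "x \<in> {c<..<d}")
        case True
        then have "clamp c d q = q" "clamp c d p = p"
          using inn[OF pq(2) _ cd True] pq(1,3) by (auto simp: clamp_def)
        moreover have "0 \<le> \<sigma> * (f q - f p)" using pq(1,4) k by (smt (verit) mult_nonneg_nonneg)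
        ultimately show ?thesis using \<sigma>(2)[OF cd True] by simp
      next
        case False
        then have "clamp c d q = clamp c d p"
          using out[OF pq(2) _ cd False] pq(1,3) inD[OF cd] by (auto simp: clamp_def)
        then show ?thesis by simp
      qed
    qed
    finally have "V q - V p \<le> Q q - Q p" by (simp add: Q_def)
    moreover have "\<sigma> * (f q - f p) \<le> \<bar>f q - f p\<bar>" using \<sigma>(1) by (metis abs_ge_self abs_mult mult_1)
    moreover have "\<bar>f q - f p\<bar> \<le> V q - V p" using Vinc pq(1) pqab by auto
    ultimately show ?thesis using pq pqab by (intro exI[of _ p] exI[of _ q]) auto
  qed
  then obtain W where W: "S \<subseteq> W" "W \<in> lmeasurable" "measure lebesgue W \<le> (Q b - Q a) / k"
    using vitali_steep_bound[OF Qmono less_imp_le[OF ab] k, of S] by blast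
  have "(Q b - Q a) / k \<le> e / k" using Qe k by (simp add: divide_right_mono)
  with W finD show ?thesis
    by (intro exI[of _ W] exI[of _ N]) (auto simp: S_def N_def)
qed

lemma negligible_oscillation:
  fixes f :: "real \<Rightarrow> real"
  assumes bv: "bounded_var a b f" and k: "k > 0"
  shows "negligible {x \<in> {a<..<b}. steep_up f k x \<and> steep_up (\<lambda>x. - f x) k x}" (is "negligible ?S")
proof (cases "a < b")
  case True
  show ?thesis
  proof (subst negligible_outer_le, intro allI impI)
    fix e :: real assume "e > 0"
    then have "e * k > 0" using k by simp
    from bounded_var_oscillation_cover[OF bv True k this] k
    obtain W N where W: "?S \<subseteq> W \<union> N" "finite N" "W \<in> lmeasurable" "measure lebesgue W \<le> e"
      by auto
    have N: "negligible N" using W(2) by (rule negligible_finite)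
    have "measure lebesgue (W \<union> N) \<le> measure lebesgue W + measure lebesgue N"
      using W(3) N negligible_imp_measurable by (intro measure_Un_le) (auto simp: fmeasurableD)
    also have "measure lebesgue N = 0" using N negligible_imp_measure0 by blast
    finally show "\<exists>T. ?S \<subseteq> T \<and> T \<in> lmeasurable \<and> measure lebesgue T \<le> e"
      using W N negligible_imp_measurable by (intro exI[of _ "W \<union> N"]) auto
  qed
next
  case False
  then show ?thesis by auto
qed

text \<open>Steep rises and steep falls of f are both steep rises of its variation, and a monotone
  function can have slope at least k only on a set of measure at most its total rise over k. Here k
  is arbitrarily large.\<close>

lemma negligible_infinite_slope:
  fixes f :: "real \<Rightarrow> real"
  assumes bv: "bounded_var a b f"
  shows "negligible {x \<in> {a<..<b}. \<forall>k>0. steep_up f k x \<or> steep_up (\<lambda>x. - f x) k x}" (is "negligible ?S")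
proof (cases "a < b")
  case True
  show ?thesis
  proof (subst negligible_outer_le, intro allI impI)
    fix e :: real assume e: "e > 0"
    define V where "V = variation a f"
    have Vinc: "\<bar>f y - f x\<bar> \<le> V y - V x" if "a \<le> x" "x \<le> y" "y \<le> b" for x y
      using variation_increment[OF bv that] by (simp add: V_def)
    \<comment> \<open>Chosen so that (V b - V a) / k is at most e; the summand 1 keeps k positive
      when V is constant.\<close>
    define k where "k = (V b - V a + 1) / e"
    have k: "k > 0" using Vinc[of a b] True e by (auto simp: k_def)
    have "\<exists>p q. a \<le> p \<and> p < q \<and> q \<le> b \<and> x \<in> {p..q} \<and> q - p < \<eta> \<and> k * (q - p) \<le> V q - V p"
      if x: "x \<in> ?S" and \<eta>: "\<eta> > 0" for x \<eta>
    proof -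
      define r where "r = min \<eta> (min (x - a) (b - x))"
      have "r > 0" using x \<eta> by (auto simp: r_def)
      moreover have "steep_up f k x \<or> steep_up (\<lambda>x. - f x) k x" using x k by auto
      ultimately obtain p q where pq: "p < q" "x \<in> {p..q}" "q - p < r" "k * (q - p) \<le> \<bar>f q - f p\<bar>"
        unfolding steep_up_def by (smt (verit, ccfv_threshold))
      then show ?thesis using Vinc[of p q] by (intro exI[of _ p] exI[of _ q]) (auto simp: r_def)
    qed
    then obtain W where W: "?S \<subseteq> W" "W \<in> lmeasurable" "measure lebesgue W \<le> (V b - V a) / k"
      using vitali_steep_bound[OF mono_on_variation[OF bv, folded V_def] less_imp_le[OF True] k, of ?S]
      by blast
    have "(V b - V a) / k \<le> e" using Vinc[of a b] True e k
      by (simp add: k_def field_simps)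
    with W show "\<exists>T. ?S \<subseteq> T \<and> T \<in> lmeasurable \<and> measure lebesgue T \<le> e"
      by auto
  qed
next
  case False
  then show ?thesis by auto
qed


lemma steep_upI:
  assumes "\<And>e. e > 0 \<Longrightarrow> \<exists>y. y \<noteq> x \<and> \<bar>y - x\<bar> < e \<and> k \<le> (f y - f x) / (y - x)"
  shows "steep_up f k x"
  unfolding steep_up_def
proof (intro allI impI)
  fix e :: real assume "e > 0"
  from assms[OF this] obtain y where y: "y \<noteq> x" "\<bar>y - x\<bar> < e" "k \<le> (f y - f x) / (y - x)" by auto
  show "\<exists>p q. p < q \<and> x \<in> {p..q} \<and> q - p < e \<and> k * (q - p) \<le> f q - f p"
  proof (cases "x < y")
    case True
    then show ?thesis using y by (intro exI[of _ x] exI[of _ y]) (auto simp: field_simps)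
  next
    case False
    then show ?thesis using y by (intro exI[of _ y] exI[of _ x]) (auto simp: field_simps)
  qed
qed

lemma bounded_var_diff_linear:
  fixes f :: "real \<Rightarrow> real"
  assumes "bounded_var a b f" "a \<le> b"
  shows "bounded_var a b (\<lambda>x. f x - r * x)"
proof -
  from assms obtain T where T: "\<And>D. D \<in> subintervals a b \<Longrightarrow> total_increment f D \<le> T"
    by (auto simp: bounded_var_def bdd_above_def)
  have "total_increment (\<lambda>x. f x - r * x) D \<le> T + \<bar>r\<bar> * (b - a)" if D: "D \<in> subintervals a b" for D
  proof -
    have "total_increment (\<lambda>x. f x - r * x) D \<le> (\<Sum>(c, d)\<in>D. norm (f d - f c) + \<bar>r\<bar> * (d - c))"
      unfolding total_increment_def
    proof (intro sum_mono, clarify)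
      fix c d assume "(c, d) \<in> D"
      then have "c \<le> d" using D by (auto simp: subintervals_def)
      then have "\<bar>r\<bar> * (d - c) = \<bar>r * (d - c)\<bar>" by (simp add: abs_mult)
      then show "norm (f d - r * d - (f c - r * c)) \<le> norm (f d - f c) + \<bar>r\<bar> * (d - c)"
        by (simp add: algebra_simps)
    qed
    also have "\<dots> = total_increment f D + \<bar>r\<bar> * (\<Sum>(c, d)\<in>D. d - c)"
      by (simp add: total_increment_def sum.distrib sum_distrib_left case_prod_unfold)
    also have "\<dots> \<le> T + \<bar>r\<bar> * (b - a)"
      using T[OF D] sum_lengths_le[OF D assms(2)] by (intro add_mono mult_left_mono) auto
    finally show ?thesis .
  qed
  then show ?thesis unfolding bounded_var_def by (rule bdd_aboveI2)
qed

text \<open>If the lower and upper derivatives at x differ, rationals r < s separate them; after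
  subtracting the line of slope (r + s) / 2, slopes beyond (s - r) / 2 occur in both directions, so
  x is an oscillation point. If they agree, the derivative exists unless it is infinite. This leaves
  countably many exceptional null sets.\<close>

theorem bounded_var_differentiable_ae:
  fixes f :: "real \<Rightarrow> real"
  assumes bv: "bounded_var a b f"
  shows "negligible {x \<in> {a<..<b}. \<not> f differentiable (at x)}"
proof (cases "a < b")
  case True
  define osc where "osc r s = {x \<in> {a<..<b}. steep_up (\<lambda>x. f x - (r + s) / 2 * x) ((s - r) / 2) x \<and>
     steep_up (\<lambda>x. - (f x - (r + s) / 2 * x)) ((s - r) / 2) x}" for r s
  define infs where "infs = {x \<in> {a<..<b}. \<forall>k>0. steep_up f k x \<or> steep_up (\<lambda>x. - f x) k x}"
  let ?Z = "infs \<union> (\<Union>(r, s)\<in>{(r, s). r \<in> \<rat> \<and> s \<in> \<rat> \<and> r < s}. osc r s)"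
  have "negligible ?Z"
  proof (intro negligible_Un)
    show "negligible infs" unfolding infs_def by (rule negligible_infinite_slope[OF bv])
    show "negligible (\<Union>(r, s)\<in>{(r, s). r \<in> \<rat> \<and> s \<in> \<rat> \<and> r < s}. osc r s)"
    proof (intro negligible_countable_Union)
      have "countable (\<rat> \<times> \<rat> :: (real \<times> real) set)" using countable_rat by auto
      then show "countable ((\<lambda>(r, s). osc r s) ` {(r, s). r \<in> \<rat> \<and> s \<in> \<rat> \<and> r < s})"
        by (intro countable_image) (auto elim: countable_subset[rotated])
      fix S assume "S \<in> (\<lambda>(r, s). osc r s) ` {(r, s). r \<in> \<rat> \<and> s \<in> \<rat> \<and> r < s}"
      then obtain r s where "S = osc r s" "r < s" by auto
      then show "negligible S"
        using negligible_oscillation[OF bounded_var_diff_linear[OF bv, of "(r + s) / 2"], of "(s - r) / 2"] True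
        by (simp add: osc_def)
    qed
  qed
  moreover have "{x \<in> {a<..<b}. \<not> f differentiable (at x)} \<subseteq> ?Z"
  proof (intro subsetI, rule ccontr)
    fix x assume x: "x \<in> {x \<in> {a<..<b}. \<not> f differentiable (at x)}" and nz: "x \<notin> ?Z"
    define s where "s y = (f y - f x) / (y - x)" for y
    have freqD: "\<exists>y. y \<noteq> x \<and> \<bar>y - x\<bar> < e \<and> P y" if "frequently P (at x)" "e > 0" for P e
      using that unfolding frequently_at by (auto simp: dist_real_def)
    let ?s = "\<lambda>y. ereal (s y)"
    have eq: "Liminf (at x) ?s = Limsup (at x) ?s"
    proof (rule ccontr)
      assume "Liminf (at x) ?s \<noteq> Limsup (at x) ?s"
      then have "Liminf (at x) ?s < Limsup (at x) ?s"
        by (simp add: Liminf_le_Limsup order_less_le)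
      then obtain r' s' where "Liminf (at x) ?s < ereal r'" "ereal r' < ereal s'" "ereal s' < Limsup (at x) ?s"
        by (metis ereal_dense2)
      moreover obtain r where r: "r \<in> \<rat>" "r' < r" "r < (r' + s') / 2"
        using Rats_dense_in_real[of r' "(r' + s') / 2"] calculation by auto
      moreover obtain t where t: "t \<in> \<rat>" "(r' + s') / 2 < t" "t < s'"
        using Rats_dense_in_real[of "(r' + s') / 2" s'] calculation by auto
      ultimately have lr: "Liminf (at x) ?s < ereal r" and tl: "ereal t < Limsup (at x) ?s" and rt: "r < t"
        by (auto intro: less_trans[of _ "ereal r'"] less_trans[of _ "ereal s'"])
      have "frequently (\<lambda>y. s y < r) (at x)"
      proof (rule ccontr)
        assume "\<not> frequently (\<lambda>y. s y < r) (at x)"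
        then have "ereal r \<le> Liminf (at x) ?s"
          by (intro Liminf_bounded) (simp add: not_frequently not_less)
        with lr show False by simp
      qed
      moreover have "frequently (\<lambda>y. t < s y) (at x)"
      proof (rule ccontr)
        assume "\<not> frequently (\<lambda>y. t < s y) (at x)"
        then have "Limsup (at x) ?s \<le> ereal t"
          by (intro Limsup_bounded) (simp add: not_frequently not_less)
        with tl show False by simp
      qed
      ultimately have F: "\<And>e. e > 0 \<Longrightarrow> \<exists>y. y \<noteq> x \<and> \<bar>y - x\<bar> < e \<and> s y < r"
        "\<And>e. e > 0 \<Longrightarrow> \<exists>y. y \<noteq> x \<and> \<bar>y - x\<bar> < e \<and> t < s y"
        by (auto dest: freqD)
      have slope: "(f y - c * y - (f x - c * x)) / (y - x) = s y - c" if "y \<noteq> x" for y c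
        using that by (simp add: s_def field_simps)
      have slope': "(- (f y - c * y) - - (f x - c * x)) / (y - x) = c - s y" if "y \<noteq> x" for y c
        using that by (simp add: s_def field_simps)
      have "x \<in> osc r t"
        unfolding osc_def
      proof (intro CollectI conjI steep_upI)
        show "x \<in> {a<..<b}" using x by simp
        fix e :: real assume "e > 0"
        from F(2)[OF this] obtain y where "y \<noteq> x" "\<bar>y - x\<bar> < e" "t < s y" by auto
        then show "\<exists>y. y \<noteq> x \<and> \<bar>y - x\<bar> < e \<and>
           (t - r) / 2 \<le> (f y - (r + t) / 2 * y - (f x - (r + t) / 2 * x)) / (y - x)"
          by (intro exI[of _ y]) (subst slope, auto simp: field_simps)
      next
        fix e :: real assume "e > 0"
        from F(1)[OF this] obtain y where "y \<noteq> x" "\<bar>y - x\<bar> < e" "s y < r" by auto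
        then show "\<exists>y. y \<noteq> x \<and> \<bar>y - x\<bar> < e \<and>
           (t - r) / 2 \<le> (- (f y - (r + t) / 2 * y) - - (f x - (r + t) / 2 * x)) / (y - x)"
          by (intro exI[of _ y]) (subst slope', auto simp: field_simps)
      qed
      with nz r(1) t(1) rt show False by auto
    qed
    define L where "L = Liminf (at x) ?s"
    have lim: "(?s \<longlongrightarrow> L) (at x)"
      using eq by (simp add: L_def tendsto_iff_Liminf_eq_Limsup)
    have "x \<notin> infs" using nz by auto
    then obtain k where k: "k > 0" "\<not> steep_up f k x" "\<not> steep_up (\<lambda>x. - f x) k x"
      using x unfolding infs_def by auto
    \<comment> \<open>The absence of steep intervals at level k bounds all nearby difference
      quotients by k, so the common limit L is finite.\<close>
    have ev: "eventually (\<lambda>y. \<bar>s y\<bar> \<le> k) (at x)"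
    proof -
      obtain e1 where e1: "e1 > 0" "\<And>y. y \<noteq> x \<Longrightarrow> \<bar>y - x\<bar> < e1 \<Longrightarrow> s y < k"
        using k(2) steep_upI[of x k f] by (metis not_less s_def)
      obtain e2 where e2: "e2 > 0" "\<And>y. y \<noteq> x \<Longrightarrow> \<bar>y - x\<bar> < e2 \<Longrightarrow> (- f y - - f x) / (y - x) < k"
        using k(3) steep_upI[of x k "\<lambda>x. - f x"] by (metis not_less)
      have "(- f y - - f x) / (y - x) = - s y" for y by (simp add: s_def minus_divide_left)
      then show ?thesis unfolding eventually_at using e1 e2
        by (intro exI[of _ "min e1 e2"]) (force simp: dist_real_def)
    qed
    have "L \<le> ereal k" "- ereal k \<le> L"
      using tendsto_upperbound[OF lim, of "ereal k"] tendsto_lowerbound[OF lim, of "- ereal k"]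
        eventually_mono[OF ev, of "\<lambda>y. s y \<le> k"] eventually_mono[OF ev, of "\<lambda>y. - k \<le> s y"]
      by auto
    then obtain m where m: "L = ereal m" by (cases L) auto
    with lim have "(s \<longlongrightarrow> m) (at x)" by simp
    then have "(f has_real_derivative m) (at x)"
      unfolding has_field_derivative_iff s_def .
    then have "f differentiable (at x)" by (auto simp: real_differentiable_def)
    with x show False by simp
  qed
  ultimately show ?thesis by (rule negligible_subset)
next
  case False
  then show ?thesis by auto
qed

text \<open>Absolute continuity with tolerance 1 bounds the variation on intervals shorter than
  \<delta>. Negligibility is a local property, so such short intervals suffice.\<close>

lemma abs_cont_on_differentiable_ae_real:
  fixes f :: "real \<Rightarrow> real"
  assumes "\<And>a b. abs_cont_on a b f"
  shows "negligible {x. \<not> f differentiable (at x)}"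
proof (subst locally_negligible_alt, intro ballI)
  fix x assume x: "x \<in> {x. \<not> f differentiable (at x)}"
  obtain \<delta> where \<delta>: "\<delta> > 0"
    "\<And>D. D \<in> subintervals (x - 1) (x + 1) \<Longrightarrow> (\<Sum>(c, d)\<in>D. d - c) < \<delta> \<Longrightarrow> total_increment f D < 1"
    using assms[of "x - 1" "x + 1"] unfolding abs_cont_on_altdef by (meson zero_less_one)
  \<comment> \<open>The interval of radius r has length at most 2 \<delta> / 3 < \<delta> and stays
    inside \<open>{x - 1..x + 1}\<close>.\<close>
  define r where "r = min 1 (\<delta> / 3)"
  have r: "r > 0" using \<delta>(1) by (simp add: r_def)
  have "bounded_var (x - r) (x + r) f"
    unfolding bounded_var_def
  proof (rule bdd_aboveI2)
    fix D assume D: "D \<in> subintervals (x - r) (x + r)"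
    then have "D \<in> subintervals (x - 1) (x + 1)"
      using subintervals_mono[of "x - 1" "x - r" "x + r" "x + 1"] by (auto simp: r_def)
    moreover have "(\<Sum>(c, d)\<in>D. d - c) < \<delta>"
      using sum_lengths_le[OF D] r \<delta>(1) by (auto simp: r_def min_def split: if_splits)
    ultimately show "total_increment f D \<le> 1" using \<delta>(2) by fastforce
  qed
  from bounded_var_differentiable_ae[OF this]
  show "\<exists>u. openin (top_of_set {x. \<not> f differentiable (at x)}) u \<and> x \<in> u \<and> negligible u"
    using x r by (intro exI[of _ "{y. \<not> f differentiable (at y)} \<inter> {x-r<..<x+r}"])
      (auto intro: openin_open_Int elim: negligible_subset)
qed

subsection \<open>Absolutely continuous functions\<close>

lemma differentiable_iff_Basis:
  fixes f :: "real \<Rightarrow> 'a::euclidean_space"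
  shows "f differentiable (at x) \<longleftrightarrow> (\<forall>i\<in>Basis. (\<lambda>t. f t \<bullet> i) differentiable (at x))"
  by (rule differentiable_componentwise_within)

text \<open>A common source of closure properties: components, products, exponentials and Lipschitz
  functions all have increments controlled by those of known functions. Two dominating functions are
  allowed with products in mind.\<close>

lemma abs_cont_on_dominated:
  assumes "abs_cont_on a b f" "abs_cont_on a b g" and C: "C \<ge> 0"
    and le: "\<And>c d. a \<le> c \<Longrightarrow> c \<le> d \<Longrightarrow> d \<le> b \<Longrightarrow> norm (h d - h c) \<le> C * (norm (f d - f c) + norm (g d - g c))"
  shows "abs_cont_on a b h"
  unfolding abs_cont_on_altdef
proof (intro allI impI)
  fix e :: real assume "e > 0"
  then have e': "e / (2 * (C + 1)) > 0" using C by simp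
  from assms(1,2) e' obtain d1 d2 where d: "d1 > 0" "d2 > 0"
    "\<And>D. D \<in> subintervals a b \<Longrightarrow> (\<Sum>(c, d)\<in>D. d - c) < d1 \<Longrightarrow> total_increment f D < e / (2 * (C + 1))"
    "\<And>D. D \<in> subintervals a b \<Longrightarrow> (\<Sum>(c, d)\<in>D. d - c) < d2 \<Longrightarrow> total_increment g D < e / (2 * (C + 1))"
    unfolding abs_cont_on_altdef by metis
  have "total_increment h D < e" if D: "D \<in> subintervals a b" and s: "(\<Sum>(c, d)\<in>D. d - c) < min d1 d2" for D
  proof -
    have "total_increment h D \<le> (\<Sum>(c, d)\<in>D. C * (norm (f d - f c) + norm (g d - g c)))"
      unfolding total_increment_def using D le by (intro sum_mono) (auto simp: subintervals_def)
    also have "\<dots> = C * (total_increment f D + total_increment g D)"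
      by (simp add: total_increment_def sum.distrib sum_distrib_left case_prod_unfold distrib_left)
    also have "\<dots> \<le> C * (e / (2 * (C + 1)) + e / (2 * (C + 1)))"
      using d(3,4)[OF D] s C by (intro mult_left_mono) auto
    also have "e / (2 * (C + 1)) + e / (2 * (C + 1)) = e / (C + 1)"
      by (simp only: divide_divide_eq_left[symmetric] mult.commute[of 2] field_sum_of_halves)
    also have "C * (e / (C + 1)) < e" using C \<open>e > 0\<close> by (simp add: field_simps)
    finally show ?thesis .
  qed
  with d(1,2) show "\<exists>\<delta>>0. \<forall>D\<in>subintervals a b. (\<Sum>(c, d)\<in>D. d - c) < \<delta> \<longrightarrow> total_increment h D < e"
    by (intro exI[of _ "min d1 d2"]) auto
qed

lemma abs_cont_on_id: "abs_cont_on a b (\<lambda>x::real. x)"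
  unfolding abs_cont_on_altdef
proof (intro allI impI)
  fix e :: real assume "e > 0"
  moreover have "total_increment (\<lambda>x. x) D = (\<Sum>(c, d)\<in>D. d - c)" if "D \<in> subintervals a b" for D
    unfolding total_increment_def using that by (intro sum.cong) (auto simp: subintervals_def)
  ultimately show "\<exists>\<delta>>0. \<forall>D\<in>subintervals a b. (\<Sum>(c, d)\<in>D. d - c) < \<delta> \<longrightarrow> total_increment (\<lambda>x. x) D < e"
    by (intro exI[of _ e]) auto
qed

theorem abs_cont_on_differentiable_ae:
  fixes f :: "real \<Rightarrow> 'a::euclidean_space"
  assumes "\<And>a b. abs_cont_on a b f"
  shows "negligible {x. \<not> f differentiable (at x)}"
proof -
  have "negligible (\<Union>i\<in>Basis. {x. \<not> (\<lambda>t. f t \<bullet> i) differentiable (at x)})"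
  proof (intro negligible_Union, safe)
    fix i :: 'a assume i: "i \<in> Basis"
    have "abs_cont_on a b (\<lambda>t. f t \<bullet> i)" for a b
      by (rule abs_cont_on_dominated[OF assms assms, where C = 1])
        (use i in \<open>auto simp flip: inner_diff_left intro: order_trans[OF Basis_le_norm]\<close>)
    then show "negligible {x. \<not> (\<lambda>t. f t \<bullet> i) differentiable (at x)}"
      by (rule abs_cont_on_differentiable_ae_real)
  qed auto
  then show ?thesis
    by (rule negligible_subset) (auto simp: differentiable_iff_Basis[of f])
qed

lemma abs_cont_on_continuous:
  assumes "abs_cont_on a b f"
  shows "continuous_on {a..b} f"
  unfolding continuous_on_iff
proof (intro ballI allI impI)
  fix x e :: real assume x: "x \<in> {a..b}" and "e > 0"
  then obtain \<delta> where \<delta>: "\<delta> > 0"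
    "\<And>D. D \<in> subintervals a b \<Longrightarrow> (\<Sum>(c, d)\<in>D. d - c) < \<delta> \<Longrightarrow> total_increment f D < e"
    using assms unfolding abs_cont_on_altdef by metis
  have "dist (f y) (f x) < e" if y: "y \<in> {a..b}" "dist y x < \<delta>" for y
  proof -
    have "{(min x y, max x y)} \<in> subintervals a b"
      using x y by (auto simp: subintervals_def disjoint_family_on_def)
    from \<delta>(2)[OF this] y show ?thesis
      by (cases "x \<le> y") (auto simp: total_increment_def dist_norm norm_minus_commute)
  qed
  with \<delta>(1) show "\<exists>d>0. \<forall>x'\<in>{a..b}. dist x' x < d \<longrightarrow> dist (f x') (f x) < e" by blast
qed

text \<open>Proved directly for the gauge integral, so that integrability of f' is part of the
  conclusion. Pieces tagged outside N are controlled by the derivative. Pieces tagged in N lie in an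
  open set of measure below \<delta>, so absolute continuity makes their total increment
  small.\<close>

theorem abs_cont_on_has_integral:
  fixes f :: "real \<Rightarrow> 'a::banach"
  assumes ac: "abs_cont_on a b f" and ab: "a \<le> b" and N: "negligible N"
    and deriv: "\<And>x. x \<in> {a..b} - N \<Longrightarrow> (f has_vector_derivative f' x) (at x within {a..b})"
  shows "(f' has_integral (f b - f a)) {a..b}"
proof (cases "a = b")
  case True
  then show ?thesis by (auto simp: has_integral_null)
next
  case False
  with ab have lt: "a < b" by auto
  \<comment> \<open>With value 0 on N, a piece tagged in N contributes nothing but its increment of
    f.\<close>
  define g where "g x = (if x \<in> N then 0 else f' x)" for x
  have "(g has_integral (f b - f a)) {a..b}"
    unfolding has_integral_factor_content_real
  proof (intro allI impI)
    fix e :: real assume e: "e > 0"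
    then have e': "e / 2 * (b - a) > 0" using lt by simp
    obtain \<delta> where \<delta>: "\<delta> > 0"
      "\<And>D. D \<in> subintervals a b \<Longrightarrow> (\<Sum>(c, d)\<in>D. d - c) < \<delta> \<Longrightarrow> total_increment f D < e / 2 * (b - a)"
      using ac e' unfolding abs_cont_on_altdef by metis
    obtain U where U: "open U" "N \<subseteq> U" "U - N \<in> lmeasurable" "emeasure lebesgue (U - N) < ennreal \<delta>"
      using sets_lebesgue_outer_open[OF negligible_imp_sets[OF N] \<delta>(1)] by blast
    have Ulm: "U \<in> lmeasurable"
      using fmeasurable.Un[OF U(3) negligible_imp_measurable[OF N]] U(2) by (simp add: Un_absorb2)
    have "measure lebesgue U \<le> measure lebesgue (U - N) + measure lebesgue N"
      using measure_Un_le[of "U - N" lebesgue N] U(2,3) N by (simp add: Un_absorb2 fmeasurableD negligible_imp_sets)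
    moreover have "measure lebesgue N = 0" using N negligible_imp_measure0 by blast
    moreover have "measure lebesgue (U - N) < \<delta>"
      using U(3,4) \<delta>(1) by (simp add: emeasure_eq_measure2 ennreal_less_iff)
    ultimately have Um: "measure lebesgue U < \<delta>" by simp
    have "\<exists>d>0. \<forall>y\<in>{a..b}. \<bar>y - x\<bar> < d \<longrightarrow> norm (f y - f x - (y - x) *\<^sub>R f' x) \<le> e / 2 * \<bar>y - x\<bar>"
      if "x \<in> {a..b} - N" for x
      using deriv[OF that] e unfolding has_vector_derivative_def has_derivative_within_alt
      by (auto dest!: spec[of _ "e / 2"])
    then obtain r where r: "\<And>x. x \<in> {a..b} - N \<Longrightarrow> r x > 0"
      "\<And>x y. x \<in> {a..b} - N \<Longrightarrow> y \<in> {a..b} \<Longrightarrow> \<bar>y - x\<bar> < r x \<Longrightarrow>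
         norm (f y - f x - (y - x) *\<^sub>R f' x) \<le> e / 2 * \<bar>y - x\<bar>"
      by metis
    define \<gamma> where "\<gamma> x = (if x \<in> N then U else if x \<in> {a..b} then ball x (r x) else ball x 1)" for x
    have "gauge \<gamma>" using U(1,2) r(1) by (auto simp: gauge_def \<gamma>_def)
    moreover have "norm ((\<Sum>(x, k)\<in>p. measure lborel k *\<^sub>R g x) - (f b - f a)) \<le> e * measure lborel {a..b}"
      if p: "p tagged_division_of {a..b}" "\<gamma> fine p" for p
    proof -
      have finp: "finite p" using p(1) by blast
      have pD: "\<exists>c d. k = {c..d} \<and> Inf k = c \<and> Sup k = d \<and> c \<le> d \<and> x \<in> {c..d} \<and> {c..d} \<subseteq> {a..b} \<and> k \<subseteq> \<gamma> x"
        if "(x, k) \<in> p" for x k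
      proof -
        from tagged_division_ofD(2,3,4)[OF p(1) that] obtain c d where "x \<in> k" "k \<subseteq> {a..b}" "k = {c..d}"
          by auto
        moreover have "k \<subseteq> \<gamma> x" using p(2) that by (auto simp: fine_def)
        ultimately show ?thesis by (intro exI[of _ c] exI[of _ d]) auto
      qed
      \<comment> \<open>Degenerate pieces carry no increment. The remaining ones have non-empty,
        pairwise disjoint interiors, so \<open>h\<close>, which sends a tagged piece to its pair of
        endpoints, is injective on them.\<close>
      define p1 where "p1 = {(x, k) \<in> p. x \<in> N \<and> Inf k < Sup k}"
      define h where "h = (\<lambda>(x::real, k::real set). (Inf k, Sup k))"
      have finp1: "finite p1" using finp by (rule finite_subset[rotated]) (auto simp: p1_def)
      have disj: "{Inf k<..<Sup k} \<inter> {Inf k'<..<Sup k'} = {}"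
        if k: "(x, k) \<in> p" "(x', k') \<in> p" "(x, k) \<noteq> (x', k')" for x k x' k'
      proof -
        obtain c d c' d' where "k = {c..d}" "k' = {c'..d'}" "Inf k = c" "Sup k = d" "Inf k' = c'" "Sup k' = d'"
          using pD[OF k(1)] pD[OF k(2)] by blast
        then show ?thesis
          using tagged_division_ofD(5)[OF p(1) k] by (simp only: interior_atLeastAtMost_real)
      qed
      have inj: "inj_on h p1"
      proof (rule inj_onI)
        fix i j assume ij: "i \<in> p1" "j \<in> p1" "h i = h j"
        obtain x k x' k' where [simp]: "i = (x, k)" "j = (x', k')" by (cases i, cases j)
        show "i = j"
        proof (rule ccontr)
          assume "i \<noteq> j"
          then have "{Inf k<..<Sup k} \<inter> {Inf k'<..<Sup k'} = {}"
            using disj ij by (auto simp: p1_def)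
          then show False using ij by (auto simp: p1_def h_def dest: dense)
        qed
      qed
      have D: "h ` p1 \<in> subintervals a b"
        unfolding subintervals_def
      proof (intro CollectI conjI)
        show "finite (h ` p1)" using finp1 by simp
        show "\<forall>(c, d)\<in>h ` p1. a \<le> c \<and> c \<le> d \<and> d \<le> b"
          using pD by (fastforce simp: p1_def h_def)
        show "disjoint_family_on (\<lambda>(c, d). {c<..<d}) (h ` p1)"
          unfolding disjoint_family_on_def
        proof (intro ballI impI)
          fix m n assume "m \<in> h ` p1" "n \<in> h ` p1" "m \<noteq> n"
          then obtain x k x' k' where "m = (Inf k, Sup k)" "n = (Inf k', Sup k')" "(x, k) \<in> p" "(x', k') \<in> p" "(x, k) \<noteq> (x', k')"
            by (auto simp: p1_def h_def)
          then show "(case m of (c, d) \<Rightarrow> {c<..<d}) \<inter> (case n of (c, d) \<Rightarrow> {c<..<d}) = {}"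
            using disj[of x k x' k'] by simp
        qed
      qed
      have "(\<Sum>(c, d)\<in>h ` p1. d - c) = (\<Sum>i\<in>h ` p1. measure lebesgue {fst i<..<snd i})"
        using D by (intro sum.cong) (auto simp: subintervals_def)
      also have "\<dots> = measure lebesgue (\<Union>i\<in>h ` p1. {fst i<..<snd i})"
        using D by (subst measure_finite_Union) (auto simp: subintervals_def case_prod_unfold)
      also have "\<dots> \<le> measure lebesgue U"
      proof (rule measure_mono_fmeasurable[OF _ _ Ulm])
        show "(\<Union>i\<in>h ` p1. {fst i<..<snd i}) \<subseteq> U"
        proof (clarsimp simp: p1_def h_def)
          fix y x k assume "Inf k < y" "y < Sup k" "(x, k) \<in> p" "x \<in> N"
          with pD[of x k] show "y \<in> U" by (auto simp: \<gamma>_def subset_iff)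
        qed
      qed (use finp1 in auto)
      finally have small: "total_increment f (h ` p1) < e / 2 * (b - a)"
        using \<delta>(2)[OF D] Um by simp
      have "(\<Sum>(x, k)\<in>p. measure lborel k *\<^sub>R g x) - (f b - f a)
            = (\<Sum>(x, k)\<in>p. measure lborel k *\<^sub>R g x) - (\<Sum>(x, k)\<in>p. f (Sup k) - f (Inf k))"
        using additive_tagged_division_1[OF ab p(1), of f] by simp
      also have "\<dots> = (\<Sum>(x, k)\<in>p. measure lborel k *\<^sub>R g x - (f (Sup k) - f (Inf k)))"
        by (simp add: sum_subtractf case_prod_unfold)
      also have "norm \<dots> \<le> (\<Sum>(x, k)\<in>p. norm (measure lborel k *\<^sub>R g x - (f (Sup k) - f (Inf k))))"
        by (simp add: case_prod_unfold sum_norm_le)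
      also have "\<dots> \<le> (\<Sum>(x, k)\<in>p. e / 2 * measure lborel k + (if (x, k) \<in> p1 then norm (f (Sup k) - f (Inf k)) else 0))"
      proof (intro sum_mono, clarify)
        fix x k assume xk: "(x, k) \<in> p"
        from pD[OF xk] obtain c d where cd: "k = {c..d}" "Inf k = c" "Sup k = d" "c \<le> d" "x \<in> {c..d}" "{c..d} \<subseteq> {a..b}" "k \<subseteq> \<gamma> x"
          by blast
        show "norm (measure lborel k *\<^sub>R g x - (f (Sup k) - f (Inf k)))
          \<le> e / 2 * measure lborel k + (if (x, k) \<in> p1 then norm (f (Sup k) - f (Inf k)) else 0)"
        proof (cases "x \<in> N")
          case True
          then show ?thesis
            using cd xk e by (cases "c < d") (auto simp: g_def p1_def norm_minus_commute)
        next
          case False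
          with cd have x: "x \<in> {a..b} - N" by auto
          have "c \<in> \<gamma> x" "d \<in> \<gamma> x" using cd by auto
          then have cr: "\<bar>c - x\<bar> < r x" "\<bar>d - x\<bar> < r x"
            using x by (auto simp: \<gamma>_def dist_real_def)
          have "measure lborel k *\<^sub>R g x - (f d - f c) =
             (f c - f x - (c - x) *\<^sub>R f' x) - (f d - f x - (d - x) *\<^sub>R f' x)"
            using False cd by (simp add: g_def algebra_simps)
          also have "norm \<dots> \<le> e / 2 * \<bar>c - x\<bar> + e / 2 * \<bar>d - x\<bar>"
            using cd by (intro norm_triangle_le_diff add_mono r(2)[OF x _ cr(1)] r(2)[OF x _ cr(2)]) auto
          also have "\<dots> = e / 2 * (\<bar>c - x\<bar> + \<bar>d - x\<bar>)" by (simp only: distrib_left)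
          also have "\<bar>c - x\<bar> + \<bar>d - x\<bar> = measure lborel k" using cd by simp
          finally show ?thesis using cd by (simp add: add_increasing2)
        qed
      qed
      also have "\<dots> = e / 2 * (\<Sum>(x, k)\<in>p. measure lborel k) + (\<Sum>i\<in>p. if i \<in> p1 then norm (f (Sup (snd i)) - f (Inf (snd i))) else 0)"
        by (simp add: sum.distrib sum_distrib_left case_prod_unfold)
      also have "(\<Sum>(x, k)\<in>p. measure lborel k) = b - a"
        using additive_content_tagged_division[of p a b] p(1) ab by simp
      also have "(\<Sum>i\<in>p. if i \<in> p1 then norm (f (Sup (snd i)) - f (Inf (snd i))) else 0)
          = (\<Sum>i\<in>p1. norm (f (Sup (snd i)) - f (Inf (snd i))))"
        using finp by (intro sum.mono_neutral_cong_right) (auto simp: p1_def)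
      also have "\<dots> = total_increment f (h ` p1)"
        unfolding total_increment_def by (subst sum.reindex[OF inj]) (simp add: h_def case_prod_unfold)
      finally have "norm ((\<Sum>(x, k)\<in>p. measure lborel k *\<^sub>R g x) - (f b - f a)) \<le> e / 2 * (b - a) + total_increment f (h ` p1)" .
      also have "\<dots> \<le> e / 2 * (b - a) + e / 2 * (b - a)" using small by simp
      also have "\<dots> = e * measure lborel {a..b}" using ab by (simp flip: distrib_right)
      finally show ?thesis .
    qed
    ultimately show "\<exists>d. gauge d \<and> (\<forall>p. p tagged_division_of {a..b} \<and> d fine p \<longrightarrow>
       norm ((\<Sum>(x, k)\<in>p. measure lborel k *\<^sub>R g x) - (f b - f a)) \<le> e * measure lborel {a..b})"
      by (intro exI[of _ \<gamma>]) blast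
  qed
  then show ?thesis
    by (intro has_integral_spike[OF N, of _ f' g]) (auto simp: g_def)
qed

subsection \<open>Locally square integrable derivatives\<close>

lemma ae_lebesgue_iff_negligible: "(AE x in lebesgue. P x) \<longleftrightarrow> negligible {x. \<not> P x}"
  by (simp add: completion.AE_iff_null_sets negligible_iff_null_sets)

lemma H1loc_abs_cont: "f \<in> H1loc \<Longrightarrow> abs_cont_on a b f"
  by (simp add: H1loc_def)

lemma H1loc_continuous_on: "f \<in> H1loc \<Longrightarrow> continuous_on S f"
proof -
  assume f: "f \<in> H1loc"
  have "continuous (at x) f" for x
    by (rule continuous_on_interior[OF abs_cont_on_continuous[OF H1loc_abs_cont[OF f, of "x-1" "x+1"]]]) simp
  then show ?thesis by (simp add: continuous_at_imp_continuous_on)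
qed

lemma H1loc_deriv_ae:
  fixes f :: "real \<Rightarrow> 'a::euclidean_space"
  shows "f \<in> H1loc \<Longrightarrow> AE x in lebesgue. (f has_vector_derivative ddx f x) (at x)"
  unfolding ae_lebesgue_iff_negligible
  using abs_cont_on_differentiable_ae[of f] by (simp add: H1loc_def vector_derivative_works[symmetric])

lemma has_vector_derivative_imp_tendsto:
  assumes "(f has_vector_derivative D) (at x)"
  shows "((\<lambda>t. (f (x + t) - f x) /\<^sub>R t) \<longlongrightarrow> D) (at 0)"
proof (rule LIM_zero_cancel, rule tendsto_norm_zero_cancel)
  have "((\<lambda>h. norm (f (x + h) - f x - h *\<^sub>R D) / norm h) \<longlongrightarrow> 0) (at 0)"
    using assms unfolding has_vector_derivative_def has_derivative_at by simp
  then show "((\<lambda>t. norm ((f (x + t) - f x) /\<^sub>R t - D)) \<longlongrightarrow> 0) (at 0)"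
  proof (rule Lim_transform_eventually)
    have "norm (f (x + h) - f x - h *\<^sub>R D) / norm h = norm ((f (x + h) - f x) /\<^sub>R h - D)" if "h \<noteq> 0" for h
    proof -
      have "(f (x + h) - f x) /\<^sub>R h - D = (f (x + h) - f x - h *\<^sub>R D) /\<^sub>R h"
        using that by (simp add: scaleR_diff_right)
      then show ?thesis
        by (simp only: norm_scaleR abs_inverse) (simp add: divide_inverse mult.commute)
    qed
    then show "\<forall>\<^sub>F h in at 0. norm (f (x + h) - f x - h *\<^sub>R D) / norm h = norm ((f (x + h) - f x) /\<^sub>R h - D)"
      by (auto simp: eventually_at intro!: exI[of _ 1])
  qed
qed

text \<open>Almost everywhere the derivative is the limit of continuous difference quotients with
  step 1/(n+1); the unspecified values on the exceptional null set are harmless because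
  \<open>lebesgue\<close> is complete.\<close>

lemma borel_measurable_ddx:
  fixes f :: "real \<Rightarrow> 'a::euclidean_space"
  assumes f: "continuous_on UNIV f" and d: "AE x in lebesgue. (f has_vector_derivative ddx f x) (at x)"
  shows "ddx f \<in> borel_measurable lebesgue"
proof -
  define h where "h n x = (f (x + inverse (real (Suc n))) - f x) /\<^sub>R inverse (real (Suc n))" for n x
  have "h n \<in> borel_measurable borel" for n
    unfolding h_def by (intro borel_measurable_continuous_onI continuous_intros continuous_on_compose2[OF f]) auto
  then have h: "h n \<in> borel_measurable lebesgue" for n
    by (simp add: measurable_completion)
  have "(\<lambda>x. lim (\<lambda>n. h n x)) \<in> borel_measurable lebesgue"
    by (intro borel_measurable_lim_metric h)
  moreover have "AE x in lebesgue. lim (\<lambda>n. h n x) = ddx f x"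
    using d
  proof eventually_elim
    case (elim x)
    have "filterlim (\<lambda>n. inverse (real (Suc n))) (at 0) sequentially"
      unfolding filterlim_at using LIMSEQ_inverse_real_of_nat by auto
    from filterlim_compose[OF has_vector_derivative_imp_tendsto[OF elim] this]
    show ?case by (intro limI) (simp add: h_def)
  qed
  ultimately show ?thesis by (rule borel_measurable_AE)
qed

lemma H1loc_ddx_measurable:
  fixes f :: "real \<Rightarrow> 'a::euclidean_space"
  shows "f \<in> H1loc \<Longrightarrow> ddx f \<in> borel_measurable lebesgue"
  by (intro borel_measurable_ddx H1loc_continuous_on H1loc_deriv_ae)

lemma set_borel_measurable_lebesgue_Icc:
  fixes f :: "real \<Rightarrow> 'a::euclidean_space"
  shows "f \<in> borel_measurable lebesgue \<Longrightarrow> set_borel_measurable lebesgue {a..b::real} f"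
  unfolding set_borel_measurable_def
  by (intro borel_measurable_scaleR borel_measurable_indicator) simp_all

section \<open>Locally square integrable functions\<close>

definition L2loc :: "(real \<Rightarrow> 'a::euclidean_space) set" where
  "L2loc = {f \<in> borel_measurable lebesgue. \<forall>a b. set_integrable lebesgue {a..b} (\<lambda>x. (norm (f x))\<^sup>2)}"

lemma L2loc_measurable [measurable_dest]: "f \<in> L2loc \<Longrightarrow> f \<in> borel_measurable lebesgue"
  by (simp add: L2loc_def)

lemma L2loc_ddx: "f \<in> H1loc \<Longrightarrow> ddx f \<in> L2loc"
  using H1loc_ddx_measurable[of f] by (simp add: L2loc_def H1loc_def)

text \<open>The constant may depend on the interval, since continuous factors are bounded only
  locally. The factor 2 C^2 in the proof comes from (s + t)^2 <= 2 (s^2 + t^2).\<close>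

lemma L2loc_dominated:
  assumes f: "f \<in> L2loc" and g: "g \<in> L2loc" and h: "h \<in> borel_measurable lebesgue"
    and le: "\<And>a b. \<exists>C\<ge>0. AE x in lebesgue. x \<in> {a..b} \<longrightarrow> norm (h x) \<le> C * (norm (f x) + norm (g x))"
  shows "h \<in> L2loc"
proof -
  have "set_integrable lebesgue {a..b} (\<lambda>x. (norm (h x))\<^sup>2)" for a b
  proof -
    obtain C where C: "C \<ge> 0" "AE x in lebesgue. x \<in> {a..b} \<longrightarrow> norm (h x) \<le> C * (norm (f x) + norm (g x))"
      using le by blast
    have i: "set_integrable lebesgue {a..b} (\<lambda>x. 2 * C\<^sup>2 * ((norm (f x))\<^sup>2 + (norm (g x))\<^sup>2))"
      using f g by (intro set_integrable_mult_right set_integral_add) (auto simp: L2loc_def)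
    have "AE x in lebesgue. x \<in> {a..b} \<longrightarrow> norm ((norm (h x))\<^sup>2) \<le> norm (2 * C\<^sup>2 * ((norm (f x))\<^sup>2 + (norm (g x))\<^sup>2))"
      using C(2)
    proof eventually_elim
      case (elim x)
      show ?case
      proof
        assume "x \<in> {a..b}"
        with elim have "(norm (h x))\<^sup>2 \<le> (C * (norm (f x) + norm (g x)))\<^sup>2" by (intro power_mono) auto
        also have "\<dots> = C\<^sup>2 * (norm (f x) + norm (g x))\<^sup>2" by (simp add: power_mult_distrib)
        also have "(norm (f x) + norm (g x))\<^sup>2 \<le> 2 * ((norm (f x))\<^sup>2 + (norm (g x))\<^sup>2)"
          using zero_le_power2[of "norm (f x) - norm (g x)"] by (simp add: power2_sum power2_diff)
        finally have "(norm (h x))\<^sup>2 \<le> 2 * C\<^sup>2 * ((norm (f x))\<^sup>2 + (norm (g x))\<^sup>2)"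
          by (simp add: mult_left_mono distrib_left mult.assoc mult.left_commute)
        then show "norm ((norm (h x))\<^sup>2) \<le> norm (2 * C\<^sup>2 * ((norm (f x))\<^sup>2 + (norm (g x))\<^sup>2))"
          by simp
      qed
    qed
    then show ?thesis
      using h by (intro set_integrable_bound[OF i] set_borel_measurable_lebesgue_Icc) simp_all
  qed
  with h show ?thesis by (simp add: L2loc_def)
qed

lemma L2loc_continuous:
  assumes "continuous_on UNIV f"
  shows "f \<in> L2loc"
proof -
  have "f \<in> borel_measurable lebesgue"
    using borel_measurable_continuous_onI[OF assms] by (simp add: measurable_completion)
  moreover have "set_integrable lebesgue {a..b} (\<lambda>x. (norm (f x))\<^sup>2)" for a b
    by (intro absolutely_integrable_continuous_real continuous_intros continuous_on_subset[OF assms]) auto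
  ultimately show ?thesis by (simp add: L2loc_def)
qed

lemma L2loc_cong_ae:
  assumes "f \<in> L2loc" "AE x in lebesgue. f x = g x"
  shows "g \<in> L2loc"
proof (rule L2loc_dominated[OF assms(1,1)])
  show "g \<in> borel_measurable lebesgue"
    by (rule borel_measurable_AE[OF L2loc_measurable[OF assms(1)] assms(2)])
  have "AE x in lebesgue. x \<in> {a..b} \<longrightarrow> norm (g x) \<le> 1 * (norm (f x) + norm (f x))" for a b
    using assms(2) by eventually_elim simp
  then show "\<exists>C\<ge>0. AE x in lebesgue. x \<in> {a..b} \<longrightarrow> norm (g x) \<le> C * (norm (f x) + norm (f x))" for a b
    by (intro exI[of _ 1] conjI) auto
qed

lemma L2loc_cont_mult:
  fixes c f :: "real \<Rightarrow> complex"
  assumes c: "continuous_on UNIV c" and f: "f \<in> L2loc"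
  shows "(\<lambda>x. c x * f x) \<in> L2loc"
proof (rule L2loc_dominated[OF f f])
  have "c \<in> borel_measurable lebesgue"
    using borel_measurable_continuous_onI[OF c] by (simp add: measurable_completion)
  then show "(\<lambda>x. c x * f x) \<in> borel_measurable lebesgue" using f by measurable
  fix a b
  have "bounded (c ` {a..b})"
    by (intro compact_imp_bounded compact_continuous_image continuous_on_subset[OF c]) auto
  then obtain C where C: "C > 0" "\<And>x. x \<in> {a..b} \<Longrightarrow> norm (c x) \<le> C" unfolding bounded_pos by auto
  have "norm (c x * f x) \<le> C * (norm (f x) + norm (f x))" if "x \<in> {a..b}" for x
  proof -
    have "norm (c x * f x) \<le> C * norm (f x)" unfolding norm_mult using C(2)[OF that] by (intro mult_right_mono) auto
    also have "\<dots> \<le> C * (norm (f x) + norm (f x))" using C(1) by simp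
    finally show ?thesis .
  qed
  with C(1) show "\<exists>C\<ge>0. AE x in lebesgue. x \<in> {a..b} \<longrightarrow> norm (c x * f x) \<le> C * (norm (f x) + norm (f x))"
    by (intro exI[of _ C]) auto
qed

lemma L2loc_diff:
  assumes "f \<in> L2loc" "g \<in> L2loc"
  shows "(\<lambda>x. f x - g x) \<in> L2loc"
proof (rule L2loc_dominated[OF assms])
  show "(\<lambda>x. f x - g x) \<in> borel_measurable lebesgue" using assms by measurable
qed (intro exI[of _ 1], simp add: norm_triangle_ineq4)

lemma L2loc_of_real:
  assumes "f \<in> L2loc"
  shows "(\<lambda>x. of_real (f x) :: complex) \<in> L2loc"
proof (rule L2loc_dominated[OF assms assms])
  show "(\<lambda>x. of_real (f x) :: complex) \<in> borel_measurable lebesgue" using assms by measurable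
qed (intro exI[of _ 1], simp)

lemma L2loc_mult_integrable:
  fixes f g :: "real \<Rightarrow> complex"
  assumes f: "f \<in> L2loc" and g: "g \<in> L2loc"
  shows "set_integrable lebesgue {a..b} (\<lambda>x. f x * g x)"
proof -
  have i: "set_integrable lebesgue {a..b} (\<lambda>x. (norm (f x))\<^sup>2 + (norm (g x))\<^sup>2)"
    using f g by (intro set_integral_add) (auto simp: L2loc_def)
  have m: "(\<lambda>x. f x * g x) \<in> borel_measurable lebesgue" using f g by measurable
  have "norm (f x * g x) \<le> norm ((norm (f x))\<^sup>2 + (norm (g x))\<^sup>2)" for x
  proof -
    have "2 * (norm (f x) * norm (g x)) \<le> (norm (f x))\<^sup>2 + (norm (g x))\<^sup>2"
      using zero_le_power2[of "norm (f x) - norm (g x)"] by (simp add: power2_diff)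
    moreover have "0 \<le> norm (f x) * norm (g x)" by simp
    ultimately show ?thesis unfolding norm_mult by (smt (verit) real_norm_def)
  qed
  then show ?thesis
    by (intro set_integrable_bound[OF i] set_borel_measurable_lebesgue_Icc m) simp
qed

lemma L2loc_integrable:
  assumes f: "f \<in> L2loc"
  shows "set_integrable lebesgue {a..b} f"
proof -
  have i: "set_integrable lebesgue {a..b} (\<lambda>x. (norm (f x))\<^sup>2 + 1)"
    using f by (intro set_integral_add absolutely_integrable_on_const) (auto simp: L2loc_def)
  have "norm (f x) \<le> norm ((norm (f x))\<^sup>2 + 1)" for x
  proof -
    have "0 \<le> (norm (f x) - 1)\<^sup>2" by simp
    then have "2 * norm (f x) \<le> (norm (f x))\<^sup>2 + 1" by (simp add: power2_diff)
    then show ?thesis using norm_ge_zero[of "f x"] by (smt (verit) real_norm_def)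
  qed
  then show ?thesis
    using f by (intro set_integrable_bound[OF i] set_borel_measurable_lebesgue_Icc) (simp_all add: L2loc_measurable)
qed

lemma H1loc_ftc:
  assumes f: "f \<in> H1loc" and ab: "a \<le> b"
  shows "(LINT x:{a..b}|lebesgue. ddx f x) = f b - f a"
proof -
  have "(ddx f has_integral f b - f a) {a..b}"
  proof (rule abs_cont_on_has_integral[OF H1loc_abs_cont[OF f] ab])
    show "negligible {x. \<not> (f has_vector_derivative ddx f x) (at x)}"
      using H1loc_deriv_ae[OF f] by (simp add: ae_lebesgue_iff_negligible)
  qed (auto intro: has_vector_derivative_at_within)
  then show ?thesis
    using set_lebesgue_integral_eq_integral(2)[OF L2loc_integrable[OF L2loc_ddx[OF f]]]
    by (simp add: integral_unique)
qed

text \<open>In the limit the bound on increments becomes a bound on the derivatives, whence the square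
  integrability.\<close>
lemma H1loc_dominated:
  fixes f :: "real \<Rightarrow> 'a::euclidean_space" and g :: "real \<Rightarrow> 'b::euclidean_space"
    and h :: "real \<Rightarrow> 'c::euclidean_space"
  assumes f: "f \<in> H1loc" and g: "g \<in> H1loc"
    and le: "\<And>a b. \<exists>C\<ge>0. \<forall>x\<in>{a..b}. \<forall>y\<in>{a..b}. norm (h y - h x) \<le> C * (norm (f y - f x) + norm (g y - g x))"
  shows "h \<in> H1loc"
proof -
  have ac: "abs_cont_on a b h" for a b
  proof -
    obtain C where "C \<ge> 0" "\<forall>x\<in>{a..b}. \<forall>y\<in>{a..b}. norm (h y - h x) \<le> C * (norm (f y - f x) + norm (g y - g x))"
      using le by blast
    then show ?thesis
      by (intro abs_cont_on_dominated[OF H1loc_abs_cont[OF f] H1loc_abs_cont[OF g], of C]) auto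
  qed
  have cont: "continuous_on UNIV h"
  proof -
    have "continuous (at x) h" for x
      by (rule continuous_on_interior[OF abs_cont_on_continuous[OF ac, of "x-1" "x+1"]]) simp
    then show ?thesis by (simp add: continuous_at_imp_continuous_on)
  qed
  have d: "AE x in lebesgue. (h has_vector_derivative ddx h x) (at x)"
    unfolding ae_lebesgue_iff_negligible
    using abs_cont_on_differentiable_ae[OF ac] by (simp add: vector_derivative_works[symmetric])
  have "ddx h \<in> L2loc"
  proof (rule L2loc_dominated[OF L2loc_ddx[OF f] L2loc_ddx[OF g] borel_measurable_ddx[OF cont d]])
    fix a b :: real
    obtain C where C: "C \<ge> 0" "\<forall>x\<in>{a-1..b+1}. \<forall>y\<in>{a-1..b+1}. norm (h y - h x) \<le> C * (norm (f y - f x) + norm (g y - g x))"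
      using le by blast
    have "AE x in lebesgue. x \<in> {a..b} \<longrightarrow> norm (ddx h x) \<le> C * (norm (ddx f x) + norm (ddx g x))"
      using H1loc_deriv_ae[OF f] H1loc_deriv_ae[OF g] d
    proof eventually_elim
      case (elim x)
      show ?case
      proof
        assume x: "x \<in> {a..b}"
        note lim = elim[THEN has_vector_derivative_imp_tendsto]
        show "norm (ddx h x) \<le> C * (norm (ddx f x) + norm (ddx g x))"
        proof (rule tendsto_le[OF _ _ tendsto_norm[OF lim(3)]])
          show "((\<lambda>t. C * (norm ((f (x + t) - f x) /\<^sub>R t) + norm ((g (x + t) - g x) /\<^sub>R t)))
             \<longlongrightarrow> C * (norm (ddx f x) + norm (ddx g x))) (at 0)"
            by (intro tendsto_intros lim(1,2))
          have "norm ((h (x + t) - h x) /\<^sub>R t) \<le> C * (norm ((f (x + t) - f x) /\<^sub>R t) + norm ((g (x + t) - g x) /\<^sub>R t))"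
            if "t \<noteq> 0" "dist t 0 < 1" for t
          proof -
            have "norm (h (x + t) - h x) \<le> C * (norm (f (x + t) - f x) + norm (g (x + t) - g x))"
              by (intro C(2)[rule_format]) (use that x in \<open>auto simp: dist_real_def\<close>)
            then have "\<bar>inverse t\<bar> * norm (h (x + t) - h x) \<le> \<bar>inverse t\<bar> * (C * (norm (f (x + t) - f x) + norm (g (x + t) - g x)))"
              by (intro mult_left_mono) auto
            also have "\<dots> = C * (\<bar>inverse t\<bar> * norm (f (x + t) - f x) + \<bar>inverse t\<bar> * norm (g (x + t) - g x))"
              by (simp only: distrib_left mult.left_commute)
            finally show ?thesis by (simp only: norm_scaleR)
          qed
          then show "\<forall>\<^sub>F t in at 0. norm ((h (x + t) - h x) /\<^sub>R t) \<le> C * (norm ((f (x + t) - f x) /\<^sub>R t) + norm ((g (x + t) - g x) /\<^sub>R t))"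
            unfolding eventually_at by (intro exI[of _ 1]) auto
        qed simp
      qed
    qed
    with C(1) show "\<exists>C\<ge>0. AE x in lebesgue. x \<in> {a..b} \<longrightarrow> norm (ddx h x) \<le> C * (norm (ddx f x) + norm (ddx g x))"
      by blast
  qed
  with ac show ?thesis by (simp add: H1loc_def L2loc_def)
qed

section \<open>Closure properties of \<open>H1loc\<close>\<close>

lemma continuous_on_interval_bound:
  assumes "continuous_on UNIV f"
  shows "\<exists>C>0. \<forall>x\<in>{a..b::real}. norm (f x) \<le> C"
proof -
  have "bounded (f ` {a..b})"
    by (intro compact_imp_bounded compact_continuous_image continuous_on_subset[OF assms]) auto
  then show ?thesis unfolding bounded_pos by auto
qed

lemma H1loc_id: "(\<lambda>x::real. x) \<in> H1loc"
  by (auto simp: H1loc_def abs_cont_on_id intro!: absolutely_integrable_on_const)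

lemma H1loc_lipschitz:
  fixes h :: "real \<Rightarrow> 'a::euclidean_space"
  assumes "\<And>x y. norm (h y - h x) \<le> C * \<bar>y - x\<bar>"
  shows "h \<in> H1loc"
proof (rule H1loc_dominated[OF H1loc_id H1loc_id])
  have C: "C \<ge> 0" using order_trans[OF norm_ge_zero assms[of 1 0]] by simp
  have "norm (h y - h x) \<le> C * (norm (y - x) + norm (y - x))" for x y
    by (rule order_trans[OF assms]) (use C in \<open>auto intro: mult_left_mono\<close>)
  with C show "\<exists>C\<ge>0. \<forall>x\<in>{a..b}. \<forall>y\<in>{a..b}. norm (h y - h x) \<le> C * (norm (y - x) + norm (y - x))" for a b
    by blast
qed

lemma H1loc_mult:
  fixes f g :: "real \<Rightarrow> complex"
  assumes f: "f \<in> H1loc" and g: "g \<in> H1loc"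
  shows "(\<lambda>x. f x * g x) \<in> H1loc"
proof (rule H1loc_dominated[OF f g])
  fix a b :: real
  obtain A B where A: "A > 0" "\<forall>x\<in>{a..b}. norm (f x) \<le> A" and B: "B > 0" "\<forall>x\<in>{a..b}. norm (g x) \<le> B"
    using continuous_on_interval_bound[OF H1loc_continuous_on[OF f]] continuous_on_interval_bound[OF H1loc_continuous_on[OF g]]
    by meson
  have "norm (f y * g y - f x * g x) \<le> (A + B) * (norm (f y - f x) + norm (g y - g x))"
    if "x \<in> {a..b}" "y \<in> {a..b}" for x y
  proof -
    have "f y * g y - f x * g x = f y * (g y - g x) + (f y - f x) * g x" by (simp add: algebra_simps)
    also have "norm \<dots> \<le> A * norm (g y - g x) + norm (f y - f x) * B"
      using A B that by (intro norm_triangle_mono) (auto simp: norm_mult intro!: mult_mono)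
    also have "\<dots> \<le> (A + B) * (norm (f y - f x) + norm (g y - g x))"
      using A(1) B(1) by (simp add: algebra_simps)
    finally show ?thesis .
  qed
  then show "\<exists>C\<ge>0. \<forall>x\<in>{a..b}. \<forall>y\<in>{a..b}. norm (f y * g y - f x * g x) \<le> C * (norm (f y - f x) + norm (g y - g x))"
    using A(1) B(1) by (intro exI[of _ "A + B"]) auto
qed

lemma exp_lipschitz_bounded:
  fixes v w :: complex
  assumes "norm v \<le> R" "norm w \<le> R"
  shows "norm (exp v - exp w) \<le> exp R * norm (v - w)"
proof (rule field_differentiable_bound[of "cball 0 R" exp exp])
  fix z :: complex assume "z \<in> cball 0 R"
  then show "norm (exp z) \<le> exp R"
    using norm_exp[of z] by (auto intro: order_trans)
qed (use assms in \<open>simp_all add: DERIV_subset[OF DERIV_exp]\<close>)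

lemma H1loc_exp:
  fixes u :: "real \<Rightarrow> real"
  assumes u: "u \<in> H1loc"
  shows "(\<lambda>x. exp (z * of_real (u x)) :: complex) \<in> H1loc"
proof (rule H1loc_dominated[OF u u])
  fix a b :: real
  obtain A where A: "A > 0" "\<forall>x\<in>{a..b}. norm (u x) \<le> A"
    using continuous_on_interval_bound[OF H1loc_continuous_on[OF u]] by meson
  define C where "C = exp (norm z * A) * norm z"
  have "norm (exp (z * of_real (u y)) - exp (z * of_real (u x))) \<le> C * (norm (u y - u x) + norm (u y - u x))"
    if "x \<in> {a..b}" "y \<in> {a..b}" for x y
  proof -
    have "norm (exp (z * of_real (u y)) - exp (z * of_real (u x)))
        \<le> exp (norm z * A) * norm (z * of_real (u y) - z * of_real (u x))"
      using A that by (intro exp_lipschitz_bounded) (auto simp: norm_mult intro!: mult_left_mono)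
    also have "\<dots> = C * norm (u y - u x)"
      by (simp add: C_def norm_mult flip: of_real_diff right_diff_distrib)
    also have "\<dots> \<le> C * (norm (u y - u x) + norm (u y - u x))" by (simp add: C_def)
    finally show ?thesis .
  qed
  then show "\<exists>C\<ge>0. \<forall>x\<in>{a..b}. \<forall>y\<in>{a..b}. norm (exp (z * of_real (u y)) - exp (z * of_real (u x))) \<le> C * (norm (u y - u x) + norm (u y - u x))"
    by (intro exI[of _ C]) (auto simp: C_def)
qed

lemma ddx_exp_ae:
  fixes u :: "real \<Rightarrow> real"
  assumes u: "u \<in> H1loc"
  shows "AE x in lebesgue. ddx (\<lambda>x. exp (z * of_real (u x)) :: complex) x = z * of_real (ddx u x) * exp (z * of_real (u x))"
  using H1loc_deriv_ae[OF u]
proof eventually_elim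
  case (elim x)
  have "((\<lambda>x. exp (z * of_real (u x)) :: complex) has_vector_derivative (z * of_real (ddx u x)) * exp (z * of_real (u x))) (at x)"
    by (rule field_vector_diff_chain_at[of "\<lambda>x. z * of_real (u x)" _ x exp, unfolded o_def])
      (auto intro!: derivative_eq_intros has_vector_derivative_mult_right has_vector_derivative_of_real
          elim[folded has_real_derivative_iff_has_vector_derivative])
  then show ?case by (rule vector_derivative_at)
qed

lemma ddx_mult_ae:
  fixes f g :: "real \<Rightarrow> complex"
  assumes "f \<in> H1loc" "g \<in> H1loc"
  shows "AE x in lebesgue. ddx (\<lambda>x. f x * g x) x = f x * ddx g x + ddx f x * g x"
  using H1loc_deriv_ae[OF assms(1)] H1loc_deriv_ae[OF assms(2)]
proof eventually_elim
  case (elim x)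
  show ?case by (rule vector_derivative_at[OF has_vector_derivative_mult[OF elim]])
qed

subsection \<open>The measure \<open>\<upsilon>\<close>\<close>

lemma DperD:
  assumes "(u, M) \<in> Dper l"
  shows "u \<in> H1loc" "\<And>x. u (x + l) = u x" "sets M = sets borel"
    "\<And>K. compact K \<Longrightarrow> emeasure M K < \<infinity>"
    "\<And>B. B \<in> sets borel \<Longrightarrow> (\<integral>\<^sup>+x\<in>B. ennreal ((u x)\<^sup>2 + (ddx u x)\<^sup>2) \<partial>lebesgue) \<le> emeasure M B"
  using assms by (auto simp: Dper_def)

lemma sigma_finite_locally_finite:
  fixes M :: "real measure"
  assumes "sets M = sets borel" "\<And>K. compact K \<Longrightarrow> emeasure M K < \<infinity>"
  shows "sigma_finite_measure M"
proof
  let ?A = "range (\<lambda>n::nat. {- real n..real n})"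
  have "x \<in> \<Union>?A" for x :: real
  proof -
    obtain n :: nat where "\<bar>x\<bar> < real n" using reals_Archimedean2 by blast
    then have "x \<in> {- real n..real n}" by auto
    then show ?thesis by blast
  qed
  moreover have "space M = UNIV" using assms(1) sets_eq_imp_space_eq[of M borel] by simp
  ultimately show "\<exists>A. countable A \<and> A \<subseteq> sets M \<and> \<Union>A = space M \<and> (\<forall>a\<in>A. emeasure M a \<noteq> \<infinity>)"
    using assms by (intro exI[of _ ?A]) (auto simp: less_top)
qed

lemma compactly_supportedE:
  fixes f :: "real \<Rightarrow> 'a::real_normed_vector"
  assumes "compactly_supported f"
  obtains A B where "A \<le> B" "\<And>x. x \<notin> {A..B} \<Longrightarrow> f x = 0"
proof -
  have "bounded {x. f x \<noteq> 0}"
    using assms unfolding compactly_supported_def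
    by (metis bounded_subset closure_subset compact_imp_bounded)
  then obtain B where B: "B > 0" "\<And>x. f x \<noteq> 0 \<Longrightarrow> \<bar>x\<bar> \<le> B"
    unfolding bounded_pos by auto
  then have "f x = 0" if "x \<notin> {-B..B}" for x using that by (cases "f x = 0") fastforce+
  with B(1) show thesis by (intro that[of "-B" B]) auto
qed

lemma compactly_supportedI:
  fixes f :: "real \<Rightarrow> 'a::real_normed_vector"
  assumes "\<And>x. x \<notin> {A..B} \<Longrightarrow> f x = 0"
  shows "compactly_supported f"
proof -
  have "{x. f x \<noteq> 0} \<subseteq> {A..B}" using assms by blast
  then have "bounded {x. f x \<noteq> 0}" by (rule bounded_subset[rotated]) auto
  then show ?thesis unfolding compactly_supported_def by (simp add: compact_closure)
qed

lemma Cc_integrable: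
  fixes F :: "real \<Rightarrow> complex"
  assumes M: "sets M = sets borel" "\<And>K. compact K \<Longrightarrow> emeasure M K < \<infinity>" and F: "F \<in> Cc"
  shows "integrable M F"
proof -
  from F have "compactly_supported F" by (simp add: Cc_def)
  then obtain A B where AB: "\<And>x. x \<notin> {A..B} \<Longrightarrow> F x = 0"
    by (rule compactly_supportedE) blast
  obtain C where C: "C > 0" "\<forall>x\<in>{A..B}. norm (F x) \<le> C"
    using continuous_on_interval_bound[of F A B] F by (auto simp: Cc_def)
  have "F \<in> borel_measurable M"
    using F M(1) by (auto simp: Cc_def measurable_cong_sets[OF M(1) refl] intro: borel_measurable_continuous_onI)
  then show ?thesis
    by (intro integrableI_bounded_set[of "{A..B}" M F C]) (use M AB C(2) in auto)
qed

text \<open>Since \<open>\<mu>\<close> dominates the absolutely continuous measure with density \<open>u\<^sup>2 + u'\<^sup>2\<close>, the latter has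
  a Radon-Nikodym density \<open>D \<le> 1\<close> with respect to \<open>\<mu>\<close>, so that \<open>\<upsilon>\<close> has density \<open>1 - D\<close>.\<close>
lemma upsilon_density:
  assumes D: "(u, M) \<in> Dper l"
  obtains D v where "D \<in> borel_measurable borel" "\<And>x. 0 \<le> D x" "\<And>x. D x \<le> 1"
    "v \<in> borel_measurable borel" "AE x in lborel. ddx u x = v x"
    "upsilon u M = density M (\<lambda>x. ennreal (1 - D x))"
    "density M (\<lambda>x. ennreal (D x)) = density lborel (\<lambda>x. ennreal ((u x)\<^sup>2 + (v x)\<^sup>2))"
proof -
  note Dp = DperD[OF D]
  have [measurable_cong]: "sets M = sets borel" by (rule Dp(3))
  interpret M: sigma_finite_measure M by (rule sigma_finite_locally_finite[OF Dp(3,4)])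
  have um [measurable]: "u \<in> borel_measurable borel"
    by (intro borel_measurable_continuous_onI H1loc_continuous_on Dp(1))
  obtain v where v [measurable]: "v \<in> borel_measurable lborel" and vae: "AE x in lborel. ddx u x = v x"
    using completion_ex_borel_measurable_real[OF H1loc_ddx_measurable[OF Dp(1)]] by blast
  have vae': "AE x in lebesgue. ddx u x = v x" using vae by (rule AE_completion)
  define \<rho> where "\<rho> = density lborel (\<lambda>x. ennreal ((u x)\<^sup>2 + (v x)\<^sup>2))"
  have sr [measurable_cong, simp]: "sets \<rho> = sets borel" by (simp add: \<rho>_def)
  have rho: "(\<integral>\<^sup>+x\<in>B. ennreal ((u x)\<^sup>2 + (ddx u x)\<^sup>2) \<partial>lebesgue) = emeasure \<rho> B" if [measurable]: "B \<in> sets borel" for B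
  proof -
    have "(\<integral>\<^sup>+x\<in>B. ennreal ((u x)\<^sup>2 + (ddx u x)\<^sup>2) \<partial>lebesgue) = (\<integral>\<^sup>+x. ennreal ((u x)\<^sup>2 + (v x)\<^sup>2) * indicator B x \<partial>lebesgue)"
      by (intro nn_integral_cong_AE) (use vae' in \<open>eventually_elim, simp\<close>)
    also have "\<dots> = (\<integral>\<^sup>+x. ennreal ((u x)\<^sup>2 + (v x)\<^sup>2) * indicator B x \<partial>lborel)"
      by (intro nn_integral_completion)
    also have "\<dots> = emeasure \<rho> B" by (simp add: \<rho>_def emeasure_density)
    finally show ?thesis .
  qed
  have le: "emeasure \<rho> B \<le> emeasure M B" if "B \<in> sets borel" for B
    using Dp(5)[OF that] rho[OF that] by simp
  have "absolutely_continuous M \<rho>"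
    unfolding absolutely_continuous_def null_sets_def using le Dp(3) by fastforce
  then obtain f where f [measurable]: "f \<in> borel_measurable M" and fr: "density M f = \<rho>"
    using M.Radon_Nikodym[of \<rho>] Dp(3) by auto
  have f' [measurable]: "f \<in> borel_measurable borel" using f measurable_cong_sets[OF Dp(3) refl] by blast
  have f1: "AE x in M. f x \<le> 1"
  proof -
    \<comment> \<open>On a bounded piece A of the set where f > 1 the measure M is finite, and the
      integral of f - 1 over A is \<rho>(A) - M(A). This truncated difference is 0 because \<rho> <=
      M.\<close>
    have "AE x in M. \<not> (x \<in> {- real n..real n} \<and> 1 < f x)" for n :: nat
    proof -
      define A where "A = {x \<in> {- real n..real n}. 1 < f x}"
      have A [measurable]: "A \<in> sets borel" unfolding A_def by measurable
      have "emeasure M A \<le> emeasure M {- real n..real n}" by (intro emeasure_mono) (auto simp: A_def)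
      also have "\<dots> < \<infinity>" by (intro Dp(4)) auto
      finally have fin: "emeasure M A < \<infinity>" .
      have "(\<integral>\<^sup>+x. f x * indicator A x - indicator A x \<partial>M) = (\<integral>\<^sup>+x. f x * indicator A x \<partial>M) - (\<integral>\<^sup>+x. indicator A x \<partial>M)"
        using fin by (intro nn_integral_diff) (auto simp: A_def split: split_indicator)
      also have "\<dots> = emeasure \<rho> A - emeasure M A"
        by (simp add: fr[symmetric] emeasure_density)
      also have "\<dots> = 0"
        using le[OF A] le_less_trans[OF le[OF A] fin] by (simp add: diff_eq_0_iff_ennreal less_top)
      finally have "AE x in M. f x * indicator A x - indicator A x = 0"
        by (subst (asm) nn_integral_0_iff_AE) auto
      then show ?thesis
      proof eventually_elim
        case (elim x)
        then show ?case
          by (cases "x \<in> A") (auto simp: A_def diff_eq_0_iff_ennreal)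
      qed
    qed
    then have "AE x in M. \<forall>n::nat. \<not> (x \<in> {- real n..real n} \<and> 1 < f x)" by (simp add: AE_all_countable)
    then show ?thesis
    proof eventually_elim
      case (elim x)
      obtain n where "\<bar>x\<bar> < real n" using reals_Archimedean2 by blast
      then have "x \<in> {- real n..real n}" by auto
      with elim show ?case by (auto simp: not_less)
    qed
  qed
  \<comment> \<open>Truncation makes D <= 1 hold everywhere, so that 1 - D is a non-negative
    density; by \<open>f1\<close> it alters f only on a null set of M.\<close>
  define D where "D x = enn2real (min 1 (f x))" for x
  have Dm [measurable]: "D \<in> borel_measurable borel" unfolding D_def by measurable
  have D0: "0 \<le> D x" for x by (simp add: D_def)
  have Dmin: "ennreal (D x) = min 1 (f x)" for x unfolding D_def
    by (rule ennreal_enn2real) (simp add: min_less_iff_disj)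
  have D1: "D x \<le> 1" for x using Dmin[of x] by (metis D0 ennreal_le_1 min.cobounded1)
  have Dr: "density M (\<lambda>x. ennreal (D x)) = \<rho>"
    unfolding fr[symmetric] by (intro density_cong) (use f1 in \<open>auto simp: Dmin min_def elim!: eventually_mono\<close>)
  define N where "N = density M (\<lambda>x. ennreal (1 - D x))"
  have sN: "sets N = sets borel" by (simp add: N_def Dp(3))
  have dec: "emeasure M B = emeasure \<rho> B + emeasure N B" if [measurable]: "B \<in> sets borel" for B
  proof -
    have "emeasure \<rho> B + emeasure N B = (\<integral>\<^sup>+x. ennreal (D x) * indicator B x + ennreal (1 - D x) * indicator B x \<partial>M)"
      unfolding Dr[symmetric] N_def by (subst nn_integral_add) (auto simp: emeasure_density)
    also have "\<dots> = (\<integral>\<^sup>+x. indicator B x \<partial>M)"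
      using D0 D1 by (intro nn_integral_cong) (auto split: split_indicator simp flip: ennreal_plus)
    finally show ?thesis by simp
  qed
  have "upsilon u M = N"
    unfolding upsilon_def
  proof (rule the_equality)
    show "sets N = sets borel \<and> (\<forall>B\<in>sets borel. emeasure M B =
        (\<integral>\<^sup>+x\<in>B. ennreal ((u x)\<^sup>2 + (ddx u x)\<^sup>2) \<partial>lebesgue) + emeasure N B)"
      using sN by (auto simp only: rho dec)
    fix N' assume "sets N' = sets borel \<and> (\<forall>B\<in>sets borel. emeasure M B =
        (\<integral>\<^sup>+x\<in>B. ennreal ((u x)\<^sup>2 + (ddx u x)\<^sup>2) \<partial>lebesgue) + emeasure N' B)"
    then have sN': "sets N' = sets borel" and dec': "\<And>B. B \<in> sets borel \<Longrightarrow> emeasure M B = emeasure \<rho> B + emeasure N' B"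
      by (auto simp only: rho)
    show "N' = N"
    proof (rule measure_eqI)
      show "sets N' = sets N" by (simp add: sN sN')
      fix B assume "B \<in> sets N'"
      then have B: "B \<in> sets borel" by (simp add: sN')
      \<comment> \<open>Uniqueness is checked on bounded sets, where \<rho> is finite and can be
        cancelled, and then extended by continuity from below.\<close>
      let ?B = "\<lambda>n::nat. B \<inter> {- real n..real n}"
      have eq: "emeasure N' (?B n) = emeasure N (?B n)" for n
      proof -
        have b: "?B n \<in> sets borel" using B by simp
        have "emeasure M (?B n) \<le> emeasure M {- real n..real n}" by (intro emeasure_mono) (auto simp: Dp(3))
        also have "\<dots> < \<infinity>" by (intro Dp(4)) auto
        finally have "emeasure \<rho> (?B n) < \<infinity>" using le[OF b] by (rule le_less_trans[rotated])
        with dec[OF b] dec'[OF b] show ?thesis by (auto simp: ennreal_add_left_cancel)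
      qed
      have inc: "incseq ?B" by (auto simp: incseq_def)
      have un: "(\<Union>n. ?B n) = B"
      proof -
        have "\<exists>n::nat. x \<in> {- real n..real n}" for x
        proof -
          obtain n :: nat where "\<bar>x\<bar> < real n" using reals_Archimedean2 by blast
          then show ?thesis by (intro exI[of _ n]) auto
        qed
        then show ?thesis by auto
      qed
      have "emeasure N' B = (SUP n. emeasure N' (?B n))"
        using SUP_emeasure_incseq[of ?B N'] B inc un sN' by (simp add: image_subset_iff)
      also have "\<dots> = (SUP n. emeasure N (?B n))" by (simp add: eq)
      also have "\<dots> = emeasure N B"
        using SUP_emeasure_incseq[of ?B N] B inc un sN by (simp add: image_subset_iff)
      finally show "emeasure N' B = emeasure N B" .
    qed
  qed
  with Dm D0 D1 v vae Dr show thesis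
    by (intro that[of D v]) (auto simp: N_def \<rho>_def)
qed

text \<open>With 0 <= D <= 1 the functions D F and (1 - D) F are both integrable for M, so the
  density of \<open>upsilon\<close> splits the integral. This is what replaces
  \<open>upsilon\<close> by \<mu> in the weak form.\<close>

lemma integral_upsilon:
  fixes F :: "real \<Rightarrow> complex"
  assumes D: "(u, M) \<in> Dper l" and F: "F \<in> Cc"
  shows "(LINT x|upsilon u M. F x) =
    (LINT x|M. F x) - (LINT x|lebesgue. of_real ((u x)\<^sup>2 + (ddx u x)\<^sup>2) * F x)"
proof -
  note Dp = DperD[OF D]
  obtain d v where d: "d \<in> borel_measurable borel" "\<And>x. 0 \<le> d x" "\<And>x. d x \<le> 1"
    and v: "v \<in> borel_measurable borel" "AE x in lborel. ddx u x = v x"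
    and up: "upsilon u M = density M (\<lambda>x. ennreal (1 - d x))"
    and rho: "density M (\<lambda>x. ennreal (d x)) = density lborel (\<lambda>x. ennreal ((u x)\<^sup>2 + (v x)\<^sup>2))"
    by (rule upsilon_density[OF D]) blast
  have [measurable_cong]: "sets M = sets borel" by (rule Dp(3))
  have [measurable]: "u \<in> borel_measurable borel" "d \<in> borel_measurable borel" "v \<in> borel_measurable borel" "F \<in> borel_measurable borel"
    using F d v borel_measurable_continuous_onI[OF H1loc_continuous_on[OF Dp(1)]]
    by (auto intro: borel_measurable_continuous_onI simp: Cc_def)
  have iF: "integrable M F" by (rule Cc_integrable[OF Dp(3,4) F])
  have idF: "integrable M (\<lambda>x. d x *\<^sub>R F x)"
    by (rule Bochner_Integration.integrable_bound[OF iF]) (use d(2,3) in \<open>auto intro!: mult_left_le_one_le\<close>)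
  have "(LINT x|upsilon u M. F x) = (LINT x|M. (1 - d x) *\<^sub>R F x)"
    unfolding up using d(3) by (subst integral_density) auto
  also have "\<dots> = (LINT x|M. F x) - (LINT x|M. d x *\<^sub>R F x)"
    using iF idF by (simp add: scaleR_diff_left Bochner_Integration.integral_diff)
  also have "(LINT x|M. d x *\<^sub>R F x) = (LINT x|density M (\<lambda>x. ennreal (d x)). F x)"
    using d(2) by (subst integral_density) auto
  also have "\<dots> = (LINT x|lborel. ((u x)\<^sup>2 + (v x)\<^sup>2) *\<^sub>R F x)"
    unfolding rho by (subst integral_density) auto
  also have "\<dots> = (LINT x|lebesgue. ((u x)\<^sup>2 + (v x)\<^sup>2) *\<^sub>R F x)"
    by (intro integral_completion[symmetric]) auto
  also have "\<dots> = (LINT x|lebesgue. of_real ((u x)\<^sup>2 + (ddx u x)\<^sup>2) * F x)"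
  proof (rule integral_cong_AE)
    have "AE x in lebesgue. ddx u x = v x" using v(2) by (rule AE_completion)
    then show "AE x in lebesgue. ((u x)\<^sup>2 + (v x)\<^sup>2) *\<^sub>R F x = of_real ((u x)\<^sup>2 + (ddx u x)\<^sup>2) * F x"
      by eventually_elim (simp add: scaleR_conv_of_real)
    have "F \<in> borel_measurable lebesgue" "u \<in> borel_measurable lebesgue" "v \<in> borel_measurable lebesgue"
      by (auto intro: measurable_completion)
    moreover have "ddx u \<in> borel_measurable lebesgue" by (rule H1loc_ddx_measurable[OF Dp(1)])
    ultimately show "(\<lambda>x. ((u x)\<^sup>2 + (v x)\<^sup>2) *\<^sub>R F x) \<in> borel_measurable lebesgue"
      "(\<lambda>x. of_real ((u x)\<^sup>2 + (ddx u x)\<^sup>2) * F x) \<in> borel_measurable lebesgue" by measurable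
  qed
  finally show ?thesis .
qed

subsection \<open>The weak form in the gauge \<open>exp (z u)\<close>\<close>

lemma integrable_of_set_integrable:
  fixes F :: "real \<Rightarrow> complex"
  assumes "set_integrable lebesgue {A..B} F" "\<And>x. x \<notin> {A..B} \<Longrightarrow> F x = 0"
  shows "integrable lebesgue F"
proof -
  have "(\<lambda>x. indicator {A..B} x *\<^sub>R F x) = F"
    using assms(2) by (auto simp: fun_eq_iff split: split_indicator)
  with assms(1) show ?thesis by (simp add: set_integrable_def)
qed

lemma ddx_eq_0_outside:
  assumes "\<And>x. x \<notin> {A..B} \<Longrightarrow> f x = 0" "x \<notin> {A..B}"
  shows "ddx f x = 0"
proof -
  have "((\<lambda>_. 0) has_vector_derivative 0) (at x)" by (rule has_vector_derivative_const)
  then have "(f has_vector_derivative 0) (at x)"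
    by (rule has_vector_derivative_transform_within_open[where S = "- {A..B}"]) (use assms in auto)
  then show ?thesis by (rule vector_derivative_at)
qed

lemma H1c_mult:
  fixes f g :: "real \<Rightarrow> complex"
  assumes f: "f \<in> H1loc" and g: "g \<in> H1c"
  shows "(\<lambda>x. f x * g x) \<in> H1c"
proof -
  have "compactly_supported g" using g by (simp add: H1c_def)
  then obtain A B where "\<And>x. x \<notin> {A..B} \<Longrightarrow> g x = 0" by (rule compactly_supportedE) blast
  then have "compactly_supported (\<lambda>x. f x * g x)" by (intro compactly_supportedI[of A B]) simp
  moreover have "(\<lambda>x. f x * g x) \<in> H1loc" using f g by (intro H1loc_mult) (auto simp: H1c_def)
  ultimately show ?thesis by (simp add: H1c_def)
qed

lemma H1c_imp_Cc: "h \<in> H1c \<Longrightarrow> h \<in> Cc"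
  by (simp add: H1c_def Cc_def H1loc_continuous_on)

definition potential :: "(real \<Rightarrow> real) \<Rightarrow> complex \<Rightarrow> real \<Rightarrow> complex" where
  "potential u z x = 1/4 - z * of_real (u x) + z\<^sup>2 * (of_real (u x))\<^sup>2"

text \<open>Testing with \<open>h = exp (z u) g\<close> removes all products of \<open>u'\<close> with discontinuous quantities.\<close>
lemma solution_gauged_weak_form:
  assumes D: "(u, M) \<in> Dper l" and sol: "is_solution u M z f" and g: "g \<in> H1c"
  defines "e \<equiv> \<lambda>x. exp (z * complex_of_real (u x))"
  shows "(LINT x|lebesgue. e x * (ddx f x - z * of_real (ddx u x) * f x) * ddx g x) +
     (LINT x|lebesgue. potential u z x * (f x * (e x * g x))) = z\<^sup>2 * (LINT x|M. f x * (e x * g x))"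
proof -
  note Dp = DperD[OF D]
  have u: "u \<in> H1loc" by (rule Dp(1))
  have f: "f \<in> H1loc" and weak: "\<And>h. h \<in> H1c \<Longrightarrow>
        (LINT x|lebesgue. ddx f x * ddx h x) + 1/4 * (LINT x|lebesgue. f x * h x) =
        z * omega u (\<lambda>x. f x * h x) + z\<^sup>2 * (LINT x|upsilon u M. f x * h x)"
    using sol by (auto simp: is_solution_def)
  have e: "e \<in> H1loc" unfolding e_def by (rule H1loc_exp[OF u])
  define h where "h x = e x * g x" for x
  have h: "h \<in> H1c" unfolding h_def by (rule H1c_mult[OF e g])
  have fh: "(\<lambda>x. f x * h x) \<in> H1c" by (rule H1c_mult[OF f h])
  have hl: "h \<in> H1loc" and gl: "g \<in> H1loc" and fhl: "(\<lambda>x. f x * h x) \<in> H1loc"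
    using h g fh by (auto simp: H1c_def)
  have "compactly_supported g" using g by (simp add: H1c_def)
  then obtain A B where g0: "\<And>x. x \<notin> {A..B} \<Longrightarrow> g x = 0" by (rule compactly_supportedE) blast
  have h0: "\<And>x. x \<notin> {A..B} \<Longrightarrow> h x = 0" by (simp add: h_def g0)
  have fh0: "\<And>x. x \<notin> {A..B} \<Longrightarrow> f x * h x = 0" by (simp add: h0)
  have d0: "ddx g x = 0" "ddx h x = 0" "ddx (\<lambda>x. f x * h x) x = 0" if "x \<notin> {A..B}" for x
    using that by (auto intro!: ddx_eq_0_outside[of A B] simp: g0 h0)
  note z0 = g0 h0 d0
  define U where "U x = complex_of_real (u x)" for x
  define U' where "U' x = complex_of_real (ddx u x)" for x
  have cu: "continuous_on UNIV U" unfolding U_def by (intro continuous_intros H1loc_continuous_on[OF u])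
  note cont = H1loc_continuous_on[OF f] H1loc_continuous_on[OF hl] H1loc_continuous_on[OF gl] H1loc_continuous_on[OF e] cu
  have lU': "U' \<in> L2loc" unfolding U'_def by (intro L2loc_of_real L2loc_ddx u)
  note l2 = L2loc_ddx[OF f] L2loc_ddx[OF hl] L2loc_ddx[OF gl] L2loc_ddx[OF fhl] lU' L2loc_continuous
  have i1: "integrable lebesgue (\<lambda>x. ddx f x * ddx h x)"
    by (intro integrable_of_set_integrable[of A B] L2loc_mult_integrable l2) (simp add: z0)
  have i2: "integrable lebesgue (\<lambda>x. f x * h x)"
    by (intro integrable_of_set_integrable[of A B] L2loc_mult_integrable l2 cont) (simp add: z0)
  have i3: "integrable lebesgue (\<lambda>x. U x * (f x * h x))"
    by (intro integrable_of_set_integrable[of A B] L2loc_mult_integrable l2 continuous_intros cont) (simp add: z0)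
  have i4: "integrable lebesgue (\<lambda>x. U' x * ddx (\<lambda>x. f x * h x) x)"
    by (intro integrable_of_set_integrable[of A B] L2loc_mult_integrable l2) (simp add: z0)
  have i5: "integrable lebesgue (\<lambda>x. of_real ((u x)\<^sup>2 + (ddx u x)\<^sup>2) * (f x * h x))"
  proof -
    have "integrable lebesgue (\<lambda>x. U x * (U x * (f x * h x)) + U' x * ((f x * h x) * U' x))"
      by (intro Bochner_Integration.integrable_add integrable_of_set_integrable[of A B] L2loc_mult_integrable l2 L2loc_cont_mult
          continuous_intros cont) (simp_all add: z0)
    also have "(\<lambda>x. U x * (U x * (f x * h x)) + U' x * ((f x * h x) * U' x)) = (\<lambda>x. of_real ((u x)\<^sup>2 + (ddx u x)\<^sup>2) * (f x * h x))"
      by (simp add: U_def U'_def fun_eq_iff power2_eq_square algebra_simps)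
    finally show ?thesis .
  qed
  have i6: "integrable lebesgue (\<lambda>x. e x * (ddx f x - z * U' x * f x) * ddx g x)"
    by (intro integrable_of_set_integrable[of A B] L2loc_mult_integrable L2loc_cont_mult L2loc_diff
         L2loc_cong_ae[OF L2loc_cont_mult[OF _ lU', of "\<lambda>x. z * f x"]] l2 continuous_intros cont) (simp_all add: z0 mult_ac)
  have i7: "integrable lebesgue (\<lambda>x. potential u z x * (f x * h x))"
    unfolding potential_def U_def[symmetric]
    by (intro integrable_of_set_integrable[of A B] L2loc_mult_integrable l2 continuous_intros cont) (simp add: z0)
  let ?I = "\<lambda>F :: real \<Rightarrow> complex. LINT x|lebesgue. F x"
  have "?I (\<lambda>x. e x * (ddx f x - z * U' x * f x) * ddx g x) + ?I (\<lambda>x. potential u z x * (f x * h x))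
     = ?I (\<lambda>x. e x * (ddx f x - z * U' x * f x) * ddx g x + potential u z x * (f x * h x))"
    by (rule Bochner_Integration.integral_add[OF i6 i7, symmetric])
  also have "\<dots> = ?I (\<lambda>x. ddx f x * ddx h x + 1/4 * (f x * h x) - z * (U x * (f x * h x))
      - z * (U' x * ddx (\<lambda>x. f x * h x) x) + z\<^sup>2 * (of_real ((u x)\<^sup>2 + (ddx u x)\<^sup>2) * (f x * h x)))"
  proof (rule integral_cong_AE)
    show "AE x in lebesgue. e x * (ddx f x - z * U' x * f x) * ddx g x + potential u z x * (f x * h x) =
      ddx f x * ddx h x + 1/4 * (f x * h x) - z * (U x * (f x * h x))
      - z * (U' x * ddx (\<lambda>x. f x * h x) x) + z\<^sup>2 * (of_real ((u x)\<^sup>2 + (ddx u x)\<^sup>2) * (f x * h x))"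
      using ddx_mult_ae[OF f hl] ddx_mult_ae[OF e gl, folded h_def] ddx_exp_ae[OF u, of z, folded e_def]
    proof eventually_elim
      case (elim x)
      have h': "ddx h x = e x * ddx g x + z * U' x * (e x * g x)"
        unfolding elim(2) elim(3) U'_def by (simp add: e_def mult_ac)
      \<comment> \<open>Inserting h' = e g' + z u' h, the terms z u' f' h cancel, and the term -z^2
        u'^2 f h arising from \<open>omega\<close> cancels against the u'^2 part of the density of
        \<mu> - \<upsilon>.\<close>
      show ?case
        unfolding elim(1) h'
        by (simp add: h_def potential_def U_def[symmetric] U'_def[symmetric] power2_eq_square algebra_simps)
    qed
  qed (use i1 i2 i3 i4 i5 i6 i7 in \<open>auto intro!: borel_measurable_integrable\<close>)
  also have "\<dots> = ?I (\<lambda>x. ddx f x * ddx h x) + 1/4 * ?I (\<lambda>x. f x * h x) - z * ?I (\<lambda>x. U x * (f x * h x))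
      - z * ?I (\<lambda>x. U' x * ddx (\<lambda>x. f x * h x) x) + z\<^sup>2 * ?I (\<lambda>x. of_real ((u x)\<^sup>2 + (ddx u x)\<^sup>2) * (f x * h x))"
    using i1 i2 i3 i4 i5 by (simp add: Bochner_Integration.integral_add Bochner_Integration.integral_diff)
  also have "\<dots> = z\<^sup>2 * (LINT x|M. f x * h x)"
    using weak[OF h] integral_upsilon[OF D H1c_imp_Cc[OF fh]]
    by (simp add: omega_def U_def U'_def algebra_simps)
  finally show ?thesis by (simp add: U'_def h_def)
qed

subsection \<open>The Volterra equation\<close>

definition prim :: "(real \<Rightarrow> real) \<Rightarrow> complex \<Rightarrow> real \<Rightarrow> real \<Rightarrow> complex" where
  "prim u z a y = integral {a..y} (\<lambda>t. exp (- 2 * z * of_real (u t)))"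

text \<open>Clamping s to \<open>{a..x}\<close> makes the kernel continuous on the whole line and
  zero beyond x. To the left of a it does not vanish in general, but there it is always paired with
  the value at a of a function that is zero at a.\<close>

definition kern :: "(real \<Rightarrow> real) \<Rightarrow> complex \<Rightarrow> real \<Rightarrow> real \<Rightarrow> real \<Rightarrow> complex" where
  "kern u z a x s = (prim u z a x - prim u z a (max a (min x s))) * exp (2 * z * of_real (u s))"

lemma prim_base [simp]: "prim u z a a = 0"
  by (simp add: prim_def)

lemma prim_diff:
  assumes u: "continuous_on UNIV u" and "a \<le> y" "y \<le> x"
  shows "prim u z a x - prim u z a y = integral {y..x} (\<lambda>t. exp (- 2 * z * of_real (u t)))"
proof -
  have "(\<lambda>t. exp (- 2 * z * complex_of_real (u t))) integrable_on {a..x}"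
    by (intro integrable_continuous_real continuous_intros continuous_on_subset[OF u]) auto
  from Henstock_Kurzweil_Integration.integral_combine[OF assms(2,3) this]
  show ?thesis by (simp add: prim_def algebra_simps)
qed

lemma prim_lipschitz:
  assumes u: "continuous_on UNIV u" and C: "\<And>t. t \<in> {a..x} \<Longrightarrow> norm (exp (- 2 * z * complex_of_real (u t))) \<le> C"
    and y: "y1 \<in> {a..x}" "y2 \<in> {a..x}"
  shows "norm (prim u z a y2 - prim u z a y1) \<le> C * \<bar>y2 - y1\<bar>"
  using y
proof (induction y1 y2 rule: linorder_wlog)
  case (le y1 y2)
  then have "norm (prim u z a y2 - prim u z a y1) \<le> C * (y2 - y1)"
    unfolding prim_diff[OF u, of a y1 y2] using le
    by (subst prim_diff[OF u], simp, simp)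
      (intro integral_bound C continuous_intros continuous_on_subset[OF u], auto)
  with le show ?case by simp
qed (simp add: norm_minus_commute abs_minus_commute)

lemma prim_deriv:
  assumes u: "continuous_on UNIV u" and y: "a < y"
  shows "(prim u z a has_vector_derivative exp (- 2 * z * of_real (u y))) (at y)"
proof -
  have "((\<lambda>v. integral {a..v} (\<lambda>t. exp (- 2 * z * complex_of_real (u t)))) has_vector_derivative exp (- 2 * z * of_real (u y))) (at y within {a..y+1})"
    using y by (intro integral_has_vector_derivative continuous_intros continuous_on_subset[OF u]) auto
  moreover have "at y within {a..y+1} = at y" using y by (intro at_within_interior) simp
  ultimately show ?thesis by (simp add: prim_def[abs_def])
qed

text \<open>Dominated convergence for test functions with ever steeper cut-offs. The limit is
  required at every s, because N may have atoms.\<close>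

lemma tendsto_integral_ramp:
  fixes N :: "real measure" and c G :: "real \<Rightarrow> complex" and g :: "nat \<Rightarrow> real \<Rightarrow> complex"
  assumes N: "sets N = sets borel" "\<And>K. compact K \<Longrightarrow> emeasure N K < \<infinity>"
    and c: "continuous_on UNIV c" and g: "\<And>n. continuous_on UNIV (g n)" and L: "L \<in> borel_measurable borel"
    and lim: "\<And>s. (\<lambda>n. c s * g n s) \<longlonglongrightarrow> L s"
    and bd: "\<And>n s. norm (g n s) \<le> C" and supp: "\<And>n s. s \<notin> {A..B} \<Longrightarrow> g n s = 0"
  shows "(\<lambda>n. LINT s|N. c s * g n s) \<longlonglongrightarrow> (LINT s|N. L s)"
proof -
  have [measurable_cong]: "sets N = sets borel" by (rule N(1))
  have [measurable]: "L \<in> borel_measurable borel" "c \<in> borel_measurable borel" "\<And>n. g n \<in> borel_measurable borel"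
    using L c g by (auto intro: borel_measurable_continuous_onI)
  obtain C1 where C1: "C1 > 0" "\<forall>s\<in>{A..B}. norm (c s) \<le> C1"
    using continuous_on_interval_bound[OF c] by blast
  have C0: "C \<ge> 0" using order_trans[OF norm_ge_zero bd] by blast
  show ?thesis
  proof (rule integral_dominated_convergence)
    show "integrable N (\<lambda>s. C1 * C * indicator {A..B} s)"
      using N by (intro integrable_mult_right integrable_real_indicator) auto
    show "AE s in N. norm (c s * g n s) \<le> C1 * C * indicator {A..B} s" for n
    proof (intro AE_I2)
      fix s
      show "norm (c s * g n s) \<le> C1 * C * indicator {A..B} s"
        using C1 bd[of n s] supp[of s n] by (auto simp: norm_mult indicator_def intro!: mult_mono)
    qed
  qed (use lim in auto)
qed

text \<open>The quasi-derivative is tied to f only almost everywhere, so its value at a has to be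
  recovered from averages over intervals shrinking to a from the left. This is how the initial
  condition f^[1](a) = 1 enters the weak form.\<close>

lemma tendsto_left_average:
  fixes F q :: "real \<Rightarrow> complex"
  assumes ae: "AE x in lebesgue. F x = q x" and q: "continuous (at_left a) q"
    and F: "\<And>c d. set_integrable lebesgue {c..d} F"
  shows "(\<lambda>n. of_real (real (Suc n)) * (LINT s:{a - 1 / real (Suc n)..a}|lebesgue. F s)) \<longlonglongrightarrow> q a"
proof (rule LIMSEQ_I)
  fix r :: real assume "r > 0"
  then have r2: "r / 2 > 0" by simp
  have "(q \<longlongrightarrow> q a) (at_left a)" using q by (simp add: continuous_within)
  from tendstoD[OF this r2] obtain b where b: "b < a" "\<And>y. b < y \<Longrightarrow> y < a \<Longrightarrow> dist (q y) (q a) < r / 2"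
    unfolding eventually_at_left_field by blast
  obtain n0 where n0: "1 / real (Suc n0) < a - b"
    using b(1) reals_Archimedean[of "a - b"] by (auto simp: inverse_eq_divide)
  show "\<exists>no. \<forall>n\<ge>no. norm (of_real (real (Suc n)) * (LINT s:{a - 1 / real (Suc n)..a}|lebesgue. F s) - q a) < r"
  proof (intro exI[of _ n0] allI impI)
    fix n assume "n \<ge> n0"
    then have "1 / real (Suc n) \<le> 1 / real (Suc n0)" by (intro divide_left_mono) auto
    with n0 have bn: "b < a - 1 / real (Suc n)" by simp
    let ?I = "{a - 1 / real (Suc n)..a}"
    have m: "measure lebesgue ?I = 1 / real (Suc n)" by simp
    have ci: "set_integrable lebesgue ?I (\<lambda>s. q a)" by (rule absolutely_integrable_on_const) auto
    have "(LINT s:?I|lebesgue. F s) - of_real (1 / real (Suc n)) * q a = (LINT s:?I|lebesgue. F s - q a)"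
      using F ci by (subst set_integral_diff) (auto simp: m set_integral_const scaleR_conv_of_real)
    also have "norm \<dots> \<le> (LINT s:?I|lebesgue. norm (F s - q a))"
      using F ci by (intro set_integral_norm_bound set_integral_diff) auto
    also have "\<dots> \<le> (LINT s:?I|lebesgue. r / 2)"
      unfolding set_lebesgue_integral_def
    proof (rule integral_mono_AE)
      show "integrable lebesgue (\<lambda>x. indicat_real ?I x *\<^sub>R norm (F x - q a))"
        using set_integrable_norm[OF set_integral_diff(1)[OF F ci]] by (simp add: set_integrable_def)
      show "integrable lebesgue (\<lambda>x. indicat_real ?I x *\<^sub>R (r / 2))"
        using absolutely_integrable_on_const[of ?I "r/2"] by (simp add: set_integrable_def)
      show "AE x in lebesgue. indicat_real ?I x *\<^sub>R norm (F x - q a) \<le> indicat_real ?I x *\<^sub>R (r / 2)"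
        using ae
      proof eventually_elim
        case (elim x)
        show ?case
          using b(2)[of x] bn r2 elim by (cases "x = a") (auto simp: indicator_def dist_norm)
      qed
    qed
    also have "\<dots> = 1 / real (Suc n) * (r / 2)" by (simp add: m set_integral_const)
    finally have le: "norm ((LINT s:?I|lebesgue. F s) - of_real (1 / real (Suc n)) * q a) \<le> 1 / real (Suc n) * (r / 2)" .
    have one: "complex_of_real (real (Suc n)) * of_real (1 / real (Suc n)) = 1"
      unfolding of_real_mult[symmetric] by simp
    have "of_real (real (Suc n)) * (LINT s:?I|lebesgue. F s) - q a =
       of_real (real (Suc n)) * ((LINT s:?I|lebesgue. F s) - of_real (1 / real (Suc n)) * q a)"
      by (simp only: right_diff_distrib mult.assoc[symmetric] one mult_1)
    also have "norm \<dots> = real (Suc n) * norm ((LINT s:?I|lebesgue. F s) - of_real (1 / real (Suc n)) * q a)"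
      by (simp only: norm_mult norm_of_real abs_of_nat)
    also have "\<dots> \<le> real (Suc n) * (1 / real (Suc n) * (r / 2))"
      by (intro mult_left_mono le) auto
    also have "\<dots> = r / 2" by (simp del: of_nat_Suc)
    finally show "norm (of_real (real (Suc n)) * (LINT s:?I|lebesgue. F s) - q a) < r" using \<open>r > 0\<close> by simp
  qed
qed


text \<open>The weak form is tested with G times a ramp, where G(s) is the integral of exp (-2 z u)
  from s to x for s in [a, x]. Since G' = -exp (-2 z u) there, the derivative term contributes
  -\<phi>(x). To the left of a the ramp takes the value G(a) down to 0 over a length 1/(n+1), and
  the resulting average of exp (z u) f^[1] tends to its value at a.\<close>

lemma volterra_equation:
  assumes D: "(u, M) \<in> Dper l" and sol: "solves_ivp u M z a 0 1 f" and ax: "a \<le> x"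
  defines "\<phi> \<equiv> \<lambda>y. exp (- z * complex_of_real (u y)) * f y"
  shows "\<phi> x = exp (z * of_real (u a)) * prim u z a x
      + (LINT s|lborel. potential u z s * (kern u z a x s * \<phi> (max a s)))
      - z\<^sup>2 * (LINT s|M. kern u z a x s * \<phi> (max a s))"
proof (cases "a = x")
  case True
  have "f a = 0" using sol by (simp add: solves_ivp_def)
  then show ?thesis using True by (simp add: \<phi>_def kern_def)
next
  case False
  with ax have ax: "a < x" by simp
  note Dp = DperD[OF D]
  have u: "u \<in> H1loc" by (rule Dp(1))
  have cu: "continuous_on S u" for S by (rule H1loc_continuous_on[OF u])
  obtain q where isol: "is_solution u M z f" and fa: "f a = 0" and q: "is_quasi_derivative u z f q" and qa: "q a = 1"
    using sol by (auto simp: solves_ivp_def)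
  have f: "f \<in> H1loc" using isol by (simp add: is_solution_def)
  have cf: "continuous_on S f" for S by (rule H1loc_continuous_on[OF f])
  define e where "e x = exp (z * complex_of_real (u x))" for x
  define em where "em x = exp (- z * complex_of_real (u x))" for x
  have e: "e \<in> H1loc" unfolding e_def[abs_def] by (rule H1loc_exp[OF u])
  have em: "em \<in> H1loc" unfolding em_def[abs_def] by (rule H1loc_exp[OF u])
  have ce: "continuous_on S e" and cem: "continuous_on S em" for S
    using H1loc_continuous_on e em by blast+
  define qt where "qt x = ddx f x - z * of_real (ddx u x) * f x" for x
  have qt: "qt \<in> L2loc"
  proof -
    have "(\<lambda>x. ddx f x - (z * f x) * of_real (ddx u x)) \<in> L2loc"
      by (intro L2loc_diff L2loc_cont_mult L2loc_of_real L2loc_ddx f u continuous_intros cf)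
    then show ?thesis by (simp add: qt_def[abs_def] mult_ac)
  qed
  have eq_int: "set_integrable lebesgue {c..d} (\<lambda>x. e x * qt x)" for c d
    by (intro L2loc_mult_integrable qt L2loc_continuous ce)
  have phi_H1: "\<phi> \<in> H1loc" unfolding \<phi>_def em_def[symmetric] by (rule H1loc_mult[OF em f])
  have cphi: "continuous_on S \<phi>" for S by (rule H1loc_continuous_on[OF phi_H1])
  have phia: "\<phi> a = 0" by (simp add: \<phi>_def fa)
  obtain C where C: "C > 0" "\<And>t. t \<in> {a..x} \<Longrightarrow> norm (exp (- 2 * z * complex_of_real (u t))) \<le> C"
  proof -
    have "continuous_on UNIV (\<lambda>t. exp (- 2 * z * complex_of_real (u t)))"
      by (intro continuous_intros cu)
    from continuous_on_interval_bound[OF this, of a x] show thesis using that by blast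
  qed
  define G where "G s = prim u z a x - prim u z a (max a (min x s))" for s
  have Glip: "norm (G y - G s) \<le> C * \<bar>y - s\<bar>" for s y
  proof -
    have "norm (G y - G s) = norm (prim u z a (max a (min x y)) - prim u z a (max a (min x s)))"
      by (simp add: G_def norm_minus_commute)
    also have "\<dots> \<le> C * \<bar>max a (min x y) - max a (min x s)\<bar>"
      using ax by (intro prim_lipschitz[OF cu, of a x] C(2)) auto
    also have "\<dots> \<le> C * \<bar>y - s\<bar>" using C(1) by (intro mult_left_mono) auto
    finally show ?thesis .
  qed
  have GH: "G \<in> H1loc" by (rule H1loc_lipschitz[OF Glip])
  have cG: "continuous_on S G" for S by (rule H1loc_continuous_on[OF GH])
  have Gx: "G s = 0" if "s \<ge> x" for s using that ax by (simp add: G_def)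
  have Ga: "G s = prim u z a x" if "s \<le> a" for s using that ax by (simp add: G_def)
  define ramp where "ramp n s = complex_of_real (max 0 (min 1 (1 + real (Suc n) * (s - a))))" for n s
  have rlip: "norm (ramp n y - ramp n s) \<le> real (Suc n) * \<bar>y - s\<bar>" for n y s
  proof -
    have "norm (ramp n y - ramp n s) = \<bar>max 0 (min 1 (1 + real (Suc n) * (y - a))) - max 0 (min 1 (1 + real (Suc n) * (s - a)))\<bar>"
      unfolding ramp_def of_real_diff[symmetric] norm_of_real ..
    also have "\<dots> \<le> \<bar>real (Suc n) * (y - a) - real (Suc n) * (s - a)\<bar>" by linarith
    also have "\<dots> = real (Suc n) * \<bar>y - s\<bar>"
      unfolding right_diff_distrib[symmetric] abs_mult by simp
    finally show ?thesis .
  qed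
  have rH: "ramp n \<in> H1loc" for n by (rule H1loc_lipschitz[OF rlip])
  define \<tau> where "\<tau> n = 1 / real (Suc n)" for n
  have \<tau>: "\<tau> n > 0" "\<tau> n \<le> 1" "real (Suc n) * \<tau> n = 1" for n by (auto simp: \<tau>_def)
  have ramp0: "ramp n s = 0" if "s \<le> a - \<tau> n" for n s
  proof -
    have "real (Suc n) * (s - a) \<le> real (Suc n) * (- \<tau> n)" using that by (intro mult_left_mono) auto
    then show ?thesis using \<tau>(3)[of n] by (simp add: ramp_def)
  qed
  have ramp1: "ramp n s = 1" if "a \<le> s" for n s
    using that by (simp add: ramp_def min_def)
  have rampm: "ramp n s = of_real (1 + real (Suc n) * (s - a))" if "a - \<tau> n \<le> s" "s \<le> a" for n s
  proof -
    have "real (Suc n) * (s - a) \<ge> real (Suc n) * (- \<tau> n)" using that by (intro mult_left_mono) auto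
    moreover have "real (Suc n) * (s - a) \<le> 0" using that by (intro mult_nonneg_nonpos) auto
    ultimately show ?thesis using \<tau>(3)[of n] by (simp add: ramp_def)
  qed
  define g where "g n s = G s * ramp n s" for n s
  have gsupp: "g n s = 0" if "s \<notin> {a - \<tau> n..x}" for n s
    using that by (auto simp: g_def ramp0 Gx not_le)
  have gH: "g n \<in> H1c" for n
    unfolding H1c_def g_def[abs_def]
    by (intro CollectI conjI H1loc_mult GH rH compactly_supportedI[of "a - \<tau> n" x])
      (use gsupp in \<open>auto simp: g_def\<close>)
  have cg: "continuous_on S (g n)" for S n using gH[of n] by (auto simp: H1c_def H1loc_continuous_on)
  have g'1: "ddx (g n) s = of_real (real (Suc n)) * prim u z a x" if "a - \<tau> n < s" "s < a" for n s
  proof (rule vector_derivative_at)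
    have "((\<lambda>s. prim u z a x * of_real (1 + real (Suc n) * (s - a))) has_vector_derivative of_real (real (Suc n)) * prim u z a x) (at s)"
      by (auto intro!: derivative_eq_intros has_vector_derivative_mult_right has_vector_derivative_of_real simp: mult.commute)
    then show "(g n has_vector_derivative of_real (real (Suc n)) * prim u z a x) (at s)"
      by (rule has_vector_derivative_transform_within_open[where S = "{a - \<tau> n<..<a}"])
        (use that in \<open>auto simp: g_def rampm Ga\<close>)
  qed
  have g'2: "ddx (g n) s = - exp (- 2 * z * of_real (u s))" if "a < s" "s < x" for n s
  proof (rule vector_derivative_at)
    have "((\<lambda>s. prim u z a x - prim u z a s) has_vector_derivative - exp (- 2 * z * of_real (u s))) (at s)"
      using has_vector_derivative_diff[OF has_vector_derivative_const prim_deriv[OF cu that(1)]] by simp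
    then show "(g n has_vector_derivative - exp (- 2 * z * of_real (u s))) (at s)"
      by (rule has_vector_derivative_transform_within_open[where S = "{a<..<x}"])
        (use that in \<open>auto simp: g_def ramp1 G_def\<close>)
  qed
  define Fn where "Fn n = (LINT s:{a - \<tau> n..a}|lebesgue. e s * qt s)" for n
  have qpart: "(LINT s|lebesgue. e s * qt s * ddx (g n) s) = of_real (real (Suc n)) * prim u z a x * Fn n - \<phi> x" for n
  proof -
    have ae: "AE s in lebesgue. s \<notin> {a - \<tau> n, a, x}"
      unfolding ae_lebesgue_iff_negligible by (rule negligible_subset[OF negligible_finite[of "{a - \<tau> n, a, x}"]]) auto
    have dphi: "AE s in lebesgue. ddx \<phi> s = em s * qt s"
      using ddx_mult_ae[OF em f] ddx_exp_ae[OF u, of "- z"]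
      unfolding \<phi>_def em_def[abs_def, symmetric]
      by eventually_elim (simp add: qt_def em_def algebra_simps)
    have i1: "integrable lebesgue (\<lambda>s. of_real (real (Suc n)) * prim u z a x * (indicator {a - \<tau> n..a} s *\<^sub>R (e s * qt s)))"
      using eq_int[of "a - \<tau> n" a] unfolding set_integrable_def by (rule integrable_mult_right)
    have i2: "integrable lebesgue (\<lambda>s. indicator {a..x} s *\<^sub>R ddx \<phi> s)"
      using L2loc_integrable[OF L2loc_ddx[OF phi_H1], of a x] by (simp add: set_integrable_def)
    have "(LINT s|lebesgue. e s * qt s * ddx (g n) s) =
       (LINT s|lebesgue. of_real (real (Suc n)) * prim u z a x * (indicator {a - \<tau> n..a} s *\<^sub>R (e s * qt s))
          - indicator {a..x} s *\<^sub>R ddx \<phi> s)"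
    proof (rule integral_cong_AE)
      have "ddx (g n) \<in> L2loc" using gH[of n] by (intro L2loc_ddx) (simp add: H1c_def)
      then show "(\<lambda>s. e s * qt s * ddx (g n) s) \<in> borel_measurable lebesgue"
        using qt L2loc_continuous[OF ce] by measurable
      show "(\<lambda>s. of_real (real (Suc n)) * prim u z a x * (indicator {a - \<tau> n..a} s *\<^sub>R (e s * qt s))
          - indicator {a..x} s *\<^sub>R ddx \<phi> s) \<in> borel_measurable lebesgue"
        using i1 i2 by (intro borel_measurable_integrable Bochner_Integration.integrable_diff)
      show "AE s in lebesgue. e s * qt s * ddx (g n) s = of_real (real (Suc n)) * prim u z a x * (indicator {a - \<tau> n..a} s *\<^sub>R (e s * qt s))
          - indicator {a..x} s *\<^sub>R ddx \<phi> s"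
        using ae dphi
      proof eventually_elim
        case (elim s)
        consider "s < a - \<tau> n \<or> x < s" | "a - \<tau> n < s" "s < a" | "a < s" "s < x" using elim(1) by fastforce
        then show ?case
        proof cases
          case 1
          then have "ddx (g n) s = 0" by (intro ddx_eq_0_outside[of "a - \<tau> n" x "g n" s] gsupp) auto
          then show ?thesis using 1 ax \<tau>(1)[of n] by (auto simp: indicator_def)
        next
          case 2
          then show ?thesis using ax by (simp add: g'1[OF 2] indicator_def mult_ac)
        next
          case 3
          \<comment> \<open>Between a and x the integrand becomes -\<phi>', because \<phi>' = exp
            (-z u) f^[1] almost everywhere.\<close>
          have "e s * exp (- 2 * z * of_real (u s)) = em s"
            by (simp add: e_def em_def flip: exp_add)
          then have "e s * qt s * - exp (- 2 * z * of_real (u s)) = - (em s * qt s)"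
            by (metis (no_types, lifting) mult.commute mult.left_commute mult_minus_right)
          then show ?thesis using 3 by (simp add: g'2[OF 3] elim(2) indicator_def)
        qed
      qed
    qed
    also have "\<dots> = of_real (real (Suc n)) * prim u z a x * Fn n - (LINT s:{a..x}|lebesgue. ddx \<phi> s)"
      by (subst Bochner_Integration.integral_diff[OF i1 i2])
        (simp only: Fn_def set_lebesgue_integral_def integral_mult_right_zero)
    also have "(LINT s:{a..x}|lebesgue. ddx \<phi> s) = \<phi> x"
      using H1loc_ftc[OF phi_H1 less_imp_le[OF ax]] by (simp add: phia)
    finally show ?thesis .
  qed
  have eqn: "of_real (real (Suc n)) * prim u z a x * Fn n - \<phi> x
      + (LINT s|lborel. (potential u z s * (f s * e s)) * g n s) = z\<^sup>2 * (LINT s|M. (f s * e s) * g n s)" for n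
  proof -
    have "(LINT s|lebesgue. potential u z s * (f s * (e s * g n s))) = (LINT s|lborel. (potential u z s * (f s * e s)) * g n s)"
      unfolding potential_def
      by (subst integral_completion)
        (auto simp: mult_ac intro!: borel_measurable_continuous_onI continuous_intros cu cf ce cg)
    moreover have "(LINT s|lebesgue. e s * qt s * ddx (g n) s) +
       (LINT s|lebesgue. potential u z s * (f s * (e s * g n s))) = z\<^sup>2 * (LINT s|M. f s * (e s * g n s))"
      unfolding e_def qt_def by (rule solution_gauged_weak_form[OF D isol gH])
    ultimately show ?thesis unfolding qpart by (simp only: mult.assoc)
  qed
  have limF: "(\<lambda>n. of_real (real (Suc n)) * Fn n) \<longlonglongrightarrow> e a"
  proof -
    have "(\<lambda>n. of_real (real (Suc n)) * Fn n) \<longlonglongrightarrow> e a * q a"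
      unfolding Fn_def \<tau>_def
    proof (rule tendsto_left_average[OF _ _ eq_int])
      show "AE x in lebesgue. e x * qt x = e x * q x"
        using q unfolding is_quasi_derivative_def qt_def by (auto elim!: eventually_mono)
      show "continuous (at_left a) (\<lambda>x. e x * q x)"
        using q ce[of UNIV] by (intro continuous_mult)
          (auto simp: is_quasi_derivative_def continuous_on_eq_continuous_at continuous_at_imp_continuous_at_within)
    qed
    then show ?thesis by (simp add: qa)
  qed
  define CG where "CG = C * (x - a)"
  have Gbd: "norm (G s) \<le> CG" for s
  proof -
    have "norm (G s) = norm (prim u z a x - prim u z a (max a (min x s)))" by (simp add: G_def)
    also have "\<dots> \<le> C * \<bar>x - max a (min x s)\<bar>"
      using ax by (intro prim_lipschitz[OF cu, of a x] C(2)) auto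
    also have "\<dots> \<le> CG" unfolding CG_def using C(1) ax by (intro mult_left_mono) auto
    finally show ?thesis .
  qed
  have gbd: "norm (g n s) \<le> CG" for n s
  proof -
    have "norm (ramp n s) \<le> 1" by (simp add: ramp_def)
    then have "norm (g n s) \<le> CG * 1" unfolding g_def norm_mult using Gbd[of s] order_trans[OF norm_ge_zero Gbd[of s]]
      by (intro mult_mono) auto
    then show ?thesis by simp
  qed
  have gsupp': "g n s = 0" if "s \<notin> {a - 1..x}" for n s
    using gsupp[of s n] that \<tau>(2)[of n] by auto
  have limN: "(\<lambda>n. LINT s|N. (c s * (f s * e s)) * g n s) \<longlonglongrightarrow> (LINT s|N. c s * (kern u z a x s * \<phi> (max a s)))"
    if N: "sets N = sets borel" "\<And>K. compact K \<Longrightarrow> emeasure N K < \<infinity>" and c: "continuous_on UNIV c"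
    for c :: "real \<Rightarrow> complex" and N :: "real measure"
  proof (rule tendsto_integral_ramp[OF N _ cg _ _ gbd gsupp'])
    show "continuous_on UNIV (\<lambda>s. c s * (f s * e s))" by (intro continuous_intros c cf ce)
    have ck: "continuous_on UNIV (kern u z a x)"
      unfolding kern_def[abs_def] G_def[symmetric] by (intro continuous_intros cG cu)
    have cm: "continuous_on UNIV (\<lambda>s. \<phi> (max a s))"
      by (rule continuous_on_compose2[OF cphi[of UNIV]]) (auto intro!: continuous_intros)
    show "(\<lambda>s. c s * (kern u z a x s * \<phi> (max a s))) \<in> borel_measurable borel"
      by (intro borel_measurable_continuous_onI continuous_intros c ck cm)
    fix s
    show "(\<lambda>n. c s * (f s * e s) * g n s) \<longlonglongrightarrow> c s * (kern u z a x s * \<phi> (max a s))"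
    proof (cases "a \<le> s")
      case True
      have ee: "exp (2 * z * of_real (u s)) * em s = e s"
        by (simp add: e_def em_def flip: exp_add)
      have "\<phi> (max a s) = em s * f s" using True by (simp add: \<phi>_def em_def max_def)
      moreover have "kern u z a x s = G s * exp (2 * z * of_real (u s))" by (simp add: kern_def G_def)
      ultimately have "kern u z a x s * \<phi> (max a s) = G s * (exp (2 * z * of_real (u s)) * em s * f s)"
        by (simp only: mult.assoc)
      then have "kern u z a x s * \<phi> (max a s) = G s * (e s * f s)" by (simp only: ee)
      then show ?thesis using True by (simp add: g_def ramp1 mult_ac)
    next
      case False
      \<comment> \<open>A fixed s < a leaves the support of \<open>g n\<close> for large n; the
        limit expression vanishes there as well because \<phi>(a) = 0.\<close>
      then have "s < a" by simp
      then obtain n0 where n0: "1 / real (Suc n0) < a - s"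
        using reals_Archimedean[of "a - s"] by (auto simp: inverse_eq_divide)
      have "g n s = 0" if "n \<ge> n0" for n
      proof (rule gsupp)
        have "\<tau> n \<le> 1 / real (Suc n0)" unfolding \<tau>_def using that by (intro divide_left_mono) auto
        with n0 show "s \<notin> {a - \<tau> n..x}" by auto
      qed
      then have "\<forall>\<^sub>F n in sequentially. c s * (f s * e s) * g n s = 0"
        by (auto intro: eventually_sequentiallyI)
      then show ?thesis using \<open>s < a\<close> by (simp add: phia max_def tendsto_eventually)
    qed
  qed
  have l1: "(\<lambda>n. LINT s|lborel. (potential u z s * (f s * e s)) * g n s) \<longlonglongrightarrow>
     (LINT s|lborel. potential u z s * (kern u z a x s * \<phi> (max a s)))"
    using emeasure_compact_finite
    by (intro limN) (auto simp: potential_def[abs_def] intro!: continuous_intros cu)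
  have l2: "(\<lambda>n. LINT s|M. (f s * e s) * g n s) \<longlonglongrightarrow> (LINT s|M. kern u z a x s * \<phi> (max a s))"
    using limN[OF Dp(3,4), of "\<lambda>_. 1"] by simp
  have "(\<lambda>n. prim u z a x * (of_real (real (Suc n)) * Fn n) - \<phi> x
      + (LINT s|lborel. (potential u z s * (f s * e s)) * g n s)) \<longlonglongrightarrow>
     prim u z a x * e a - \<phi> x + (LINT s|lborel. potential u z s * (kern u z a x s * \<phi> (max a s)))"
    by (intro tendsto_intros limF l1)
  moreover have "(\<lambda>n. prim u z a x * (of_real (real (Suc n)) * Fn n) - \<phi> x
      + (LINT s|lborel. (potential u z s * (f s * e s)) * g n s)) = (\<lambda>n. z\<^sup>2 * (LINT s|M. (f s * e s) * g n s))"
    using eqn by (simp add: fun_eq_iff mult_ac)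
  moreover have "(\<lambda>n. z\<^sup>2 * (LINT s|M. (f s * e s) * g n s)) \<longlonglongrightarrow> z\<^sup>2 * (LINT s|M. kern u z a x s * \<phi> (max a s))"
    by (intro tendsto_intros l2)
  ultimately have "prim u z a x * e a - \<phi> x + (LINT s|lborel. potential u z s * (kern u z a x s * \<phi> (max a s)))
     = z\<^sup>2 * (LINT s|M. kern u z a x s * \<phi> (max a s))"
    using LIMSEQ_unique by auto
  then show ?thesis by (simp add: e_def algebra_simps)
qed

subsection \<open>Convergence in the phase space\<close>

lemma Dper_functional_tendsto:
  assumes lim: "limitin (Dper_topology l) p q sequentially" and q: "q \<in> Dper l"
    and h: "h \<in> H1c" and g: "g \<in> Cc"
  shows "(\<lambda>k. Dper_functional h g (p k)) \<longlonglongrightarrow> Dper_functional h g q"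
proof (rule topological_tendstoI)
  fix U :: "complex set" assume U: "open U" "Dper_functional h g q \<in> U"
  have "openin (Dper_topology l) {p \<in> Dper l. Dper_functional h g p \<in> U}"
    unfolding Dper_topology_def using U(1) h g by (intro topology_generated_by_Basis) blast
  with lim q U(2) have "\<forall>\<^sub>F k in sequentially. p k \<in> {p \<in> Dper l. Dper_functional h g p \<in> U}"
    unfolding limitin_def by blast
  then show "\<forall>\<^sub>F k in sequentially. Dper_functional h g (p k) \<in> U" by (auto elim: eventually_mono)
qed

text \<open>Setting one of the two test functions to zero decouples the functionals that generate
  the topology into convergence of \<open>omega\<close> and vague convergence of \<mu>.\<close>

lemma zero_in_H1c: "(\<lambda>_. 0 :: complex) \<in> H1c"
proof -
  have "(\<lambda>_. 0 :: complex) \<in> H1loc" by (rule H1loc_lipschitz[of _ 0]) simp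
  then show ?thesis by (auto simp: H1c_def intro: compactly_supportedI)
qed

lemma Dper_tendsto_omega:
  assumes "limitin (Dper_topology l) (\<lambda>k. (uk k, Mk k)) (u, M) sequentially" "(u, M) \<in> Dper l" "h \<in> H1c"
  shows "(\<lambda>k. omega (uk k) h) \<longlonglongrightarrow> omega u h"
  using Dper_functional_tendsto[OF assms H1c_imp_Cc[OF zero_in_H1c]] by (simp add: Dper_functional_def)

lemma Dper_tendsto_integral:
  fixes g :: "real \<Rightarrow> complex"
  assumes "limitin (Dper_topology l) (\<lambda>k. (uk k, Mk k)) (u, M) sequentially" "(u, M) \<in> Dper l" "g \<in> Cc"
  shows "(\<lambda>k. LINT x|Mk k. g x) \<longlonglongrightarrow> (LINT x|M. g x)"
  using Dper_functional_tendsto[OF assms(1,2) zero_in_H1c assms(3)]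
  by (simp add: Dper_functional_def omega_def)

lemma H1loc_of_real:
  fixes f :: "real \<Rightarrow> real"
  assumes f: "f \<in> H1loc"
  shows "(\<lambda>x. complex_of_real (f x)) \<in> H1loc"
proof (rule H1loc_dominated[OF f f])
  show "\<exists>C\<ge>0. \<forall>x\<in>{a..b}. \<forall>y\<in>{a..b}. norm (complex_of_real (f y) - complex_of_real (f x)) \<le> C * (norm (f y - f x) + norm (f y - f x))" for a b
    by (intro exI[of _ 1]) (simp flip: of_real_diff)
qed

lemma ddx_of_real_ae:
  fixes f :: "real \<Rightarrow> real"
  assumes f: "f \<in> H1loc"
  shows "AE x in lebesgue. ddx (\<lambda>x. complex_of_real (f x)) x = of_real (ddx f x)"
  using H1loc_deriv_ae[OF f]
  by eventually_elim (auto intro!: vector_derivative_at has_vector_derivative_of_real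
      simp: has_real_derivative_iff_has_vector_derivative)

lemma H1loc_C1:
  fixes k :: "real \<Rightarrow> real"
  assumes k: "\<And>x. (k has_real_derivative k' x) (at x)" and k': "continuous_on UNIV k'"
  shows "k \<in> H1loc"
proof (rule H1loc_dominated[OF H1loc_id H1loc_id])
  fix a b :: real
  obtain C where C: "C > 0" "\<forall>x\<in>{a..b}. norm (k' x) \<le> C" using continuous_on_interval_bound[OF k'] by blast
  have "norm (k y - k x) \<le> C * (norm (y - x) + norm (y - x))" if "x \<in> {a..b}" "y \<in> {a..b}" for x y
  proof -
    have "norm (k y - k x) \<le> C * norm (y - x)"
      by (rule field_differentiable_bound[of "{a..b}" k k']) (use C that k in \<open>auto intro: DERIV_subset\<close>)
    also have "\<dots> \<le> C * (norm (y - x) + norm (y - x))" using C(1) by (intro mult_left_mono) auto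
    finally show ?thesis .
  qed
  with C(1) show "\<exists>C\<ge>0. \<forall>x\<in>{a..b}. \<forall>y\<in>{a..b}. norm (k y - k x) \<le> C * (norm (y - x) + norm (y - x))"
    by (intro exI[of _ C]) auto
qed

section \<open>Pointwise convergence of u_k by a periodic Green's function\<close>

text \<open>For t in [0, l] the l-periodization at distance t from x is sinh (l - t) + sinh t = 2
  sinh (l/2) cosh (l/2 - t), a multiple of the periodic Green's function of 1 - d^2/dy^2. The
  \<open>max\<close> with 0 makes the support compact.\<close>

definition hat :: "real \<Rightarrow> real \<Rightarrow> real \<Rightarrow> complex" where
  "hat l x y = of_real (sinh (max 0 (l - \<bar>y - x\<bar>)))"

lemma hat_H1c:
  assumes l: "l > 0"
  shows "hat l x \<in> H1c"
proof -
  have "norm (hat l x y - hat l x y') \<le> cosh l * \<bar>y - y'\<bar>" for y y'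
  proof -
    have "norm (hat l x y - hat l x y') = norm (sinh (max 0 (l - \<bar>y - x\<bar>)) - sinh (max 0 (l - \<bar>y' - x\<bar>)))"
      unfolding hat_def of_real_diff[symmetric] norm_of_real real_norm_def ..
    also have "\<dots> \<le> cosh l * norm (max 0 (l - \<bar>y - x\<bar>) - max 0 (l - \<bar>y' - x\<bar>))"
    proof (rule field_differentiable_bound[of "{0..l}" sinh cosh])
      fix t :: real assume "t \<in> {0..l}"
      then show "norm (cosh t) \<le> cosh l" by (simp add: cosh_real_nonneg_le_iff)
      show "(sinh has_field_derivative cosh t) (at t within {0..l})" by (auto intro!: derivative_eq_intros)
    qed (use l in auto)
    also have "\<dots> \<le> cosh l * \<bar>y - y'\<bar>" by (intro mult_left_mono) auto
    finally show ?thesis .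
  qed
  then have "hat l x \<in> H1loc" by (rule H1loc_lipschitz)
  moreover have "compactly_supported (hat l x)"
    by (rule compactly_supportedI[of "x - l" "x + l"]) (auto simp: hat_def max_def)
  ultimately show ?thesis by (simp add: H1c_def)
qed

text \<open>The function \<open>hat l x\<close> solves \<open>h = h''\<close> away from the kinks \<open>x - l\<close>, \<open>x\<close> and \<open>x + l\<close>, so integrating
  by parts only leaves the values of \<open>u\<close> there, and these agree by periodicity.\<close>
lemma omega_hat:
  fixes u :: "real \<Rightarrow> real"
  assumes u: "u \<in> H1loc" and per: "\<And>x. u (x + l) = u x" and l: "l > 0"
  shows "omega u (hat l x) = of_real ((2 * cosh l - 2) * u x)"
proof -
  define k1 where "k1 y = - cosh (l - (y - x))" for y
  define k2 where "k2 y = cosh (l + (y - x))" for y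
  have d1: "(k1 has_real_derivative sinh (l - (y - x))) (at y)" for y
    unfolding k1_def[abs_def] by (auto intro!: derivative_eq_intros)
  have d2: "(k2 has_real_derivative sinh (l + (y - x))) (at y)" for y
    unfolding k2_def[abs_def] by (auto intro!: derivative_eq_intros)
  define U where "U y = complex_of_real (u y)" for y
  define C1 where "C1 y = complex_of_real (k1 y)" for y
  define C2 where "C2 y = complex_of_real (k2 y)" for y
  have U: "U \<in> H1loc" unfolding U_def[abs_def] by (rule H1loc_of_real[OF u])
  have c1: "C1 \<in> H1loc" unfolding C1_def[abs_def]
    by (intro H1loc_of_real H1loc_C1[OF d1] continuous_intros)
  have c2: "C2 \<in> H1loc" unfolding C2_def[abs_def]
    by (intro H1loc_of_real H1loc_C1[OF d2] continuous_intros)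
  have dC1: "ddx C1 y = of_real (sinh (l - (y - x)))" for y
    unfolding C1_def[abs_def] by (intro vector_derivative_at has_vector_derivative_of_real d1)
  have dC2: "ddx C2 y = of_real (sinh (l + (y - x)))" for y
    unfolding C2_def[abs_def] by (intro vector_derivative_at has_vector_derivative_of_real d2)
  have UC1: "(\<lambda>y. U y * C1 y) \<in> H1loc" and UC2: "(\<lambda>y. U y * C2 y) \<in> H1loc"
    by (intro H1loc_mult U c1 c2)+
  have h: "hat l x \<in> H1c" by (rule hat_H1c[OF l])
  have hl: "hat l x \<in> H1loc" using h by (simp add: H1c_def)
  have h0: "hat l x y = 0" if "y \<notin> {x - l..x + l}" for y using that by (auto simp: hat_def max_def)
  have dh1: "ddx (hat l x) y = C1 y" if "x < y" "y < x + l" for y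
  proof (rule vector_derivative_at)
    have "((\<lambda>y. sinh (l - (y - x))) has_real_derivative k1 y) (at y)"
      unfolding k1_def by (auto intro!: derivative_eq_intros)
    then have "((\<lambda>y. complex_of_real (sinh (l - (y - x)))) has_vector_derivative C1 y) (at y)"
      unfolding C1_def by (rule has_vector_derivative_of_real)
    then show "(hat l x has_vector_derivative C1 y) (at y)"
      by (rule has_vector_derivative_transform_within_open[where S = "{x<..<x+l}"]) (use that in \<open>auto simp: hat_def\<close>)
  qed
  have dh2: "ddx (hat l x) y = C2 y" if "x - l < y" "y < x" for y
  proof (rule vector_derivative_at)
    have "((\<lambda>y. sinh (l + (y - x))) has_real_derivative k2 y) (at y)"
      unfolding k2_def by (auto intro!: derivative_eq_intros)
    then have "((\<lambda>y. complex_of_real (sinh (l + (y - x)))) has_vector_derivative C2 y) (at y)"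
      unfolding C2_def by (rule has_vector_derivative_of_real)
    then show "(hat l x has_vector_derivative C2 y) (at y)"
      by (rule has_vector_derivative_transform_within_open[where S = "{x-l<..<x}"]) (use that in \<open>auto simp: hat_def\<close>)
  qed
  have lu': "(\<lambda>y. complex_of_real (ddx u y)) \<in> L2loc" by (intro L2loc_of_real L2loc_ddx u)
  have i1: "integrable lebesgue (\<lambda>y. of_real (u y) * hat l x y)"
    by (intro integrable_of_set_integrable[of "x-l" "x+l"] L2loc_mult_integrable L2loc_continuous
        continuous_intros H1loc_continuous_on u hl) (simp add: h0)
  have dh0: "ddx (hat l x) y = 0" if "y \<notin> {x - l..x + l}" for y
    by (rule ddx_eq_0_outside[OF h0 that])
  have i2: "integrable lebesgue (\<lambda>y. of_real (ddx u y) * ddx (hat l x) y)"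
    by (intro integrable_of_set_integrable[of "x-l" "x+l"] L2loc_mult_integrable lu' L2loc_ddx hl) (simp add: dh0)
  have j1: "integrable lebesgue (\<lambda>y. indicator {x..x+l} y *\<^sub>R ddx (\<lambda>y. U y * C1 y) y)"
    using L2loc_integrable[OF L2loc_ddx[OF UC1], of x "x + l"] by (simp add: set_integrable_def)
  have j2: "integrable lebesgue (\<lambda>y. indicator {x-l..x} y *\<^sub>R ddx (\<lambda>y. U y * C2 y) y)"
    using L2loc_integrable[OF L2loc_ddx[OF UC2], of "x - l" x] by (simp add: set_integrable_def)
  have "omega u (hat l x) = (LINT y|lebesgue. of_real (u y) * hat l x y + of_real (ddx u y) * ddx (hat l x) y)"
    unfolding omega_def by (rule Bochner_Integration.integral_add[OF i1 i2, symmetric])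
  also have "\<dots> = (LINT y|lebesgue. indicator {x..x+l} y *\<^sub>R ddx (\<lambda>y. U y * C1 y) y + indicator {x-l..x} y *\<^sub>R ddx (\<lambda>y. U y * C2 y) y)"
  proof (rule integral_cong_AE)
    have ae: "AE y in lebesgue. y \<notin> {x - l, x, x + l}"
      unfolding ae_lebesgue_iff_negligible by (rule negligible_subset[OF negligible_finite[of "{x - l, x, x + l}"]]) auto
    show "AE y in lebesgue. of_real (u y) * hat l x y + of_real (ddx u y) * ddx (hat l x) y =
       indicator {x..x+l} y *\<^sub>R ddx (\<lambda>y. U y * C1 y) y + indicator {x-l..x} y *\<^sub>R ddx (\<lambda>y. U y * C2 y) y"
      using ae ddx_mult_ae[OF U c1] ddx_mult_ae[OF U c2] ddx_of_real_ae[OF u, folded U_def]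
    proof eventually_elim
      case (elim y)
      consider "y \<notin> {x - l..x + l}" | "x - l < y" "y < x" | "x < y" "y < x + l" using elim(1) by fastforce
      then show ?case
      proof cases
        case 1
        then show ?thesis using l by (auto simp: h0 dh0 indicator_def)
      next
        case 2
        have "ddx (\<lambda>y. U y * C2 y) y = U y * of_real (sinh (l + (y - x))) + of_real (ddx u y) * C2 y"
          unfolding elim(3,4) dC2 ..
        moreover have "hat l x y = of_real (sinh (l + (y - x)))" using 2 by (simp add: hat_def)
        ultimately show ?thesis using l 2 by (simp add: dh2 indicator_def U_def[symmetric])
      next
        case 3
        have "ddx (\<lambda>y. U y * C1 y) y = U y * of_real (sinh (l - (y - x))) + of_real (ddx u y) * C1 y"
          unfolding elim(2,4) dC1 ..
        moreover have "hat l x y = of_real (sinh (l - (y - x)))" using 3 by (simp add: hat_def)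
        ultimately show ?thesis using l 3 by (simp add: dh1 indicator_def U_def[symmetric])
      qed
    qed
  qed (use i1 i2 j1 j2 in \<open>auto intro!: borel_measurable_integrable\<close>)
  also have "\<dots> = (LINT y:{x..x+l}|lebesgue. ddx (\<lambda>y. U y * C1 y) y) + (LINT y:{x-l..x}|lebesgue. ddx (\<lambda>y. U y * C2 y) y)"
    unfolding set_lebesgue_integral_def by (rule Bochner_Integration.integral_add[OF j1 j2])
  \<comment> \<open>Here C1 is -cosh l at x and -1 at x + l, while C2 is cosh l at x and 1 at x - l;
    periodicity of u collects these values into 2 cosh l - 2.\<close>
  also have "\<dots> = (U (x + l) * C1 (x + l) - U x * C1 x) + (U x * C2 x - U (x - l) * C2 (x - l))"
    using l by (simp add: H1loc_ftc[OF UC1] H1loc_ftc[OF UC2])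
  also have "\<dots> = of_real ((2 * cosh l - 2) * u x)"
    using per[of x] per[of "x - l"] by (simp add: U_def C1_def C2_def k1_def k2_def algebra_simps)
  finally show ?thesis .
qed

lemma Dper_tendsto_pointwise:
  assumes lim: "limitin (Dper_topology l) (\<lambda>k. (uk k, Mk k)) (u, M) sequentially"
    and D: "(u, M) \<in> Dper l" "\<And>k. (uk k, Mk k) \<in> Dper l" and l: "l > 0"
  shows "(\<lambda>k. uk k x) \<longlonglongrightarrow> u x"
proof -
  have c: "2 * cosh l - 2 \<noteq> 0"
    using cosh_real_strict_mono[of 0 l] l by simp
  have "(\<lambda>k. complex_of_real ((2 * cosh l - 2) * uk k x)) \<longlonglongrightarrow> of_real ((2 * cosh l - 2) * u x)"
    using Dper_tendsto_omega[OF lim D(1) hat_H1c[OF l, of x]]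
    by (simp only: omega_hat[OF DperD(1,2)[OF D(1)] l] omega_hat[OF DperD(1,2)[OF D(2)] l])
  then have "(\<lambda>k. (2 * cosh l - 2) * uk k x) \<longlonglongrightarrow> (2 * cosh l - 2) * u x"
    by (simp only: tendsto_of_real_iff)
  from tendsto_divide[OF this tendsto_const c] c show ?thesis by simp
qed

section \<open>Equicontinuity and locally uniform convergence of u_k\<close>

text \<open>A continuous trapezoid dominates the indicator of \<open>{a..b}\<close>, and its
  integrals converge, hence are bounded in k.\<close>

lemma Dper_mass_bounded:
  assumes lim: "limitin (Dper_topology l) (\<lambda>k. (uk k, Mk k)) (u, M) sequentially"
    and D: "(u, M) \<in> Dper l" "\<And>k. (uk k, Mk k) \<in> Dper l"
  shows "\<exists>m. \<forall>k. measure (Mk k) {a..b} \<le> m"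
proof -
  define g where "g s = complex_of_real (max 0 (1 - max 0 (max (a - s) (s - b))))" for s
  have g: "g \<in> Cc"
    unfolding Cc_def g_def[abs_def]
    by (intro CollectI conjI continuous_intros compactly_supportedI[of "a - 1" "b + 1"]) (auto simp: max_def)
  have "Bseq (\<lambda>k. LINT s|Mk k. g s)"
    using Dper_tendsto_integral[OF lim D(1) g] convergentI convergent_imp_Bseq by blast
  then obtain m where m: "\<And>k. norm (LINT s|Mk k. g s) \<le> m" by (auto simp: Bseq_def)
  have "measure (Mk k) {a..b} \<le> m" for k
  proof -
    note Dp = DperD[OF D(2)[of k]]
    have ig: "integrable (Mk k) g" by (rule Cc_integrable[OF Dp(3,4) g])
    have "measure (Mk k) {a..b} = (LINT s|Mk k. indicator {a..b} s)"
      using Dp(3) sets_eq_imp_space_eq[OF Dp(3)] by simp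
    also have "\<dots> \<le> (LINT s|Mk k. Re (g s))"
    proof (rule integral_mono)
      show "integrable (Mk k) (indicat_real {a..b})"
        using Dp(3,4) by (intro integrable_real_indicator) auto
      show "integrable (Mk k) (\<lambda>s. Re (g s))" using ig by (rule integrable_Re)
    qed (auto simp: g_def indicator_def)
    also have "\<dots> = Re (LINT s|Mk k. g s)" using ig by (rule integral_Re)
    also have "\<dots> \<le> m" using complex_Re_le_cmod[of "LINT s|Mk k. g s"] m[of k] by linarith
    finally show ?thesis .
  qed
  then show ?thesis by blast
qed

text \<open>Integrate |u'| <= e/2 u'^2 + 1/(2e) and bound the integral of u'^2 by \<mu>. The free
  parameter e replaces the square root of the Cauchy-Schwarz inequality; optimising it would give
  Hoelder continuity of order 1/2.\<close>

lemma Dper_modulus: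
  assumes D: "(u, M) \<in> Dper l" and xy: "a \<le> x" "x \<le> y" "y \<le> b" and e: "e > 0"
  shows "\<bar>u y - u x\<bar> \<le> e / 2 * measure M {a..b} + (y - x) / (2 * e)"
proof -
  note Dp = DperD[OF D]
  have L2: "ddx u \<in> L2loc" by (rule L2loc_ddx[OF Dp(1)])
  have i2: "set_integrable lebesgue {x..y} (\<lambda>s. (ddx u s)\<^sup>2)" using L2 by (simp add: L2loc_def)
  have ic: "set_integrable lebesgue {x..y} (\<lambda>s. 1 / (2 * e))" by (rule absolutely_integrable_on_const) auto
  have i1: "set_integrable lebesgue {x..y} (ddx u)" by (rule L2loc_integrable[OF L2])
  have fin: "emeasure M {a..b} < \<infinity>" by (rule Dp(4)) auto
  have sq: "(LINT s:{x..y}|lebesgue. (ddx u s)\<^sup>2) \<le> measure M {a..b}"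
  proof -
    have "ennreal (LINT s:{x..y}|lebesgue. (ddx u s)\<^sup>2) = (\<integral>\<^sup>+s. ennreal (indicator {x..y} s *\<^sub>R (ddx u s)\<^sup>2) \<partial>lebesgue)"
      unfolding set_lebesgue_integral_def using i2
      by (intro nn_integral_eq_integral[symmetric]) (auto simp: set_integrable_def)
    also have "\<dots> \<le> (\<integral>\<^sup>+s\<in>{a..b}. ennreal ((u s)\<^sup>2 + (ddx u s)\<^sup>2) \<partial>lebesgue)"
      using xy by (intro nn_integral_mono) (auto simp: indicator_def intro!: ennreal_leI)
    also have "\<dots> \<le> emeasure M {a..b}" by (rule Dp(5)) simp
    also have "\<dots> = ennreal (measure M {a..b})" using fin by (intro emeasure_eq_ennreal_measure) auto
    finally show ?thesis by simp
  qed
  have pt: "norm (ddx u s) \<le> e / 2 * (ddx u s)\<^sup>2 + 1 / (2 * e)" for s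
  proof -
    have "0 \<le> (e * \<bar>ddx u s\<bar> - 1)\<^sup>2" by simp
    then have "2 * e * \<bar>ddx u s\<bar> \<le> e\<^sup>2 * (ddx u s)\<^sup>2 + 1" by (simp add: power2_diff power_mult_distrib)
    then have "\<bar>ddx u s\<bar> \<le> (e\<^sup>2 * (ddx u s)\<^sup>2 + 1) / (2 * e)" using e by (simp add: field_simps)
    also have "\<dots> = e / 2 * (ddx u s)\<^sup>2 + 1 / (2 * e)" using e by (simp add: add_divide_distrib power2_eq_square)
    finally show ?thesis by simp
  qed
  have i3: "set_integrable lebesgue {x..y} (\<lambda>s. e / 2 * (ddx u s)\<^sup>2)" using i2 by (intro set_integrable_mult_right) auto
  have "\<bar>u y - u x\<bar> = norm (LINT s:{x..y}|lebesgue. ddx u s)" by (simp add: H1loc_ftc[OF Dp(1) xy(2)])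
  also have "\<dots> \<le> (LINT s:{x..y}|lebesgue. norm (ddx u s))" by (rule set_integral_norm_bound[OF i1])
  also have "\<dots> \<le> (LINT s:{x..y}|lebesgue. e / 2 * (ddx u s)\<^sup>2 + 1 / (2 * e))"
    by (intro set_integral_mono set_integrable_norm i1 set_integral_add i3 ic) (rule pt)
  also have "\<dots> = e / 2 * (LINT s:{x..y}|lebesgue. (ddx u s)\<^sup>2) + (y - x) / (2 * e)"
    unfolding set_integral_add(2)[OF i3 ic] using xy by (simp add: set_integral_const)
  also have "\<dots> \<le> e / 2 * measure M {a..b} + (y - x) / (2 * e)"
    using sq e by simp
  finally show ?thesis .
qed

lemma uniform_limit_of_equicontinuous:
  fixes F :: "nat \<Rightarrow> 'a::metric_space \<Rightarrow> 'b::metric_space"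
  assumes S: "compact S" and pt: "\<And>x. x \<in> S \<Longrightarrow> (\<lambda>k. F k x) \<longlonglongrightarrow> G x"
    and eq: "\<And>e. e > 0 \<Longrightarrow> \<exists>d>0. \<forall>k. \<forall>x\<in>S. \<forall>y\<in>S. dist x y < d \<longrightarrow> dist (F k x) (F k y) \<le> e"
  shows "uniform_limit S F G sequentially"
proof (rule uniform_limitI)
  fix e :: real assume "e > 0"
  then have e4: "e / 4 > 0" by simp
  from eq[OF this] obtain d where d: "d > 0" "\<And>k x y. x \<in> S \<Longrightarrow> y \<in> S \<Longrightarrow> dist x y < d \<Longrightarrow> dist (F k x) (F k y) \<le> e / 4"
    by blast
  have dG: "dist (G x) (G y) \<le> e / 4" if "x \<in> S" "y \<in> S" "dist x y < d" for x y
    by (rule tendsto_upperbound[OF tendsto_dist[OF pt[OF that(1)] pt[OF that(2)]]]) (use d(2)[OF that] in auto)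
  obtain T where T: "finite T" "T \<subseteq> S" "S \<subseteq> (\<Union>t\<in>T. ball t d)"
    using compactE_image[OF S, of S "\<lambda>t. ball t d"] d(1) by (metis UN_I centre_in_ball open_ball subsetI)
  have "\<forall>\<^sub>F k in sequentially. \<forall>t\<in>T. dist (F k t) (G t) < e / 4"
    using T(1,2) by (intro eventually_ball_finite ballI tendstoD[OF pt e4]) auto
  then show "\<forall>\<^sub>F k in sequentially. \<forall>x\<in>S. dist (F k x) (G x) < e"
  proof eventually_elim
    case (elim k)
    show ?case
    proof
      fix x assume x: "x \<in> S"
      then obtain t where t: "t \<in> T" "dist t x < d" using T(3) by auto
      with T(2) have tS: "t \<in> S" by auto
      have "dist (F k x) (G x) \<le> dist (F k x) (F k t) + (dist (F k t) (G t) + dist (G t) (G x))"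
        by (meson add_left_mono dist_triangle order_trans)
      also have "\<dots> \<le> e / 4 + (e / 4 + e / 4)"
        using d(2)[OF x tS, of k] dG[OF tS x] elim t by (intro add_mono) (auto simp: dist_commute)
      also have "\<dots> < e" using \<open>e > 0\<close> by simp
      finally show "dist (F k x) (G x) < e" .
    qed
  qed
qed

lemma Dper_uniform_limit:
  assumes lim: "limitin (Dper_topology l) (\<lambda>k. (uk k, Mk k)) (u, M) sequentially"
    and D: "(u, M) \<in> Dper l" "\<And>k. (uk k, Mk k) \<in> Dper l" and l: "l > 0"
  shows "uniform_limit {a..b} uk u sequentially"
proof (rule uniform_limit_of_equicontinuous)
  show "(\<lambda>k. uk k x) \<longlonglongrightarrow> u x" for x by (rule Dper_tendsto_pointwise[OF lim D l])
  obtain m where m: "\<And>k. measure (Mk k) {a..b} \<le> m" using Dper_mass_bounded[OF lim D] by blast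
  have m0: "m \<ge> 0" using order_trans[OF measure_nonneg m] .
  fix e :: real assume e: "e > 0"
  \<comment> \<open>With \<eta> as parameter in \<open>Dper_modulus\<close> and y - x < \<eta> e,
    both terms of the modulus are at most e / 2; the summand 1 covers m = 0.\<close>
  define \<eta> where "\<eta> = e / (m + 1)"
  have \<eta>: "\<eta> > 0" using e m0 by (simp add: \<eta>_def)
  have main: "\<bar>uk k y - uk k x\<bar> \<le> e" if "x \<in> {a..b}" "y \<in> {a..b}" "x \<le> y" "y - x < \<eta> * e" for k x y
  proof -
    have "\<bar>uk k y - uk k x\<bar> \<le> \<eta> / 2 * measure (Mk k) {a..b} + (y - x) / (2 * \<eta>)"
      using that \<eta> by (intro Dper_modulus[OF D(2)]) auto
    also have "\<dots> \<le> \<eta> / 2 * (m + 1) + \<eta> * e / (2 * \<eta>)"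
      using m[of k] that \<eta> by (intro add_mono mult_left_mono divide_right_mono) auto
    also have "\<dots> = e"
    proof -
      have "\<eta> * (m + 1) = e" using m0 by (simp add: \<eta>_def)
      moreover have "\<eta> * e / (2 * \<eta>) = e / 2" using \<eta> by simp
      ultimately show ?thesis by simp
    qed
    finally show ?thesis .
  qed
  show "\<exists>d>0. \<forall>k. \<forall>x\<in>{a..b}. \<forall>y\<in>{a..b}. dist x y < d \<longrightarrow> dist (uk k x) (uk k y) \<le> e"
  proof (intro exI[of _ "\<eta> * e"] conjI allI ballI impI)
    fix k x y assume "x \<in> {a..b}" "y \<in> {a..b}" "dist x y < \<eta> * e"
    then show "dist (uk k x) (uk k y) \<le> e"
      using main[of x y k] main[of y x k] by (cases "x \<le> y") (auto simp: dist_real_def abs_minus_commute)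
  qed (use \<eta> e in auto)
qed auto

section \<open>Continuous convergence and vague limits\<close>

text \<open>On a compact set, uniform convergence to a continuous limit amounts to convergence along
  all convergent sequences of arguments; \<open>uniform_limit_continuous_convergenceD\<close> is the
  converse. Together they reduce uniform statements in z, x or s to limits of sequences of
  values.\<close>

lemma uniform_limit_continuous_convergenceI:
  fixes F :: "nat \<Rightarrow> 'a::metric_space \<Rightarrow> 'b::metric_space"
  assumes S: "compact S" and G: "continuous_on S G"
    and cc: "\<And>s x. (\<And>k. s k \<in> S) \<Longrightarrow> s \<longlonglongrightarrow> x \<Longrightarrow> x \<in> S \<Longrightarrow> (\<lambda>k. F k (s k)) \<longlonglongrightarrow> G x"
  shows "uniform_limit S F G sequentially"
proof (rule ccontr)
  assume "\<not> uniform_limit S F G sequentially"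
  then obtain e where e: "e > 0" "\<not> (\<forall>\<^sub>F k in sequentially. \<forall>x\<in>S. dist (F k x) (G x) < e)"
    by (auto simp: uniform_limit_iff)
  then have "\<exists>\<^sub>F k in sequentially. \<exists>x\<in>S. e \<le> dist (F k x) (G x)"
    by (simp add: not_eventually not_less)
  then have inf: "\<forall>n. \<exists>k\<ge>n. \<exists>x\<in>S. e \<le> dist (F k x) (G x)"
    by (simp add: frequently_sequentially)
  then obtain w where "strict_mono (w :: nat \<Rightarrow> nat)" and w: "\<And>j. \<exists>x\<in>S. e \<le> dist (F (w j) x) (G x)"
    using infinite_enumerate[of "{k. \<exists>x\<in>S. e \<le> dist (F k x) (G x)}"]
    by (auto simp: infinite_nat_iff_unbounded_le)
  from w obtain X where X: "\<And>j. X j \<in> S" "\<And>j. e \<le> dist (F (w j) (X j)) (G (X j))" by metis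
  obtain x r where x: "x \<in> S" and r: "strict_mono (r :: nat \<Rightarrow> nat)" and Xr: "(X \<circ> r) \<longlonglongrightarrow> x"
    using S X(1) unfolding compact_def by metis
  define v where "v = w \<circ> r"
  have v: "strict_mono v" unfolding v_def using \<open>strict_mono w\<close> r by (rule strict_mono_o)
  \<comment> \<open>The bad points are available only at the indices v j; filling the other places
    with x gives a full sequence that still converges to x.\<close>
  define s where "s k = (if k \<in> range v then X (r (inv v k)) else x)" for k
  have sv: "s (v j) = X (r j)" for j
    using v by (simp add: s_def inv_f_f strict_mono_imp_inj_on)
  have sS: "s k \<in> S" for k using X(1) x by (simp add: s_def)
  have "s \<longlonglongrightarrow> x"
  proof (rule tendstoI)
    fix d :: real assume "d > 0"
    from tendstoD[OF Xr this] obtain n where n: "\<And>j. j \<ge> n \<Longrightarrow> dist (X (r j)) x < d"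
      by (auto simp: eventually_sequentially)
    have "dist (s k) x < d" if "k \<ge> v n" for k
    proof (cases "k \<in> range v")
      case True
      then obtain j where j: "k = v j" by auto
      with that v have "j \<ge> n" by (simp add: strict_mono_less_eq)
      with n j sv show ?thesis by simp
    next
      case False
      with \<open>d > 0\<close> show ?thesis by (simp add: s_def)
    qed
    then show "\<forall>\<^sub>F k in sequentially. dist (s k) x < d" by (rule eventually_sequentiallyI)
  qed
  from cc[OF sS this x] have "(\<lambda>k. F k (s k)) \<longlonglongrightarrow> G x" .
  from LIMSEQ_subseq_LIMSEQ[OF this v] have 1: "(\<lambda>j. F (v j) (X (r j))) \<longlonglongrightarrow> G x"
    by (simp add: o_def sv)
  have 2: "(\<lambda>j. G (X (r j))) \<longlonglongrightarrow> G x"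
    using continuous_on_tendsto_compose[OF G Xr x] X(1) by (simp add: o_def)
  have "(\<lambda>j. dist (F (v j) (X (r j))) (G (X (r j)))) \<longlonglongrightarrow> 0"
    using tendsto_dist[OF 1 2] by simp
  from order_tendstoD(2)[OF this e(1)] X(2)[of "r _"] show False
    by (auto simp: v_def eventually_sequentially not_less[symmetric])
qed

lemma uniform_limit_continuous_convergenceD:
  fixes F :: "nat \<Rightarrow> 'a::metric_space \<Rightarrow> 'b::metric_space"
  assumes ul: "uniform_limit S F G sequentially" and G: "continuous_on S G"
    and s: "\<And>k. s k \<in> S" "s \<longlonglongrightarrow> x" "x \<in> S"
  shows "(\<lambda>k. F k (s k)) \<longlonglongrightarrow> G x"
proof (rule tendstoI)
  fix e :: real assume "e > 0"
  then have e2: "e / 2 > 0" by simp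
  have "(\<lambda>k. G (s k)) \<longlonglongrightarrow> G x"
    using continuous_on_tendsto_compose[OF G s(2,3)] s(1) by simp
  from tendstoD[OF this e2] uniform_limitD[OF ul e2]
  show "\<forall>\<^sub>F k in sequentially. dist (F k (s k)) (G x) < e"
    by eventually_elim (metis dist_triangle_half_r dist_commute s(1))
qed

lemma norm_integral_le_Cc:
  fixes F :: "real \<Rightarrow> complex"
  assumes N: "sets N = sets borel" "\<And>K. compact K \<Longrightarrow> emeasure N K < \<infinity>"
    and F: "continuous_on UNIV F" "\<And>s. s \<notin> {A..B} \<Longrightarrow> F s = 0" "\<And>s. s \<in> {A..B} \<Longrightarrow> norm (F s) \<le> c"
  shows "norm (LINT s|N. F s) \<le> c * measure N {A..B}"
proof -
  have iF: "integrable N F"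
    using F(1) compactly_supportedI[OF F(2)] by (intro Cc_integrable[OF N]) (auto simp: Cc_def)
  have "norm (LINT s|N. F s) \<le> (LINT s|N. norm (F s))" by (rule integral_norm_bound)
  also have "\<dots> \<le> (LINT s|N. c * indicator {A..B} s)"
  proof (rule integral_mono)
    show "integrable N (\<lambda>s. c * indicat_real {A..B} s)"
      using N by (intro integrable_mult_right integrable_real_indicator) auto
  qed (use iF F in \<open>auto simp: indicator_def\<close>)
  also have "\<dots> = c * measure N {A..B}" using N(1) sets_eq_imp_space_eq[OF N(1)] by simp
  finally show ?thesis .
qed

text \<open>The integral of F k - G is small by uniform convergence and bounded mass, and vague
  convergence handles the fixed G. Continuity on the line together with vanishing outside
  \<open>{A..B}\<close> puts both functions into \<open>Cc\<close>, so mass at A or B produces no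
  boundary term.\<close>

lemma tendsto_integral_vague:
  fixes F :: "nat \<Rightarrow> real \<Rightarrow> complex"
  assumes N: "\<And>k. sets (N k) = sets borel" "\<And>k K. compact K \<Longrightarrow> emeasure (N k) K < \<infinity>"
    and m: "\<And>k. measure (N k) {A..B} \<le> m"
    and vague: "\<And>g :: real \<Rightarrow> complex. g \<in> Cc \<Longrightarrow> (\<lambda>k. LINT s|N k. g s) \<longlonglongrightarrow> (LINT s|N0. g s)"
    and F: "\<And>k. continuous_on UNIV (F k)" "continuous_on UNIV G"
      "\<And>k s. s \<notin> {A..B} \<Longrightarrow> F k s = 0" "\<And>s. s \<notin> {A..B} \<Longrightarrow> G s = 0"
    and ul: "uniform_limit {A..B} F G sequentially"
  shows "(\<lambda>k. LINT s|N k. F k s) \<longlonglongrightarrow> (LINT s|N0. G s)"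
proof -
  have m0: "m \<ge> 0" using order_trans[OF measure_nonneg m] .
  have cs: "compactly_supported (F k)" "compactly_supported G" for k
    by (rule compactly_supportedI[OF F(3)], assumption, rule compactly_supportedI[OF F(4)], assumption)
  have "(\<lambda>k. (LINT s|N k. F k s) - (LINT s|N k. G s)) \<longlonglongrightarrow> 0"
  proof (rule tendstoI)
    fix e :: real assume e: "e > 0"
    then have "e / (m + 1) > 0" using m0 by simp
    from uniform_limitD[OF ul this]
    show "\<forall>\<^sub>F k in sequentially. dist ((LINT s|N k. F k s) - (LINT s|N k. G s)) 0 < e"
    proof eventually_elim
      case (elim k)
      have iF: "integrable (N k) (F k)" and iG: "integrable (N k) G"
        using F(1,2) cs by (auto intro!: Cc_integrable[OF N] simp: Cc_def)
      have "norm ((LINT s|N k. F k s) - (LINT s|N k. G s)) = norm (LINT s|N k. F k s - G s)"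
        using iF iG by (simp add: Bochner_Integration.integral_diff)
      also have "\<dots> \<le> e / (m + 1) * measure (N k) {A..B}"
        using elim F by (intro norm_integral_le_Cc[OF N] continuous_intros) (auto simp: dist_norm less_imp_le)
      also have "\<dots> \<le> e / (m + 1) * m" using m[of k] e m0 by (intro mult_left_mono) auto
      also have "\<dots> < e" using e m0 by (simp add: field_simps)
      finally show ?case by simp
    qed
  qed
  moreover have "(\<lambda>k. LINT s|N k. G s) \<longlonglongrightarrow> (LINT s|N0. G s)"
    using F(2) cs by (intro vague) (simp add: Cc_def)
  ultimately have "(\<lambda>k. ((LINT s|N k. F k s) - (LINT s|N k. G s)) + (LINT s|N k. G s)) \<longlonglongrightarrow> 0 + (LINT s|N0. G s)"
    by (rule tendsto_add)
  then show ?thesis by simp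
qed

subsection \<open>Stability of the Volterra equation\<close>

text \<open>Through \<open>max a s\<close> the function \<psi> is continued constantly to the left
  of a. If \<psi>(a) = 0, the integrands vanish there, and the integrals over the line are integrals
  over \<open>{a..x}\<close>.\<close>

definition volterra :: "(real \<Rightarrow> real) \<Rightarrow> real measure \<Rightarrow> complex \<Rightarrow> real \<Rightarrow> (real \<Rightarrow> complex) \<Rightarrow> real \<Rightarrow> complex" where
  "volterra u M z a \<psi> x = exp (z * of_real (u a)) * prim u z a x
      + (LINT s|lborel. potential u z s * (kern u z a x s * \<psi> (max a s)))
      - z\<^sup>2 * (LINT s|M. kern u z a x s * \<psi> (max a s))"

lemma continuous_on_prim:
  assumes u: "continuous_on UNIV u"
  shows "continuous_on {a..} (prim u z a)"
proof -
  have "continuous (at y within {a..}) (prim u z a)" if "y \<in> {a..}" for y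
  proof -
    have "(\<lambda>t. exp (- 2 * z * complex_of_real (u t))) integrable_on {a..y+1}"
      by (intro integrable_continuous_real continuous_intros continuous_on_subset[OF u]) auto
    from indefinite_integral_continuous_1[OF this] have "continuous_on {a..y+1} (prim u z a)"
      by (simp add: prim_def[abs_def])
    then have "continuous (at y within {a..y+1}) (prim u z a)"
      using that by (simp add: continuous_on_eq_continuous_within)
    moreover have "at y within {a..y+1} = at y within {a..}"
      by (rule at_within_nhd[of y "{..<y+1}"]) auto
    ultimately show ?thesis by simp
  qed
  then show ?thesis by (simp add: continuous_on_eq_continuous_within)
qed

lemma continuous_on_kern:
  assumes u: "continuous_on UNIV u" and x: "a \<le> x"
  shows "continuous_on UNIV (kern u z a x)"
proof -
  have "continuous_on UNIV (\<lambda>s. prim u z a (max a (min x s)))"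
    by (rule continuous_on_compose2[OF continuous_on_prim[OF u]]) (auto intro!: continuous_intros)
  then show ?thesis unfolding kern_def[abs_def] by (intro continuous_intros u)
qed

lemma kern_eq_0: "a \<le> x \<Longrightarrow> x \<le> s \<Longrightarrow> kern u z a x s = 0"
  by (simp add: kern_def)

lemma continuous_on_clamp:
  fixes \<psi> :: "real \<Rightarrow> complex"
  assumes "continuous_on UNIV \<psi>"
  shows "continuous_on UNIV (\<lambda>s. \<psi> (max a s))"
  by (rule continuous_on_compose2[OF assms]) (auto intro!: continuous_intros)

lemma continuous_on_potential:
  "continuous_on UNIV u \<Longrightarrow> continuous_on UNIV (potential u z)"
  unfolding potential_def[abs_def] by (intro continuous_intros)

text \<open>One factor exp (2 Z R) is a Lipschitz constant of \<open>prim\<close>, the other bounds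
  exp (2 z u(s)). The decay x - s at the diagonal is what the weighted norm exploits.\<close>

lemma kern_bound:
  assumes u: "continuous_on UNIV u" and bd: "\<And>t. t \<in> {a..b} \<Longrightarrow> \<bar>u t\<bar> \<le> R" "norm z \<le> Z"
    and xs: "a \<le> s" "s \<le> x" "x \<le> b"
  shows "norm (kern u z a x s) \<le> (exp (2 * Z * R))\<^sup>2 * (x - s)"
proof -
  have e: "norm (exp (c * z * complex_of_real (u t))) \<le> exp (2 * Z * R)" if "t \<in> {a..b}" "norm c = 2" for t c
  proof -
    have "norm (exp (c * z * complex_of_real (u t))) \<le> exp (norm (c * z * complex_of_real (u t)))" by (rule norm_exp)
    also have "norm (c * z * complex_of_real (u t)) \<le> 2 * Z * R"
      unfolding norm_mult norm_of_real that(2) using bd(1)[OF that(1)] bd(2)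
      by (intro mult_mono) (auto intro: order_trans[OF norm_ge_zero])
    finally show ?thesis by simp
  qed
  have "norm (prim u z a x - prim u z a s) \<le> exp (2 * Z * R) * \<bar>x - s\<bar>"
    using xs by (intro prim_lipschitz[OF u, of a b] e) auto
  moreover have "norm (exp (2 * z * complex_of_real (u s))) \<le> exp (2 * Z * R)" using xs by (intro e) auto
  ultimately have "norm (kern u z a x s) \<le> (exp (2 * Z * R) * \<bar>x - s\<bar>) * exp (2 * Z * R)"
    unfolding kern_def norm_mult using xs by (intro mult_mono) (auto simp: max_def min_def)
  then show ?thesis using xs by (simp add: power2_eq_square mult_ac)
qed

text \<open>In the norm weighted by \<open>exp (- L (t - a))\<close> the integral part of \<^const>\<open>volterra\<close> has operator norm
  at most 1/2, because \<open>(x - s) exp (- L (x - s)) \<le> 1 / L\<close>.\<close>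
lemma volterra_stability:
  assumes D: "(u, M) \<in> Dper l" and sol: "solves_ivp u M z a 0 1 f" and ab: "a \<le> b"
    and bd: "\<And>t. t \<in> {a..b} \<Longrightarrow> \<bar>u t\<bar> \<le> R" "norm z \<le> Z" and m: "measure M {a..b} \<le> m"
    and \<psi>: "continuous_on UNIV \<psi>" "\<psi> a = 0"
    and close: "\<And>x. x \<in> {a..b} \<Longrightarrow> norm (volterra u M z a \<psi> x - \<psi> x) \<le> \<epsilon>"
  defines "W \<equiv> (exp (2 * Z * R))\<^sup>2"
  defines "L \<equiv> 2 * ((1/4 + Z * R + Z\<^sup>2 * R\<^sup>2) * W * (b - a) + Z\<^sup>2 * W * m) + 1"
  shows "norm (exp (- z * of_real (u b)) * f b - \<psi> b) \<le> 2 * \<epsilon> * exp (L * (b - a))"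
proof -
  note Dp = DperD[OF D]
  have u: "continuous_on S u" for S by (rule H1loc_continuous_on[OF Dp(1)])
  define \<phi> where "\<phi> y = exp (- z * complex_of_real (u y)) * f y" for y
  have f: "continuous_on S f" for S
    using sol by (intro H1loc_continuous_on) (simp add: solves_ivp_def is_solution_def)
  have \<phi>: "continuous_on UNIV \<phi>" unfolding \<phi>_def[abs_def] by (intro continuous_intros u f)
  have \<phi>a: "\<phi> a = 0" using sol by (simp add: \<phi>_def solves_ivp_def)
  define P where "P = 1/4 + Z * R + Z\<^sup>2 * R\<^sup>2"
  have R0: "R \<ge> 0" using order_trans[OF abs_ge_zero bd(1)[of a]] ab by simp
  have Z0: "Z \<ge> 0" using order_trans[OF norm_ge_zero bd(2)] .
  have m0: "m \<ge> 0" using order_trans[OF measure_nonneg m] .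
  have P0: "P \<ge> 0" using R0 Z0 by (simp add: P_def)
  have W0: "W \<ge> 0" by (simp add: W_def)
  define Q where "Q = P * W * (b - a) + Z\<^sup>2 * W * m"
  have Q0: "Q \<ge> 0" using P0 W0 m0 ab by (simp add: Q_def)
  \<comment> \<open>Q collects the coefficient and kernel bounds integrated against Lebesgue measure
    and M. The choice 2 Q + 1 gives L > 0 and Q / L <= 1/2. It depends only on R, Z, m and b - a, so
    one L can serve a whole sequence of problems.\<close>
  have L: "L = 2 * Q + 1" by (simp add: L_def Q_def P_def)
  have L0: "L > 0" using Q0 L by simp
  have fix_eq: "\<phi> x = volterra u M z a \<phi> x" if "x \<in> {a..b}" for x
    using volterra_equation[OF D sol, of x] that by (simp add: volterra_def \<phi>_def)
  define \<delta> where "\<delta> y = \<phi> y - \<psi> y" for y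
  have \<delta>: "continuous_on UNIV \<delta>" unfolding \<delta>_def[abs_def] by (intro continuous_intros \<phi> \<psi>)
  have \<delta>a: "\<delta> a = 0" by (simp add: \<delta>_def \<phi>a \<psi>)
  have "continuous_on {a..b} (\<lambda>y. norm (\<delta> y) * exp (- L * (y - a)))"
    by (intro continuous_intros continuous_on_subset[OF \<delta>]) auto
  moreover have "{a..b} \<noteq> {}" using ab by simp
  ultimately obtain xs where xs: "xs \<in> {a..b}"
    and xmax: "\<And>y. y \<in> {a..b} \<Longrightarrow> norm (\<delta> y) * exp (- L * (y - a)) \<le> norm (\<delta> xs) * exp (- L * (xs - a))"
    using continuous_attains_sup[OF compact_Icc, of a b "\<lambda>y. norm (\<delta> y) * exp (- L * (y - a))"] by blast
  define N where "N = norm (\<delta> xs) * exp (- L * (xs - a))"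
  have N0: "N \<ge> 0" by (simp add: N_def)
  have \<delta>N: "norm (\<delta> y) \<le> N * exp (L * (y - a))" if "y \<in> {a..b}" for y
  proof -
    have "norm (\<delta> y) * exp (- L * (y - a)) * exp (L * (y - a)) \<le> N * exp (L * (y - a))"
      using xmax[OF that, folded N_def] by (intro mult_right_mono) auto
    then show ?thesis by (simp add: mult.assoc flip: exp_add)
  qed
  have pbd: "norm (potential u z s) \<le> P" if "s \<in> {a..b}" for s
  proof -
    have 1: "norm (z * complex_of_real (u s)) \<le> Z * R"
      using bd(1)[OF that] bd(2) Z0 by (auto simp: norm_mult intro: mult_mono)
    have 2: "norm (z\<^sup>2 * (complex_of_real (u s))\<^sup>2) \<le> Z\<^sup>2 * R\<^sup>2"
      unfolding power_mult_distrib[symmetric] norm_power using 1 by (intro power_mono) auto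
    have "norm (potential u z s) \<le> norm (1/4 - z * complex_of_real (u s)) + norm (z\<^sup>2 * (complex_of_real (u s))\<^sup>2)"
      unfolding potential_def by (rule norm_triangle_ineq)
    also have "norm (1/4 - z * complex_of_real (u s)) \<le> norm (1/4 :: complex) + norm (z * complex_of_real (u s))"
      by (rule norm_triangle_ineq4)
    finally show ?thesis using 1 2 by (simp add: P_def)
  qed
  have kbd: "norm (kern u z a x s * \<delta> (max a s)) \<le> W * N * exp (L * (x - a)) / L" if x: "x \<in> {a..b}" and s: "s \<in> {a..b}" for x s
  proof (cases "s \<le> x")
    case False
    then show ?thesis using x W0 N0 L0 by (simp add: kern_eq_0)
  next
    case True
    have "L * (x - s) \<le> exp (L * (x - s))" using exp_ge_add_one_self[of "L * (x - s)"] by linarith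
    then have t: "(x - s) * exp (L * (s - a)) \<le> exp (L * (x - a)) / L"
    proof -
      assume "L * (x - s) \<le> exp (L * (x - s))"
      then have "L * (x - s) * exp (L * (s - a)) \<le> exp (L * (x - s)) * exp (L * (s - a))"
        by (intro mult_right_mono) auto
      also have "\<dots> = exp (L * (x - a))" by (simp add: algebra_simps flip: exp_add)
      finally show ?thesis using L0 by (simp add: field_simps)
    qed
    have "norm (kern u z a x s * \<delta> (max a s)) = norm (kern u z a x s) * norm (\<delta> s)"
      using s by (simp add: norm_mult max_def)
    also have "\<dots> \<le> (W * (x - s)) * (N * exp (L * (s - a)))"
    proof (rule mult_mono)
      show "norm (kern u z a x s) \<le> W * (x - s)"
        unfolding W_def by (rule kern_bound[OF u bd]) (use x s True in auto)
    qed (use \<delta>N[OF s] W0 True in auto)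
    also have "\<dots> = W * N * ((x - s) * exp (L * (s - a)))" by (simp add: mult_ac)
    also have "\<dots> \<le> W * N * (exp (L * (x - a)) / L)" using W0 N0 t by (intro mult_left_mono) auto
    finally show ?thesis by simp
  qed
  note cl = emeasure_compact_finite
  \<comment> \<open>Both integrals of the equation are covered at once: K is \<open>lborel\<close>
    with c the potential, or M with c = 1.\<close>
  have lin: "(LINT s|K. c s * (kern u z a x s * \<phi> (max a s))) - (LINT s|K. c s * (kern u z a x s * \<psi> (max a s)))
       = (LINT s|K. c s * (kern u z a x s * \<delta> (max a s)))"
    and est: "(\<And>s. s \<in> {a..b} \<Longrightarrow> norm (c s) \<le> B) \<Longrightarrow> B \<ge> 0 \<Longrightarrow>
       norm (LINT s|K. c s * (kern u z a x s * \<delta> (max a s))) \<le> B * (W * N * exp (L * (x - a)) / L) * measure K {a..b}"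
    if K: "sets K = sets borel" "\<And>C. compact C \<Longrightarrow> emeasure K C < \<infinity>" and c: "continuous_on UNIV c"
      and x: "x \<in> {a..b}" for K :: "real measure" and c :: "real \<Rightarrow> complex" and x B
  proof -
    have z0: "kern u z a x s * \<theta> (max a s) = 0" if "s \<notin> {a..b}" "\<theta> a = 0" for s and \<theta> :: "real \<Rightarrow> complex"
      using that x kern_eq_0[of a x s u z] by (cases "s < a") (auto simp: max_def)
    have cc: "continuous_on UNIV (\<lambda>s. c s * (kern u z a x s * \<theta> (max a s)))" if "continuous_on UNIV \<theta>" for \<theta> :: "real \<Rightarrow> complex"
      using x that by (intro continuous_intros c continuous_on_kern u continuous_on_clamp) auto
    have int: "integrable K (\<lambda>s. c s * (kern u z a x s * \<theta> (max a s)))" if "continuous_on UNIV \<theta>" "\<theta> a = 0" for \<theta> :: "real \<Rightarrow> complex"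
      using cc[OF that(1)] z0[of _ \<theta>] that(2)
      by (intro Cc_integrable[OF K]) (auto simp: Cc_def intro!: compactly_supportedI[of a b])
    show "(LINT s|K. c s * (kern u z a x s * \<phi> (max a s))) - (LINT s|K. c s * (kern u z a x s * \<psi> (max a s)))
       = (LINT s|K. c s * (kern u z a x s * \<delta> (max a s)))"
      unfolding Bochner_Integration.integral_diff[OF int[OF \<phi> \<phi>a] int[OF \<psi>], symmetric]
      by (simp add: \<delta>_def algebra_simps)
    assume B: "\<And>s. s \<in> {a..b} \<Longrightarrow> norm (c s) \<le> B" "B \<ge> 0"
    show "norm (LINT s|K. c s * (kern u z a x s * \<delta> (max a s))) \<le> B * (W * N * exp (L * (x - a)) / L) * measure K {a..b}"
    proof (rule norm_integral_le_Cc[OF K cc[OF \<delta>]])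
      show "norm (c s * (kern u z a x s * \<delta> (max a s))) \<le> B * (W * N * exp (L * (x - a)) / L)" if "s \<in> {a..b}" for s
        unfolding norm_mult[of "c s"] using B kbd[OF x that] that by (intro mult_mono) auto
    qed (simp_all add: z0[of _ \<delta>, OF _ \<delta>a])
  qed
  have step: "norm (\<phi> x - volterra u M z a \<psi> x) \<le> N * exp (L * (x - a)) / 2" if x: "x \<in> {a..b}" for x
  proof -
    have eq: "\<phi> x - volterra u M z a \<psi> x = (LINT s|lborel. potential u z s * (kern u z a x s * \<delta> (max a s)))
        - z\<^sup>2 * (LINT s|M. 1 * (kern u z a x s * \<delta> (max a s)))"
    proof -
      have "\<phi> x - volterra u M z a \<psi> x =
        ((LINT s|lborel. potential u z s * (kern u z a x s * \<phi> (max a s))) - (LINT s|lborel. potential u z s * (kern u z a x s * \<psi> (max a s))))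
        - z\<^sup>2 * ((LINT s|M. 1 * (kern u z a x s * \<phi> (max a s))) - (LINT s|M. 1 * (kern u z a x s * \<psi> (max a s))))"
        unfolding fix_eq[OF x] volterra_def by (simp add: algebra_simps)
      also have "(LINT s|lborel. potential u z s * (kern u z a x s * \<phi> (max a s))) - (LINT s|lborel. potential u z s * (kern u z a x s * \<psi> (max a s)))
        = (LINT s|lborel. potential u z s * (kern u z a x s * \<delta> (max a s)))"
        by (rule lin[OF sets_lborel cl continuous_on_potential[OF u] x])
      also have "(LINT s|M. 1 * (kern u z a x s * \<phi> (max a s))) - (LINT s|M. 1 * (kern u z a x s * \<psi> (max a s)))
        = (LINT s|M. 1 * (kern u z a x s * \<delta> (max a s)))"
        by (rule lin[OF Dp(3,4) continuous_on_const x])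
      finally show ?thesis .
    qed
    have e1: "norm (LINT s|lborel. potential u z s * (kern u z a x s * \<delta> (max a s))) \<le> P * (W * N * exp (L * (x - a)) / L) * (b - a)"
      using est[OF sets_lborel cl continuous_on_potential[OF u] x pbd P0] ab by simp
    have e2: "norm (LINT s|M. 1 * (kern u z a x s * \<delta> (max a s))) \<le> 1 * (W * N * exp (L * (x - a)) / L) * measure M {a..b}"
      by (rule est[OF Dp(3,4) continuous_on_const x]) auto
    also have "\<dots> \<le> (W * N * exp (L * (x - a)) / L) * m"
      unfolding mult_1_left by (intro mult_left_mono m) (use W0 N0 L0 in auto)
    finally have e2: "norm (LINT s|M. 1 * (kern u z a x s * \<delta> (max a s))) \<le> (W * N * exp (L * (x - a)) / L) * m" .
    have "norm (z\<^sup>2 * (LINT s|M. 1 * (kern u z a x s * \<delta> (max a s)))) \<le> Z\<^sup>2 * ((W * N * exp (L * (x - a)) / L) * m)"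
      unfolding norm_mult[of "z\<^sup>2"] norm_power using e2 bd(2) Z0 by (intro mult_mono power_mono) auto
    then have "norm (\<phi> x - volterra u M z a \<psi> x) \<le> P * (W * N * exp (L * (x - a)) / L) * (b - a) + Z\<^sup>2 * ((W * N * exp (L * (x - a)) / L) * m)"
      unfolding eq using e1 by (intro norm_triangle_le_diff add_mono)
    also have "\<dots> = (N * exp (L * (x - a))) * (Q / L)"
      by (simp add: Q_def algebra_simps add_divide_distrib diff_divide_distrib)
    also have "\<dots> \<le> (N * exp (L * (x - a))) * (1 / 2)"
      using N0 Q0 L0 L by (intro mult_left_mono) (auto simp: field_simps)
    finally show ?thesis by simp
  qed
  have eN: "norm (\<delta> xs) = N * exp (L * (xs - a))" by (simp add: N_def exp_minus)
  \<comment> \<open>At the maximiser xs of the weighted norm the integral part returns at most half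
    of the left-hand side, which is absorbed.\<close>
  have "norm (\<delta> xs) \<le> norm (\<phi> xs - volterra u M z a \<psi> xs) + norm (volterra u M z a \<psi> xs - \<psi> xs)"
    unfolding \<delta>_def using norm_triangle_ineq[of "\<phi> xs - volterra u M z a \<psi> xs" "volterra u M z a \<psi> xs - \<psi> xs"] by simp
  also have "\<dots> \<le> N * exp (L * (xs - a)) / 2 + \<epsilon>"
    by (intro add_mono step close xs)
  finally have "N * exp (L * (xs - a)) \<le> 2 * \<epsilon>" unfolding eN by simp
  moreover have "N * 1 \<le> N * exp (L * (xs - a))" using N0 L0 xs by (intro mult_left_mono) auto
  ultimately have "N \<le> 2 * \<epsilon>" by simp
  have "norm (\<delta> b) \<le> N * exp (L * (b - a))" using ab by (intro \<delta>N) auto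
  also have "\<dots> \<le> 2 * \<epsilon> * exp (L * (b - a))" using \<open>N \<le> 2 * \<epsilon>\<close> by (intro mult_right_mono) auto
  finally show ?thesis by (simp add: \<delta>_def \<phi>_def)
qed

section \<open>Passage to the limit in the Volterra equation\<close>

lemma prim_uniform_limit:
  assumes ul: "uniform_limit {a..b} uk u sequentially" and u: "continuous_on UNIV u" "\<And>k. continuous_on UNIV (uk k)"
    and z: "zk \<longlonglongrightarrow> z" and ab: "a \<le> b"
  shows "uniform_limit {a..b} (\<lambda>k. prim (uk k) (zk k) a) (prim u z a) sequentially"
proof (rule uniform_limitI)
  fix e :: real assume e: "e > 0"
  have "uniform_limit {a..b} (\<lambda>k t. exp (- 2 * zk k * complex_of_real (uk k t))) (\<lambda>t. exp (- 2 * z * complex_of_real (u t))) sequentially"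
  proof (rule uniform_limit_continuous_convergenceI)
    fix s x assume "\<And>k. s k \<in> {a..b}" "s \<longlonglongrightarrow> x" "x \<in> {a..b}"
    from uniform_limit_continuous_convergenceD[OF ul _ this] u(1)
    have "(\<lambda>k. uk k (s k)) \<longlonglongrightarrow> u x" by (auto intro: continuous_on_subset)
    then show "(\<lambda>k. exp (- 2 * zk k * complex_of_real (uk k (s k)))) \<longlonglongrightarrow> exp (- 2 * z * complex_of_real (u x))"
      by (intro tendsto_intros z)
  qed (auto intro!: continuous_intros continuous_on_subset[OF u(1)])
  moreover have "e / (b - a + 1) > 0" using e ab by simp
  ultimately have "\<forall>\<^sub>F k in sequentially. \<forall>t\<in>{a..b}. dist (exp (- 2 * zk k * complex_of_real (uk k t))) (exp (- 2 * z * complex_of_real (u t))) < e / (b - a + 1)"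
    by (rule uniform_limitD)
  then show "\<forall>\<^sub>F k in sequentially. \<forall>x\<in>{a..b}. dist (prim (uk k) (zk k) a x) (prim u z a x) < e"
  proof eventually_elim
    case (elim k)
    show ?case
    proof
      fix x assume x: "x \<in> {a..b}"
      have i: "(\<lambda>t. exp (- 2 * zk k * complex_of_real (uk k t))) integrable_on {a..x}" "(\<lambda>t. exp (- 2 * z * complex_of_real (u t))) integrable_on {a..x}"
        by (intro integrable_continuous_real continuous_intros continuous_on_subset[OF u(1)] continuous_on_subset[OF u(2)]; auto)+
      have "dist (prim (uk k) (zk k) a x) (prim u z a x) =
         norm (integral {a..x} (\<lambda>t. exp (- 2 * zk k * complex_of_real (uk k t)) - exp (- 2 * z * complex_of_real (u t))))"
        unfolding prim_def dist_norm by (subst Henstock_Kurzweil_Integration.integral_diff[OF i]) simp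
      also have "\<dots> \<le> e / (b - a + 1) * (x - a)"
        using x elim by (intro integral_bound continuous_intros continuous_on_subset[OF u(1)] continuous_on_subset[OF u(2)])
          (auto simp: dist_norm less_imp_le)
      also have "\<dots> \<le> e / (b - a + 1) * (b - a)" using x e ab by (intro mult_left_mono) auto
      also have "\<dots> < e" using e ab by (simp add: field_simps)
      finally show "dist (prim (uk k) (zk k) a x) (prim u z a x) < e" .
    qed
  qed
qed

text \<open>Consistency and stability: the fixed function \<phi> satisfies the k-th equation up to a
  defect that tends to zero uniformly in x, and \<open>volterra_stability\<close> converts this
  defect into a bound at b. Convergent parameters z_k are built in so that uniformity in z can be
  read off from sequences.\<close>

lemma solution_tendsto:
  assumes D: "(u, M) \<in> Dper l" "\<And>k. (uk k, Mk k) \<in> Dper l" and ab: "a \<le> b"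
    and ul: "uniform_limit {a..b} uk u sequentially"
    and m: "\<And>k. measure (Mk k) {a..b} \<le> m"
    and vague: "\<And>g :: real \<Rightarrow> complex. g \<in> Cc \<Longrightarrow> (\<lambda>k. LINT x|Mk k. g x) \<longlonglongrightarrow> (LINT x|M. g x)"
    and z: "zk \<longlonglongrightarrow> z"
    and sol: "solves_ivp u M z a 0 1 f" "\<And>k. solves_ivp (uk k) (Mk k) (zk k) a 0 1 (fk k)"
  shows "(\<lambda>k. fk k b) \<longlonglongrightarrow> f b"
proof -
  have u: "continuous_on S u" and uk: "continuous_on S (uk k)" for S k
    using H1loc_continuous_on DperD(1) D by blast+
  define \<phi> where "\<phi> y = exp (- z * complex_of_real (u y)) * f y" for y
  have f: "continuous_on S f" for S
    using sol(1) by (intro H1loc_continuous_on) (simp add: solves_ivp_def is_solution_def)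
  have \<phi>: "continuous_on S \<phi>" for S unfolding \<phi>_def[abs_def] by (intro continuous_intros u f)
  have \<phi>a: "\<phi> a = 0" using sol(1) by (simp add: \<phi>_def solves_ivp_def)
  have ucc: "(\<lambda>k. uk k (s k)) \<longlonglongrightarrow> u x" if "\<And>k. s k \<in> {a..b}" "s \<longlonglongrightarrow> x" "x \<in> {a..b}" for s x
    by (rule uniform_limit_continuous_convergenceD[OF ul u that])
  have pcc: "(\<lambda>k. prim (uk k) (zk k) a (s k)) \<longlonglongrightarrow> prim u z a x" if "\<And>k. s k \<in> {a..b}" "s \<longlonglongrightarrow> x" "x \<in> {a..b}" for s x
    by (rule uniform_limit_continuous_convergenceD[OF prim_uniform_limit[OF ul u uk z ab] _ that])
      (auto intro: continuous_on_subset[OF continuous_on_prim[OF u]])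
  \<comment> \<open>One limit serves both integrals: Nk is constantly \<open>lborel\<close> with the
    potentials as coefficients, or \<open>Mk\<close> with coefficient 1. The upper ends x k move
    with k, which yields uniformity in x.\<close>
  have conv: "(\<lambda>k. LINT s|Nk k. ck k s * (kern (uk k) (zk k) a (x k) s * \<phi> (max a s))) \<longlonglongrightarrow> (LINT s|N0. c0 s * (kern u z a x0 s * \<phi> (max a s)))"
    if Nk: "\<And>k. sets (Nk k) = sets borel" "\<And>k C. compact C \<Longrightarrow> emeasure (Nk k) C < \<infinity>" "\<And>k. measure (Nk k) {a..b} \<le> m'"
      "\<And>g :: real \<Rightarrow> complex. g \<in> Cc \<Longrightarrow> (\<lambda>k. LINT s|Nk k. g s) \<longlonglongrightarrow> (LINT s|N0. g s)"
      and c: "\<And>k. continuous_on UNIV (ck k)" "continuous_on UNIV c0"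
        "\<And>s y. (\<And>k. s k \<in> {a..b}) \<Longrightarrow> s \<longlonglongrightarrow> y \<Longrightarrow> y \<in> {a..b} \<Longrightarrow> (\<lambda>k. ck k (s k)) \<longlonglongrightarrow> c0 y"
      and x: "\<And>k. x k \<in> {a..b}" "x \<longlonglongrightarrow> x0" "x0 \<in> {a..b}"
    for Nk :: "nat \<Rightarrow> real measure" and N0 :: "real measure" and m' and ck :: "nat \<Rightarrow> real \<Rightarrow> complex" and c0 x x0
  proof (rule tendsto_integral_vague[OF Nk])
    have z0: "kern v w a y s * \<phi> (max a s) = 0" if "s \<notin> {a..b}" "y \<in> {a..b}" for s y v w
      using that kern_eq_0[of a y s v w] by (cases "s < a") (auto simp: max_def \<phi>a)
    show "ck k s * (kern (uk k) (zk k) a (x k) s * \<phi> (max a s)) = 0" if "s \<notin> {a..b}" for k s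
      using z0[OF that x(1)] by simp
    show "c0 s * (kern u z a x0 s * \<phi> (max a s)) = 0" if "s \<notin> {a..b}" for s
      using z0[OF that x(3)] by simp
    show "continuous_on UNIV (\<lambda>s. ck k s * (kern (uk k) (zk k) a (x k) s * \<phi> (max a s)))" for k
      using x(1)[of k] by (intro continuous_intros c continuous_on_kern uk continuous_on_clamp \<phi>) auto
    show c0: "continuous_on UNIV (\<lambda>s. c0 s * (kern u z a x0 s * \<phi> (max a s)))"
      using x(3) by (intro continuous_intros c continuous_on_kern u continuous_on_clamp \<phi>) auto
    show "uniform_limit {a..b} (\<lambda>k s. ck k s * (kern (uk k) (zk k) a (x k) s * \<phi> (max a s))) (\<lambda>s. c0 s * (kern u z a x0 s * \<phi> (max a s))) sequentially"
    proof (rule uniform_limit_continuous_convergenceI)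
      fix s y assume s: "\<And>k. s k \<in> {a..b}" "s \<longlonglongrightarrow> y" "y \<in> {a..b}"
      have "(\<lambda>k. prim (uk k) (zk k) a (max a (min (x k) (s k)))) \<longlonglongrightarrow> prim u z a (max a (min x0 y))"
      proof (rule pcc)
        have mem: "max a (min v w) \<in> {a..b}" if "v \<in> {a..b}" "w \<in> {a..b}" for v w
          using that by auto
        show "max a (min (x k) (s k)) \<in> {a..b}" for k by (rule mem[OF x(1) s(1)])
        show "max a (min x0 y) \<in> {a..b}" by (rule mem[OF x(3) s(3)])
        show "(\<lambda>k. max a (min (x k) (s k))) \<longlonglongrightarrow> max a (min x0 y)"
          by (intro tendsto_max tendsto_min tendsto_const x(2) s(2))
      qed
      moreover have "(\<lambda>k. \<phi> (max a (s k))) \<longlonglongrightarrow> \<phi> (max a y)"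
        by (rule continuous_on_tendsto_compose[OF \<phi>[of UNIV]]) (auto intro!: tendsto_intros s)
      ultimately show "(\<lambda>k. ck k (s k) * (kern (uk k) (zk k) a (x k) (s k) * \<phi> (max a (s k)))) \<longlonglongrightarrow> c0 y * (kern u z a x0 y * \<phi> (max a y))"
        unfolding kern_def by (intro tendsto_intros c(3)[OF s] pcc[OF x] z ucc[OF s])
    qed (auto intro: continuous_on_subset[OF c0])
  qed
  have ulA: "uniform_limit {a..b} (\<lambda>k. volterra (uk k) (Mk k) (zk k) a \<phi>) \<phi> sequentially"
  proof (rule uniform_limit_continuous_convergenceI)
    fix x x0 assume x: "\<And>k. x k \<in> {a..b}" "x \<longlonglongrightarrow> x0" "x0 \<in> {a..b}"
    have eq: "\<phi> x0 = volterra u M z a \<phi> x0"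
      using volterra_equation[OF D(1) sol(1), of x0] x(3) by (simp add: volterra_def \<phi>_def)
    have 1: "(\<lambda>k. LINT s|lborel. potential (uk k) (zk k) s * (kern (uk k) (zk k) a (x k) s * \<phi> (max a s)))
       \<longlonglongrightarrow> (LINT s|lborel. potential u z s * (kern u z a x0 s * \<phi> (max a s)))"
    proof (rule conv[OF sets_lborel emeasure_compact_finite order_refl tendsto_const])
      show "(\<lambda>k. potential (uk k) (zk k) (s k)) \<longlonglongrightarrow> potential u z y" if "\<And>k. s k \<in> {a..b}" "s \<longlonglongrightarrow> y" "y \<in> {a..b}" for s y
        unfolding potential_def by (intro tendsto_intros z ucc that)
    qed (use x in \<open>auto intro: continuous_on_potential u uk\<close>)
    have 2: "(\<lambda>k. LINT s|Mk k. 1 * (kern (uk k) (zk k) a (x k) s * \<phi> (max a s)))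
       \<longlonglongrightarrow> (LINT s|M. 1 * (kern u z a x0 s * \<phi> (max a s)))"
      by (rule conv[OF DperD(3)[OF D(2)] DperD(4)[OF D(2)] m vague]) (use x in auto)
    have 3: "(\<lambda>k. uk k a) \<longlonglongrightarrow> u a" by (rule ucc) (use ab in auto)
    show "(\<lambda>k. volterra (uk k) (Mk k) (zk k) a \<phi> (x k)) \<longlonglongrightarrow> \<phi> x0"
      unfolding eq volterra_def using 2 by (intro tendsto_intros 1 3 z pcc x) simp
  qed (auto intro: \<phi>)
  obtain Z where Z: "\<And>k. norm (zk k) \<le> Z"
    using z convergentI convergent_imp_Bseq[of zk] by (auto simp: Bseq_def convergent_def)
  obtain R0 where R0: "\<forall>t\<in>{a..b}. norm (u t) \<le> R0" using continuous_on_interval_bound[OF u] by blast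
  \<comment> \<open>R0 + 1 bounds u_k on \<open>{a..b}\<close> as soon as u_k is within 1 of u, so
    these constants are valid for all large k.\<close>
  define W where "W = (exp (2 * Z * (R0 + 1)))\<^sup>2"
  define L where "L = 2 * ((1/4 + Z * (R0 + 1) + Z\<^sup>2 * (R0 + 1)\<^sup>2) * W * (b - a) + Z\<^sup>2 * W * m) + 1"
  have "(\<lambda>k. exp (- zk k * complex_of_real (uk k b)) * fk k b) \<longlonglongrightarrow> \<phi> b"
  proof (rule tendstoI)
    fix e :: real assume e: "e > 0"
    \<comment> \<open>After multiplication by the stability constant 2 exp (L (b - a)) this leaves e
      / 2.\<close>
    define \<epsilon> where "\<epsilon> = e / (4 * exp (L * (b - a)))"
    have \<epsilon>: "\<epsilon> > 0" using e by (simp add: \<epsilon>_def)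
    from uniform_limitD[OF ulA \<epsilon>] uniform_limitD[OF ul zero_less_one]
    show "\<forall>\<^sub>F k in sequentially. dist (exp (- zk k * complex_of_real (uk k b)) * fk k b) (\<phi> b) < e"
    proof eventually_elim
      case (elim k)
      have ub: "\<bar>uk k t\<bar> \<le> R0 + 1" if "t \<in> {a..b}" for t
        using elim(2)[rule_format, OF that] R0[rule_format, OF that] by (simp add: dist_real_def)
      have "norm (exp (- zk k * of_real (uk k b)) * fk k b - \<phi> b) \<le> 2 * \<epsilon> * exp (L * (b - a))"
        unfolding L_def W_def
        by (rule volterra_stability[OF D(2) sol(2) ab ub Z m \<phi> \<phi>a])
          (use elim(1) in \<open>auto simp: dist_norm less_imp_le\<close>)
      also have "\<dots> = e / 2" by (simp add: \<epsilon>_def)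
      also have "\<dots> < e" using e by simp
      finally show ?case by (simp add: dist_norm)
    qed
  qed
  moreover have "(\<lambda>k. exp (zk k * complex_of_real (uk k b))) \<longlonglongrightarrow> exp (z * complex_of_real (u b))"
    by (intro tendsto_intros z ucc) (use ab in auto)
  ultimately have "(\<lambda>k. exp (zk k * complex_of_real (uk k b)) * (exp (- zk k * complex_of_real (uk k b)) * fk k b))
     \<longlonglongrightarrow> exp (z * complex_of_real (u b)) * \<phi> b"
    by (intro tendsto_mult)
  then show ?thesis by (simp add: \<phi>_def mult.assoc[symmetric] exp_add[symmetric])
qed

theorem theorem5p2:
  fixes l a :: real
    and u :: "real \<Rightarrow> real" and M :: "real measure"
    and uk :: "nat \<Rightarrow> real \<Rightarrow> real" and Mk :: "nat \<Rightarrow> real measure"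
    and s :: "complex \<Rightarrow> real \<Rightarrow> complex" and sk :: "nat \<Rightarrow> complex \<Rightarrow> real \<Rightarrow> complex"
  assumes "l > 0"
    and "(u, M) \<in> Dper l"
    and "\<And>k. (uk k, Mk k) \<in> Dper l"
    and "\<And>z. solves_ivp u M z a 0 1 (s z)"
    and "\<And>k z. solves_ivp (uk k) (Mk k) z a 0 1 (sk k z)"
    and "limitin (Dper_topology l) (\<lambda>k. (uk k, Mk k)) (u, M) sequentially"
  shows "\<forall>K. compact K \<longrightarrow>
    uniform_limit K (\<lambda>k z. sk k z (a + l)) (\<lambda>z. s z (a + l)) sequentially"
proof (intro allI impI)
  fix K :: "complex set" assume K: "compact K"
  have al: "a \<le> a + l" using assms(1) by simp
  obtain m where m: "\<And>k. measure (Mk k) {a..a+l} \<le> m"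
    using Dper_mass_bounded[OF assms(6,2,3)] by blast
  show "uniform_limit K (\<lambda>k z. sk k z (a + l)) (\<lambda>z. s z (a + l)) sequentially"
  proof (rule uniform_limit_continuous_convergenceI[OF K])
    show "(\<lambda>k. sk k (zk k) (a + l)) \<longlonglongrightarrow> s z (a + l)" if "zk \<longlonglongrightarrow> z" for zk z
      by (rule solution_tendsto[OF assms(2,3) al Dper_uniform_limit[OF assms(6,2,3,1)] m
            Dper_tendsto_integral[OF assms(6,2)] that assms(4,5)])
    \<comment> \<open>The limit lemma applied to the constant sequence of pairs (u, M), with only
      the spectral parameter moving, gives continuity in z.\<close>
    have "(\<lambda>k. s (zk k) (a + l)) \<longlonglongrightarrow> s z (a + l)" if "zk \<longlonglongrightarrow> z" for zk z
      by (rule solution_tendsto[OF assms(2,2) al _ order_refl tendsto_const that assms(4,4)])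
        (simp add: uniform_limit_const)
    then show "continuous_on K (\<lambda>z. s z (a + l))"
      by (auto simp: continuous_on_sequentially o_def)
  qed
qed

end
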